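(* Suppose $p>0$, $p\neq 1$. Then, for every integer $n\geq 1$, the problem $$-u''=\lambda u+a(t)|u|^{p-1}u \ \text{ in } [0,L],\qquad u(0)=u(L)=0, \qquad (\mathrm{P})$$ has a solution with exactly $n-1$ interior nodes if, and only if, $\lambda<\sigma_n$. In such case, (P) has at least two solutions of this type: one with $u'(0)>0$, plus its opposite $-u$. Consequently: \begin{itemize} \item for every $\lambda<\sigma_1$ and any integer $\kappa\geq 1$, (P) possesses at least two solutions with exactly $\kappa-1$ zeroes in $(0,L)$; \item for every pair of integers $\kappa\geq n\geq 1$ and every $\lambda\in[\sigma_n,\sigma_{n+1})$, (P) has at least two solutions with exactly $\kappa$ zeroes in $(0,L)$. \end{itemize}
   Context: Let $L>0$, $\lambda\in\mathbb{R}$, and $0=t_0<s_0<t_1<s_1<\dots<s_{m-1}<t_m<s_m=L$. The weight $a:[0,L]\to[0,+\infty)$ is such that, for every $i\in\{0,\dots,m\}$, the restriction of $a$ to $[t_i,s_i]$ is continuous with $a(t)>0$ for all $t\in[t_i,s_i]$, while $a\equiv 0$ on $(s_j,t_{j+1})$ for every $j\in\{0,\dots,m-1\}$. Set $\sigma_n:=(n\pi/L)^2$ for $n\geq 1$. A solution is a function $u\in C^1[0,L]$ with $u'$ absolutely continuous, $u\not\equiv 0$, satisfying the equation almost everywhere together with the boundary conditions. Interior nodes are the zeroes of $u$ in the open interval $(0,L)$ (every zero of a nontrivial solution is simple, so there are finitely many). *)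

theory Defs
  imports "HOL-Analysis.Analysis"
begin

text \<open>
  A function on \<open>[0,L]\<close> is represented by a total function on the reals whose values outside
  \<open>[0,L]\<close> are irrelevant: continuity and derivatives are taken within \<open>{0..L}\<close> (so they are
  one-sided at the end points), and two functions are different when they differ somewhere
  on \<open>{0..L}\<close>.
\<close>

definition deriv_within :: "real \<Rightarrow> real \<Rightarrow> (real \<Rightarrow> real) \<Rightarrow> real \<Rightarrow> real" where
  "deriv_within a b u x = vector_derivative u (at x within {a..b})"

definition C1_on_interval :: "real \<Rightarrow> real \<Rightarrow> (real \<Rightarrow> real) \<Rightarrow> bool" where
  "C1_on_interval a b u \<longleftrightarrow>
     u differentiable_on {a..b} \<and> continuous_on {a..b} (deriv_within a b u)"

definition abs_continuous_on_interval :: "real \<Rightarrow> real \<Rightarrow> (real \<Rightarrow> real) \<Rightarrow> bool" where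
  "abs_continuous_on_interval a b f \<longleftrightarrow>
     (\<forall>\<epsilon>>0. \<exists>\<delta>>0. \<forall>(N::nat) x y.
        (\<forall>i<N. a \<le> x i \<and> x i \<le> y i \<and> y i \<le> b) \<longrightarrow>
        disjoint_family_on (\<lambda>i. {x i<..<y i}) {..<N} \<longrightarrow>
        (\<Sum>i<N. y i - x i) < \<delta> \<longrightarrow>
        (\<Sum>i<N. \<bar>f (y i) - f (x i)\<bar>) < \<epsilon>)"

definition admissible_weight ::
  "real \<Rightarrow> nat \<Rightarrow> (nat \<Rightarrow> real) \<Rightarrow> (nat \<Rightarrow> real) \<Rightarrow> (real \<Rightarrow> real) \<Rightarrow> bool" where
  "admissible_weight L m t s a \<longleftrightarrow>
     t 0 = 0 \<and> s m = L \<and>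
     (\<forall>i\<le>m. t i < s i) \<and> (\<forall>j<m. s j < t (Suc j)) \<and>
     (\<forall>x\<in>{0..L}. 0 \<le> a x) \<and>
     (\<forall>i\<le>m. continuous_on {t i..s i} a \<and> (\<forall>x\<in>{t i..s i}. 0 < a x)) \<and>
     (\<forall>j<m. \<forall>x\<in>{s j<..<t (Suc j)}. a x = 0)"

definition dirichlet_eigenvalue :: "real \<Rightarrow> nat \<Rightarrow> real" where
  "dirichlet_eigenvalue L n = (real n * pi / L)\<^sup>2"

text \<open>
  For \<open>p < 1\<close> the expression \<open>\<bar>u\<bar> powr (p - 1) * u\<close> is still \<open>0\<close> where \<open>u = 0\<close>,
  as the continuous extension of \<open>\<bar>u\<bar>\<^sup>p\<^sup>-\<^sup>1 u\<close> requires.  The parameter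
  \<open>\<mu>\<close> is the \<open>\<lambda>\<close> of the boundary value problem
  \<open>- u'' = \<lambda> u + a \<bar>u\<bar>\<^sup>p\<^sup>-\<^sup>1 u\<close>, \<open>u 0 = u L = 0\<close>.
\<close>

definition is_solution ::
  "real \<Rightarrow> real \<Rightarrow> real \<Rightarrow> (real \<Rightarrow> real) \<Rightarrow> (real \<Rightarrow> real) \<Rightarrow> bool" where
  "is_solution L p \<mu> a u \<longleftrightarrow>
     C1_on_interval 0 L u \<and>
     abs_continuous_on_interval 0 L (deriv_within 0 L u) \<and>
     (AE x in lebesgue. x \<in> {0..L} \<longrightarrow>
        (\<exists>d. (deriv_within 0 L u has_real_derivative d) (at x within {0..L}) \<and>
             - d = \<mu> * u x + a x * (\<bar>u x\<bar> powr (p - 1) * u x))) \<and>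
     u 0 = 0 \<and> u L = 0 \<and>
     (\<exists>x\<in>{0..L}. u x \<noteq> 0)"

definition interior_nodes :: "real \<Rightarrow> (real \<Rightarrow> real) \<Rightarrow> real set" where
  "interior_nodes L u = {x \<in> {0<..<L}. u x = 0}"

definition nodal_solution ::
  "real \<Rightarrow> real \<Rightarrow> real \<Rightarrow> (real \<Rightarrow> real) \<Rightarrow> nat \<Rightarrow> (real \<Rightarrow> real) \<Rightarrow> bool" where
  "nodal_solution L p \<mu> a k u \<longleftrightarrow>
     is_solution L p \<mu> a u \<and> finite (interior_nodes L u) \<and> card (interior_nodes L u) = k"

definition two_nodal_solutions ::
  "real \<Rightarrow> real \<Rightarrow> real \<Rightarrow> (real \<Rightarrow> real) \<Rightarrow> nat \<Rightarrow> bool" where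
  "two_nodal_solutions L p \<mu> a k \<longleftrightarrow>
     (\<exists>u v. nodal_solution L p \<mu> a k u \<and> nodal_solution L p \<mu> a k v \<and>
            (\<exists>x\<in>{0..L}. u x \<noteq> v x))"

end

theory Submission
  imports Defs "HOL-Complex_Analysis.Great_Picard"
begin

text \<open>
Write a solution in polar coordinates \<open>u = e\<^sup>\<rho> sin \<theta>\<close>, \<open>u' = e\<^sup>\<rho> cos \<theta>\<close>, with \<open>\<theta> = 0\<close> at the
left end.  Nodes are the passages of \<open>\<theta>\<close> through multiples of \<open>\<pi>\<close>, and there \<open>\<theta>' = 1\<close>; so
\<open>\<theta>\<close> passes each of them once and upwards, and a trajectory with \<open>\<theta> L = n \<pi>\<close> is a solution with
exactly \<open>n - 1\<close> interior nodes.  The angle obeys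
\<open>\<theta>' = cos\<^sup>2 \<theta> + \<mu> sin\<^sup>2 \<theta> + a e\<^bsup>(p - 1) \<rho>\<^esup> \<bar>sin \<theta>\<bar>\<^bsup>p + 1\<^esup>\<close>.

Call \<open>e\<^bsup>(p - 1) \<rho>\<^esup>\<close> the coupling.  For \<open>p > 1\<close> it is small for small amplitudes and large for
large ones; for \<open>p < 1\<close> it is the other way round.  Weak coupling gives nearly the linear equation,
for which \<open>\<theta> L < n \<pi>\<close> exactly because \<open>\<mu> < (n \<pi> / L)\<^sup>2\<close> (\<open>weak_coupling_angle_less\<close>).  Strong
coupling makes the angle turn arbitrarily fast on the first interval where \<open>a > 0\<close>, so that
\<open>\<theta> L > n \<pi>\<close> (\<open>strong_coupling_angle_greater\<close>).  An initial amplitude in between gives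
\<open>\<theta> L = n \<pi>\<close>.  The argument needs that the initial amplitude controls the amplitude at all later
times, as long as the trajectory has made at most \<open>n\<close> half turns; this holds in both time directions
because \<open>\<bar>u\<bar>'' \<le> \<bar>\<mu>\<bar> \<bar>u\<bar>\<close> between nodes (\<open>growth_forward\<close>, \<open>growth_over_half_turns\<close>).

An angle defined by shooting need not depend continuously on the amplitude: for \<open>p < 1\<close> the
nonlinearity is not Lipschitz at \<open>0\<close>, and for \<open>p > 1\<close> solutions may blow up.  Decay to zero and
blow-up, respectively, are where the coupling becomes infinite, so it is capped at a constant that
the trajectories between the two initial amplitudes do not exceed within \<open>n\<close> half turns.  The lack of
uniqueness is dealt with in \<open>shooting_without_uniqueness\<close>: Euler polygons do depend continuously on
the initial value, so the intermediate value theorem applies to them, and they converge to a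
trajectory along a subsequence.

Conversely, let \<open>\<mu> \<ge> (n \<pi> / L)\<^sup>2\<close> and cut \<open>[0, L]\<close> into \<open>n\<close> equal intervals.  Comparison with the
first Dirichlet eigenfunction of such an interval shows that a solution vanishes inside it or at its
left end, and that it vanishes inside the first one since \<open>a > 0\<close> there.  This gives at least \<open>n\<close>
interior nodes (\<open>card_interior_nodes_ge\<close>).
\<close>

section \<open>Increments from bounds on the derivative\<close>

lemma deriv_ge_imp_increment_ge:
  fixes f :: "real \<Rightarrow> real"
  assumes "finite D" "a \<le> b" "continuous_on {a..b} f"
    and der: "\<And>x. x \<in> {a<..<b} - D \<Longrightarrow> (f has_real_derivative f' x) (at x)"
    and ge: "\<And>x. x \<in> {a<..<b} - D \<Longrightarrow> c \<le> f' x"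
  shows "c * (b - a) \<le> f b - f a"
proof -
  define S where "S = D \<union> {a, b}"
  have "negligible S"
    using assms(1) by (auto simp: S_def intro: negligible_finite)
  have "(f' has_integral (f b - f a)) {a..b}"
    by (rule fundamental_theorem_of_calculus_interior_strong[OF assms(1,2) _ assms(3)])
      (use der has_real_derivative_iff_has_vector_derivative in blast)
  then have 1: "((\<lambda>x. if x \<in> S then c else f' x) has_integral (f b - f a)) {a..b}"
    by (rule has_integral_spike[OF \<open>negligible S\<close>, rotated]) auto
  have 2: "((\<lambda>x. c) has_integral (b - a) *\<^sub>R c) {a..b}"
    using has_integral_const_real[of c a b] assms(2) by simp
  have "(b - a) *\<^sub>R c \<le> f b - f a"
    by (rule has_integral_le[OF 2 1]) (use ge in \<open>auto simp: S_def\<close>)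
  then show ?thesis by (simp add: mult.commute)
qed

lemma deriv_le_imp_increment_le:
  fixes f :: "real \<Rightarrow> real"
  assumes "finite D" "a \<le> b" "continuous_on {a..b} f"
    and der: "\<And>x. x \<in> {a<..<b} - D \<Longrightarrow> (f has_real_derivative f' x) (at x)"
    and le: "\<And>x. x \<in> {a<..<b} - D \<Longrightarrow> f' x \<le> c"
  shows "f b - f a \<le> c * (b - a)"
proof -
  have "(- c) * (b - a) \<le> (- f b) - (- f a)"
  proof (rule deriv_ge_imp_increment_ge[where f' = "\<lambda>x. - f' x", OF assms(1,2)])
    show "continuous_on {a..b} (\<lambda>x. - f x)" using assms(3) by (rule continuous_on_minus)
    show "((\<lambda>x. - f x) has_real_derivative - f' x) (at x)" if "x \<in> {a<..<b} - D" for x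
      using der[OF that] by (rule DERIV_minus)
    show "- c \<le> - f' x" if "x \<in> {a<..<b} - D" for x using le[OF that] by simp
  qed
  then show ?thesis by simp
qed

section \<open>Absolutely continuous functions\<close>

lemma abs_continuous_dominated:
  fixes f g :: "real \<Rightarrow> real"
  assumes f: "abs_continuous_on_interval a b f" and sub: "a \<le> c" "d \<le> b" and "0 \<le> K"
    and dom: "\<And>x y. c \<le> x \<Longrightarrow> x \<le> y \<Longrightarrow> y \<le> d \<Longrightarrow> \<bar>g y - g x\<bar> \<le> \<bar>f y - f x\<bar> + K * (y - x)"
  shows "abs_continuous_on_interval c d g"
  unfolding abs_continuous_on_interval_def
proof (intro allI impI)
  fix e :: real assume "e > 0"
  then obtain \<delta> where "\<delta> > 0" and \<delta>: "\<And>(N::nat) x y. (\<forall>i<N. a \<le> x i \<and> x i \<le> y i \<and> y i \<le> b) \<Longrightarrow>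
        disjoint_family_on (\<lambda>i. {x i<..<y i}) {..<N} \<Longrightarrow>
        (\<Sum>i<N. y i - x i) < \<delta> \<Longrightarrow> (\<Sum>i<N. \<bar>f (y i) - f (x i)\<bar>) < e / 2"
    using f[unfolded abs_continuous_on_interval_def, THEN spec, THEN mp, OF half_gt_zero[OF \<open>e > 0\<close>]]
    by blast
  \<comment> \<open>Half of \<open>e\<close> is for \<open>f\<close> and half for the linear term.\<close>
  define \<delta>' where "\<delta>' = min \<delta> (e / (2 * (K + 1)))"
  show "\<exists>\<delta>>0. \<forall>(N::nat) x y.
        (\<forall>i<N. c \<le> x i \<and> x i \<le> y i \<and> y i \<le> d) \<longrightarrow>
        disjoint_family_on (\<lambda>i. {x i<..<y i}) {..<N} \<longrightarrow>
        (\<Sum>i<N. y i - x i) < \<delta> \<longrightarrow>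
        (\<Sum>i<N. \<bar>g (y i) - g (x i)\<bar>) < e"
  proof (intro exI[of _ \<delta>'] conjI allI impI)
    show "\<delta>' > 0" using \<open>\<delta> > 0\<close> \<open>e > 0\<close> \<open>0 \<le> K\<close> by (auto simp: \<delta>'_def)
    fix N :: nat and x y :: "nat \<Rightarrow> real"
    assume *: "\<forall>i<N. c \<le> x i \<and> x i \<le> y i \<and> y i \<le> d"
      "disjoint_family_on (\<lambda>i. {x i<..<y i}) {..<N}" "(\<Sum>i<N. y i - x i) < \<delta>'"
    have "(\<Sum>i<N. \<bar>g (y i) - g (x i)\<bar>) \<le> (\<Sum>i<N. \<bar>f (y i) - f (x i)\<bar> + K * (y i - x i))"
      using * dom by (intro sum_mono) auto
    also have "\<dots> = (\<Sum>i<N. \<bar>f (y i) - f (x i)\<bar>) + K * (\<Sum>i<N. y i - x i)"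
      by (simp add: sum.distrib sum_distrib_left)
    also have "\<dots> < e / 2 + e / 2"
    proof (rule add_less_le_mono)
      have "\<forall>i<N. a \<le> x i \<and> x i \<le> y i \<and> y i \<le> b" using *(1) sub by (meson order_trans)
      then show "(\<Sum>i<N. \<bar>f (y i) - f (x i)\<bar>) < e / 2"
        using \<delta>[OF _ *(2)] *(3) by (simp add: \<delta>'_def)
      have "(\<Sum>i<N. y i - x i) \<le> e / (2 * (K + 1))" using *(3) by (simp add: \<delta>'_def)
      then have "K * (\<Sum>i<N. y i - x i) \<le> K * (e / (2 * (K + 1)))"
        using \<open>0 \<le> K\<close> by (rule mult_left_mono)
      also have "\<dots> \<le> e / 2" using \<open>e > 0\<close> \<open>0 \<le> K\<close> by (simp add: field_simps)
      finally show "K * (\<Sum>i<N. y i - x i) \<le> e / 2" .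
    qed
    finally show "(\<Sum>i<N. \<bar>g (y i) - g (x i)\<bar>) < e" by simp
  qed
qed

lemma abs_continuous_subinterval:
  assumes "abs_continuous_on_interval a b f" "a \<le> c" "d \<le> b"
  shows "abs_continuous_on_interval c d f"
  by (rule abs_continuous_dominated[OF assms, of 0]) auto

lemma lipschitz_imp_abs_continuous:
  fixes f :: "real \<Rightarrow> real"
  assumes "\<And>x y. a \<le> x \<Longrightarrow> x \<le> y \<Longrightarrow> y \<le> b \<Longrightarrow> \<bar>f y - f x\<bar> \<le> M * (y - x)" "0 \<le> M"
  shows "abs_continuous_on_interval a b f"
proof (rule abs_continuous_dominated[OF _ order_refl order_refl assms(2)])
  show "abs_continuous_on_interval a b (\<lambda>_. 0)"
    unfolding abs_continuous_on_interval_def by (auto intro: exI[of _ 1])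
qed (use assms(1) in auto)

lemma abs_continuous_add_linear:
  assumes "abs_continuous_on_interval a b f"
  shows "abs_continuous_on_interval a b (\<lambda>x. f x + k * x)"
proof (rule abs_continuous_dominated[OF assms order_refl order_refl, of "\<bar>k\<bar>"])
  fix x y :: real assume "x \<le> y"
  then have "\<bar>k * (y - x)\<bar> = \<bar>k\<bar> * (y - x)" by (simp add: abs_mult)
  moreover have "(f y + k * y) - (f x + k * x) = (f y - f x) + k * (y - x)"
    by (simp add: algebra_simps)
  ultimately show "\<bar>(f y + k * y) - (f x + k * x)\<bar> \<le> \<bar>f y - f x\<bar> + \<bar>k\<bar> * (y - x)"
    by (metis abs_triangle_ineq)
qed simp

lemma abs_continuous_uminus:
  assumes "abs_continuous_on_interval a b f"
  shows "abs_continuous_on_interval a b (\<lambda>x. - f x)"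
  by (rule abs_continuous_dominated[OF assms order_refl order_refl, of 0]) auto

lemma abs_continuous_cong:
  assumes "abs_continuous_on_interval b c f" "\<And>x. x \<in> {b..c} \<Longrightarrow> g x = f x"
  shows "abs_continuous_on_interval b c g"
  by (rule abs_continuous_dominated[OF assms(1) order_refl order_refl, of 0]) (auto simp: assms(2))

text \<open>
Absolute continuity is phrased with sequences of intervals; tagged divisions are sets of intervals.
\<close>

lemma abs_continuous_finite_family:
  fixes x y :: "'i \<Rightarrow> real"
  assumes \<delta>: "\<And>(N::nat) x y. (\<forall>i<N. a \<le> x i \<and> x i \<le> y i \<and> y i \<le> b) \<longrightarrow>
        disjoint_family_on (\<lambda>i. {x i<..<y i}) {..<N} \<longrightarrow>
        (\<Sum>i<N. y i - x i) < \<delta> \<longrightarrow> (\<Sum>i<N. \<bar>f (y i) - f (x i)\<bar>) < e"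
    and P: "finite P" "\<And>i. i \<in> P \<Longrightarrow> a \<le> x i \<and> x i \<le> y i \<and> y i \<le> b"
      "disjoint_family_on (\<lambda>i. {x i<..<y i}) P" "(\<Sum>i\<in>P. y i - x i) < \<delta>"
  shows "(\<Sum>i\<in>P. \<bar>f (y i) - f (x i)\<bar>) < e"
proof -
  obtain h where h: "bij_betw h {..<card P} P"
    using ex_bij_betw_nat_finite[OF P(1)] by (auto simp: atLeast0LessThan)
  have hP: "i < card P \<Longrightarrow> h i \<in> P" for i using h by (auto simp: bij_betw_def)
  have "(\<Sum>i<card P. \<bar>f (y (h i)) - f (x (h i))\<bar>) < e"
  proof (rule \<delta>[rule_format])
    show "a \<le> x (h i) \<and> x (h i) \<le> y (h i) \<and> y (h i) \<le> b" if "i < card P" for i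
      using P(2) hP that by blast
    show "disjoint_family_on (\<lambda>i. {x (h i)<..<y (h i)}) {..<card P}"
      unfolding disjoint_family_on_def
    proof (intro ballI impI)
      fix i j assume ij: "i \<in> {..<card P}" "j \<in> {..<card P}" "i \<noteq> j"
      then have "h i \<noteq> h j" using h by (auto simp: bij_betw_def inj_on_def)
      with ij show "{x (h i)<..<y (h i)} \<inter> {x (h j)<..<y (h j)} = {}"
        using P(3) hP by (auto simp: disjoint_family_on_def)
    qed
    show "(\<Sum>i<card P. y (h i) - x (h i)) < \<delta>"
      using P(4) sum.reindex_bij_betw[OF h, of "\<lambda>i. y i - x i"] by simp
  qed
  then show ?thesis
    using sum.reindex_bij_betw[OF h, of "\<lambda>i. \<bar>f (y i) - f (x i)\<bar>"] by simp
qed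

text \<open>
The intervals of a tagged division overlap in end points only, so the lengths of those inside an open
set \<open>U\<close> add up to at most the measure of \<open>U\<close>.
\<close>

lemma tagged_division_sum_length_le_measure:
  fixes p :: "(real \<times> real set) set"
  assumes p: "p tagged_division_of {a..b}" and q: "q \<subseteq> p" "\<And>x K. (x, K) \<in> q \<Longrightarrow> K \<subseteq> U"
    and U: "open U" "emeasure lebesgue U < ennreal \<delta>" and "0 < \<delta>"
  shows "(\<Sum>(x, K)\<in>q. Sup K - Inf K) < \<delta>"
    and "disjoint_family_on (\<lambda>z. {Inf (snd z)<..<Sup (snd z)}) q"
proof -
  have fin: "finite q" using tagged_division_ofD(1)[OF p] q(1) finite_subset by blast
  have K: "\<exists>c d. K = {c..d} \<and> c \<le> d" if "(x, K) \<in> p" for x K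
    using tagged_division_ofD(2,4)[OF p that] by (fastforce simp: box_real)
  show dis: "disjoint_family_on (\<lambda>z. {Inf (snd z)<..<Sup (snd z)}) q"
    unfolding disjoint_family_on_def
  proof (intro ballI impI)
    fix z z' assume zz: "z \<in> q" "z' \<in> q" "z \<noteq> z'"
    obtain x K x' K' where z: "z = (x, K)" "z' = (x', K')" by (cases z, cases z')
    have 0: "interior K \<inter> interior K' = {}"
      using tagged_division_ofD(5)[OF p] zz z q(1) by blast
    obtain c d where 1: "K = {c..d}" "c \<le> d" using K zz z q(1) by blast
    obtain c' d' where 2: "K' = {c'..d'}" "c' \<le> d'" using K zz z q(1) by blast
    show "{Inf (snd z)<..<Sup (snd z)} \<inter> {Inf (snd z')<..<Sup (snd z')} = {}"
      using 0 1 2 z by simp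
  qed
  have len: "measure lebesgue {Inf (snd z)<..<Sup (snd z)} = Sup (snd z) - Inf (snd z)"
    and sub: "{Inf (snd z)<..<Sup (snd z)} \<subseteq> U" if zq: "z \<in> q" for z
  proof -
    obtain x K where z: "z = (x, K)" by (cases z)
    obtain c d where 1: "K = {c..d}" "c \<le> d" using K zq z q(1) by blast
    show "measure lebesgue {Inf (snd z)<..<Sup (snd z)} = Sup (snd z) - Inf (snd z)"
      using 1 z by simp
    have "K \<subseteq> U" using q(2) zq z by blast
    then show "{Inf (snd z)<..<Sup (snd z)} \<subseteq> U" using 1 z by auto
  qed
  have "(\<Sum>(x, K)\<in>q. Sup K - Inf K) = (\<Sum>z\<in>q. measure lebesgue {Inf (snd z)<..<Sup (snd z)})"
    by (rule sum.cong[OF refl]) (simp only: len prod.case_eq_if)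
  also have "\<dots> = measure lebesgue (\<Union>z\<in>q. {Inf (snd z)<..<Sup (snd z)})"
  proof (rule measure_finite_Union[symmetric, OF fin _ dis])
    show "emeasure lebesgue {Inf (snd z)<..<Sup (snd z)} \<noteq> \<infinity>" for z :: "real \<times> real set"
      using emeasure_bounded_finite[of "{Inf (snd z)<..<Sup (snd z)}"] by auto
  qed auto
  also have "\<dots> \<le> measure lebesgue U"
  proof (rule measure_mono_fmeasurable)
    show "U \<in> fmeasurable lebesgue"
      using U by (intro fmeasurableI) (auto simp: less_top[symmetric] intro: order.strict_trans)
    show "(\<Union>z\<in>q. {Inf (snd z)<..<Sup (snd z)}) \<in> sets lebesgue"
      using fin by (intro sets.finite_UN) auto
  qed (use sub in auto)
  also have "\<dots> < \<delta>"
    using U(2) \<open>0 < \<delta>\<close>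
    by (cases "emeasure lebesgue U") (auto simp: measure_def ennreal_less_iff)
  finally show "(\<Sum>(x, K)\<in>q. Sup K - Inf K) < \<delta>" .
qed

text \<open>
A covering argument in the manner of Cousin: near a point with a nonnegative derivative, \<open>f\<close> decreases
by at most \<open>e\<close> times the length of the interval.  The remaining points form a null set, which lies in
an open set of small measure, and over that set absolute continuity bounds the variation of \<open>f\<close>.
\<close>

lemma abs_continuous_deriv_nonneg_imp_le:
  fixes f :: "real \<Rightarrow> real"
  assumes "a \<le> b" and ac: "abs_continuous_on_interval a b f"
    and ae: "AE x in lebesgue. x \<in> {a<..<b} \<longrightarrow> (\<exists>d\<ge>0. (f has_real_derivative d) (at x))"
  shows "f a \<le> f b"
proof (rule field_le_epsilon)
  fix e0 :: real assume "e0 > 0"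
  define e where "e = e0 / (b - a + 1)"
  have e: "e > 0" using \<open>e0 > 0\<close> \<open>a \<le> b\<close> by (simp add: e_def)
  have e0: "e * (b - a) + e = e0"
  proof -
    have "e * (b - a) + e = e * (b - a + 1)" by (simp add: algebra_simps)
    then show ?thesis using \<open>a \<le> b\<close> by (simp add: e_def)
  qed
  from ae obtain N0 where N0': "N0 \<in> null_sets lebesgue"
    "{x \<in> space lebesgue. \<not> (x \<in> {a<..<b} \<longrightarrow> (\<exists>d\<ge>0. (f has_real_derivative d) (at x)))} \<subseteq> N0"
    unfolding eventually_ae_filter by blast
  then have N0: "N0 \<in> null_sets lebesgue"
    "\<And>x. x \<in> {a<..<b} \<Longrightarrow> x \<notin> N0 \<Longrightarrow> \<exists>d\<ge>0. (f has_real_derivative d) (at x)"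
    by auto
  \<comment> \<open>The end points are treated as exceptional, since nothing is known about derivatives there.\<close>
  define N where "N = N0 \<union> {a, b}"
  have N: "N \<in> null_sets lebesgue"
    using N0(1) by (auto simp: N_def intro!: null_sets.Un finite_imp_null_set_lborel null_sets_completionI)
  obtain \<delta> where \<delta>: "\<delta> > 0" "\<And>(N::nat) x y. (\<forall>i<N. a \<le> x i \<and> x i \<le> y i \<and> y i \<le> b) \<longrightarrow>
        disjoint_family_on (\<lambda>i. {x i<..<y i}) {..<N} \<longrightarrow>
        (\<Sum>i<N. y i - x i) < \<delta> \<longrightarrow> (\<Sum>i<N. \<bar>f (y i) - f (x i)\<bar>) < e"
    using ac[unfolded abs_continuous_on_interval_def, THEN spec, THEN mp, OF e]
    by blast
  have "N \<in> sets lebesgue" using N by blast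
  from sets_lebesgue_outer_open[OF this \<delta>(1)]
  obtain U where U: "open U" "N \<subseteq> U" "U - N \<in> lmeasurable" "emeasure lebesgue (U - N) < ennreal \<delta>"
    by metis
  have U': "emeasure lebesgue U < ennreal \<delta>"
    using U emeasure_Diff_null_set[OF N, of U] by auto
  have "\<exists>r>0. \<forall>y. \<bar>y - x\<bar> < r \<longrightarrow> - (e * \<bar>y - x\<bar>) \<le> (if y \<ge> x then f y - f x else f x - f y)"
    if x: "x \<in> {a..b} - N" for x
  proof -
    have "x \<in> {a<..<b}" "x \<notin> N0" using x by (auto simp: N_def)
    then obtain d where d: "d \<ge> 0" "(f has_real_derivative d) (at x)" using N0(2) by blast
    from d(2) have "(f has_derivative (*) d) (at x)" by (simp add: has_field_derivative_def)
    with e obtain r where r: "r > 0" "\<And>y. norm (y - x) < r \<Longrightarrow> norm (f y - f x - d * (y - x)) \<le> e * norm (y - x)"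
      unfolding has_derivative_at_alt by blast
    show ?thesis
    proof (intro exI[of _ r] conjI allI impI)
      fix y assume y: "\<bar>y - x\<bar> < r"
      have 1: "\<bar>f y - f x - d * (y - x)\<bar> \<le> e * \<bar>y - x\<bar>" using r(2)[of y] y by simp
      show "- (e * \<bar>y - x\<bar>) \<le> (if y \<ge> x then f y - f x else f x - f y)"
      proof (cases "y \<ge> x")
        case True
        then have "d * (y - x) \<ge> 0" using d(1) by simp
        with 1 True show ?thesis by simp
      next
        case False
        then have "d * (y - x) \<le> 0" using d(1) by (simp add: mult_nonneg_nonpos)
        with 1 False show ?thesis by simp
      qed
    qed fact
  qed
  then obtain r where r: "\<And>x. x \<in> {a..b} - N \<Longrightarrow> r x > 0"
    "\<And>x y. x \<in> {a..b} - N \<Longrightarrow> \<bar>y - x\<bar> < r x \<Longrightarrow>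
        - (e * \<bar>y - x\<bar>) \<le> (if y \<ge> x then f y - f x else f x - f y)"
    by metis
  define g where "g x = (if x \<in> N then U else if x \<in> {a..b} then ball x (r x) else ball x 1)" for x
  have "gauge g"
    unfolding gauge_def g_def using U(1,2) r(1) by auto
  then obtain p where p: "p tagged_division_of {a..b}" "g fine p"
    using fine_division_exists_real by blast
  have fin: "finite p" using p(1) by blast
  have K: "\<exists>c d. K = {c..d} \<and> c \<le> x \<and> x \<le> d \<and> a \<le> c \<and> d \<le> b" if xK: "(x, K) \<in> p" for x K
  proof -
    obtain c d where "K = {c..d}" using tagged_division_ofD(4)[OF p(1) xK] by (auto simp: box_real)
    moreover have "x \<in> K" "K \<subseteq> {a..b}" using tagged_division_ofD(2,3)[OF p(1) xK] by auto
    ultimately show ?thesis by auto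
  qed
  define q where "q = {z \<in> p. fst z \<in> N}"
  have q: "(\<Sum>(x, K)\<in>q. Sup K - Inf K) < \<delta>"
    "disjoint_family_on (\<lambda>z. {Inf (snd z)<..<Sup (snd z)}) q"
  proof -
    have sub: "q \<subseteq> p" by (auto simp: q_def)
    have "K \<subseteq> U" if "(x, K) \<in> q" for x K
      using fineD[OF p(2), of x K] that by (simp add: q_def g_def)
    from tagged_division_sum_length_le_measure[OF p(1) sub this U(1) U' \<delta>(1)]
    show "(\<Sum>(x, K)\<in>q. Sup K - Inf K) < \<delta>"
      "disjoint_family_on (\<lambda>z. {Inf (snd z)<..<Sup (snd z)}) q" by auto
  qed
  have qsum: "(\<Sum>z\<in>q. \<bar>f (Sup (snd z)) - f (Inf (snd z))\<bar>) < e"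
  proof (rule abs_continuous_finite_family[OF \<delta>(2)])
    show "finite q" using fin by (simp add: q_def)
    show "a \<le> Inf (snd z) \<and> Inf (snd z) \<le> Sup (snd z) \<and> Sup (snd z) \<le> b" if z: "z \<in> q" for z
    proof -
      have "(fst z, snd z) \<in> p" using z by (simp add: q_def)
      from K[OF this] obtain c d where "snd z = {c..d}" "c \<le> fst z" "fst z \<le> d" "a \<le> c" "d \<le> b" by blast
      then show ?thesis by simp
    qed
    show "(\<Sum>z\<in>q. Sup (snd z) - Inf (snd z)) < \<delta>" using q(1) by (simp add: split_beta)
  qed (fact q(2))
  have rest: "- e * (Sup (snd z) - Inf (snd z)) \<le> f (Sup (snd z)) - f (Inf (snd z))" if z: "z \<in> p - q" for z
  proof -
    have zp: "(fst z, snd z) \<in> p" and zN: "fst z \<notin> N" using z by (auto simp: q_def)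
    from K[OF zp] obtain c d where cd: "snd z = {c..d}" "c \<le> fst z" "fst z \<le> d" "a \<le> c" "d \<le> b" by blast
    have x: "fst z \<in> {a..b} - N" using cd zN by auto
    have "snd z \<subseteq> ball (fst z) (r (fst z))" using fineD[OF p(2) zp] zN x by (simp add: g_def)
    moreover have "c \<in> snd z" "d \<in> snd z" using cd by auto
    ultimately have "c \<in> ball (fst z) (r (fst z))" "d \<in> ball (fst z) (r (fst z))" by blast+
    then have "\<bar>c - fst z\<bar> < r (fst z)" "\<bar>d - fst z\<bar> < r (fst z)"
      by (simp_all add: dist_real_def abs_minus_commute)
    from r(2)[OF x this(1)] r(2)[OF x this(2)] cd
    have "f (fst z) - f c \<ge> - (e * (fst z - c))" "f d - f (fst z) \<ge> - (e * (d - fst z))"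
      by (auto split: if_splits)
    then show ?thesis using cd by (simp add: algebra_simps)
  qed
  have len: "(\<Sum>z\<in>p. Sup (snd z) - Inf (snd z)) = b - a"
    using additive_tagged_division_1[OF \<open>a \<le> b\<close> p(1), of "\<lambda>x. x"] by (simp add: split_beta)
  have "- e * (b - a) \<le> - e * (\<Sum>z\<in>p - q. Sup (snd z) - Inf (snd z))"
  proof -
    have "(\<Sum>z\<in>p - q. Sup (snd z) - Inf (snd z)) \<le> (\<Sum>z\<in>p. Sup (snd z) - Inf (snd z))"
    proof (rule sum_mono2[OF fin])
      fix z assume "z \<in> p - (p - q)"
      then have "(fst z, snd z) \<in> p" by auto
      from K[OF this] show "0 \<le> Sup (snd z) - Inf (snd z)" by auto
    qed auto
    then show ?thesis using len e by simp
  qed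
  also have "\<dots> \<le> (\<Sum>z\<in>p - q. f (Sup (snd z)) - f (Inf (snd z)))"
    unfolding sum_distrib_left by (rule sum_mono) (rule rest)
  also have "\<dots> = (\<Sum>z\<in>p. f (Sup (snd z)) - f (Inf (snd z))) - (\<Sum>z\<in>q. f (Sup (snd z)) - f (Inf (snd z)))"
    by (rule sum_diff[OF fin]) (auto simp: q_def)
  also have "(\<Sum>z\<in>p. f (Sup (snd z)) - f (Inf (snd z))) = f b - f a"
    using additive_tagged_division_1[OF \<open>a \<le> b\<close> p(1), of f] by (simp add: split_beta)
  also have "- (\<Sum>z\<in>q. f (Sup (snd z)) - f (Inf (snd z))) \<le> (\<Sum>z\<in>q. \<bar>f (Sup (snd z)) - f (Inf (snd z))\<bar>)"
    using sum_abs[of "\<lambda>z. f (Sup (snd z)) - f (Inf (snd z))" q] by linarith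
  then have "f b - f a - (\<Sum>z\<in>q. f (Sup (snd z)) - f (Inf (snd z))) \<le> f b - f a + e"
    using qsum by linarith
  finally show "f a \<le> f b + e0" using e0 by simp
qed

lemma abs_continuous_bounded_deriv_imp_increment_ge:
  fixes f :: "real \<Rightarrow> real"
  assumes ac: "abs_continuous_on_interval a b f"
    and ae: "AE x in lebesgue. x \<in> {a<..<b} \<longrightarrow> (\<exists>d. (f has_real_derivative d) (at x) \<and> \<bar>d\<bar> \<le> M)"
    and xy: "a \<le> x" "x \<le> y" "y \<le> b"
  shows "f x - f y \<le> M * (y - x)"
proof -
  have ac': "abs_continuous_on_interval x y f"
    using abs_continuous_subinterval[OF ac] xy by auto
  have "f x + M * x \<le> f y + M * y"
  proof (rule abs_continuous_deriv_nonneg_imp_le[OF xy(2) abs_continuous_add_linear[OF ac']])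
    show "AE t in lebesgue. t \<in> {x<..<y} \<longrightarrow> (\<exists>d\<ge>0. ((\<lambda>x. f x + M * x) has_real_derivative d) (at t))"
      using ae
    proof (rule AE_mp, intro AE_I2 impI)
      fix t assume "t \<in> {a<..<b} \<longrightarrow> (\<exists>d. (f has_real_derivative d) (at t) \<and> \<bar>d\<bar> \<le> M)" "t \<in> {x<..<y}"
      with xy obtain d where d: "(f has_real_derivative d) (at t)" "\<bar>d\<bar> \<le> M" by auto
      have "((\<lambda>x. f x + M * x) has_real_derivative d + M) (at t)"
        by (auto intro!: derivative_eq_intros d(1))
      then show "\<exists>d\<ge>0. ((\<lambda>x. f x + M * x) has_real_derivative d) (at t)"
        using d(2) by (intro exI[of _ "d + M"]) auto
    qed
  qed
  then show ?thesis by (simp add: algebra_simps)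
qed

lemma abs_continuous_bounded_deriv_imp_lipschitz:
  fixes f :: "real \<Rightarrow> real"
  assumes ac: "abs_continuous_on_interval a b f" and "0 \<le> M"
    and ae: "AE x in lebesgue. x \<in> {a<..<b} \<longrightarrow> (\<exists>d. (f has_real_derivative d) (at x) \<and> \<bar>d\<bar> \<le> M)"
  shows "M-lipschitz_on {a..b} f"
proof (rule lipschitz_on_leI)
  fix x y assume xy: "x \<in> {a..b}" "y \<in> {a..b}" "x \<le> y"
  have ae': "AE x in lebesgue. x \<in> {a<..<b} \<longrightarrow> (\<exists>d. ((\<lambda>x. - f x) has_real_derivative d) (at x) \<and> \<bar>d\<bar> \<le> M)"
    using ae
  proof (rule AE_mp, intro AE_I2 impI)
    fix t assume "t \<in> {a<..<b} \<longrightarrow> (\<exists>d. (f has_real_derivative d) (at t) \<and> \<bar>d\<bar> \<le> M)" "t \<in> {a<..<b}"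
    then obtain d where d: "(f has_real_derivative d) (at t)" "\<bar>d\<bar> \<le> M" by auto
    then show "\<exists>d. ((\<lambda>x. - f x) has_real_derivative d) (at t) \<and> \<bar>d\<bar> \<le> M"
      using DERIV_minus[OF d(1)] by (intro exI[of _ "- d"]) auto
  qed
  have "f x - f y \<le> M * (y - x)" "- f x - - f y \<le> M * (y - x)"
    using abs_continuous_bounded_deriv_imp_increment_ge[OF ac ae]
      abs_continuous_bounded_deriv_imp_increment_ge[OF abs_continuous_uminus[OF ac] ae'] xy by auto
  then show "dist (f x) (f y) \<le> M * dist x y"
    using xy(3) by (simp add: dist_real_def)
qed fact

section \<open>Sturm comparison and the upper bound on the parameter\<close>

lemma continuous_on_Icc_bounded:
  fixes f :: "real \<Rightarrow> real"
  assumes "continuous_on {a..b} f"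
  obtains B where "0 < B" "\<And>x. x \<in> {a..b} \<Longrightarrow> \<bar>f x\<bar> \<le> B"
proof -
  have "bounded (f ` {a..b})"
    by (intro compact_imp_bounded compact_continuous_image[OF assms] compact_Icc)
  then show thesis using that by (auto simp: bounded_pos)
qed

lemma lipschitz_on_mult_bounded:
  fixes f g :: "real \<Rightarrow> real"
  assumes f: "C-lipschitz_on S f" "\<And>x. x \<in> S \<Longrightarrow> \<bar>f x\<bar> \<le> B"
    and g: "C'-lipschitz_on S g" "\<And>x. x \<in> S \<Longrightarrow> \<bar>g x\<bar> \<le> B'" and "0 \<le> B" "0 \<le> B'"
  shows "(B * C' + B' * C)-lipschitz_on S (\<lambda>x. f x * g x)"
proof (rule lipschitz_onI)
  have nn: "0 \<le> C" "0 \<le> C'" using f g by (auto dest: lipschitz_on_nonneg)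
  then show "0 \<le> B * C' + B' * C" using assms by simp
  fix x y assume xy: "x \<in> S" "y \<in> S"
  have "f x * g x - f y * g y = f x * (g x - g y) + g y * (f x - f y)" by (simp add: algebra_simps)
  then have "\<bar>f x * g x - f y * g y\<bar> \<le> \<bar>f x\<bar> * \<bar>g x - g y\<bar> + \<bar>g y\<bar> * \<bar>f x - f y\<bar>"
    by (metis abs_mult abs_triangle_ineq)
  also have "\<dots> \<le> B * (C' * dist x y) + B' * (C * dist x y)"
    using lipschitz_onD[OF f(1) xy] lipschitz_onD[OF g(1) xy] f(2)[OF xy(1)] g(2)[OF xy(2)] nn assms
    by (intro add_mono mult_mono) (auto simp: dist_real_def)
  finally show "dist (f x * g x) (f y * g y) \<le> (B * C' + B' * C) * dist x y"
    by (simp add: dist_real_def algebra_simps)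
qed

text \<open>
The form in which a solution enters the comparison argument, with \<open>v\<close> in the role of \<open>u'\<close>.  A
Lipschitz continuous \<open>v\<close> stays Lipschitz continuous, hence absolutely continuous, when it is combined
with other \<open>C\<^sup>1\<close> functions to a Wronskian.
\<close>

definition lipschitz_solution ::
  "real \<Rightarrow> real \<Rightarrow> real \<Rightarrow> (real \<Rightarrow> real) \<Rightarrow> (real \<Rightarrow> real) \<Rightarrow> (real \<Rightarrow> real) \<Rightarrow> bool" where
  "lipschitz_solution L p \<mu> a u v \<longleftrightarrow>
     (\<forall>x\<in>{0..L}. (u has_real_derivative v x) (at x within {0..L})) \<and>
     (\<exists>M. M-lipschitz_on {0..L} v) \<and>
     (AE x in lebesgue. x \<in> {0<..<L} \<longrightarrow>
        (v has_real_derivative - (\<mu> * u x + a x * (\<bar>u x\<bar> powr (p - 1) * u x))) (at x))"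

lemma lipschitz_solution_uminus:
  assumes "lipschitz_solution L p \<mu> a u v"
  shows "lipschitz_solution L p \<mu> a (\<lambda>x. - u x) (\<lambda>x. - v x)"
proof -
  have 1: "AE x in lebesgue. x \<in> {0<..<L} \<longrightarrow>
        (v has_real_derivative - (\<mu> * u x + a x * (\<bar>u x\<bar> powr (p - 1) * u x))) (at x)"
    using assms by (simp add: lipschitz_solution_def)
  have 2: "AE x in lebesgue. x \<in> {0<..<L} \<longrightarrow>
        ((\<lambda>x. - v x) has_real_derivative - (\<mu> * - u x + a x * (\<bar>- u x\<bar> powr (p - 1) * - u x))) (at x)"
    using 1
  proof (rule AE_mp, intro AE_I2 impI)
    fix x assume "x \<in> {0<..<L} \<longrightarrow>
        (v has_real_derivative - (\<mu> * u x + a x * (\<bar>u x\<bar> powr (p - 1) * u x))) (at x)" "x \<in> {0<..<L}"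
    then have "(v has_real_derivative - (\<mu> * u x + a x * (\<bar>u x\<bar> powr (p - 1) * u x))) (at x)" by blast
    from DERIV_minus[OF this]
    show "((\<lambda>x. - v x) has_real_derivative - (\<mu> * - u x + a x * (\<bar>- u x\<bar> powr (p - 1) * - u x))) (at x)"
      by (simp add: algebra_simps)
  qed
  show ?thesis
    using assms 2 unfolding lipschitz_solution_def by (auto intro: DERIV_minus)
qed

lemma is_solution_has_derivative:
  assumes "is_solution L p \<mu> a u" "x \<in> {0..L}"
  shows "(u has_real_derivative deriv_within 0 L u x) (at x within {0..L})"
proof -
  have "u differentiable (at x within {0..L})"
    using assms by (auto simp: is_solution_def C1_on_interval_def differentiable_on_def)
  then show ?thesis
    by (simp add: deriv_within_def has_real_derivative_iff_has_vector_derivative vector_derivative_works)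
qed

text \<open>
Since \<open>u\<close> and \<open>a\<close> are bounded, the equation bounds the derivative of the absolutely continuous
function \<open>u'\<close> almost everywhere.
\<close>

lemma is_solution_imp_lipschitz_solution:
  assumes "0 < L" "0 < p" and sol: "is_solution L p \<mu> a u"
    and a: "\<And>x. x \<in> {0..L} \<Longrightarrow> 0 \<le> a x \<and> a x \<le> A"
  shows "lipschitz_solution L p \<mu> a u (deriv_within 0 L u)"
proof -
  let ?v = "deriv_within 0 L u"
  let ?h = "\<lambda>x. \<mu> * u x + a x * (\<bar>u x\<bar> powr (p - 1) * u x)"
  note der = is_solution_has_derivative[OF sol]
  have ae: "AE x in lebesgue. x \<in> {0<..<L} \<longrightarrow> (?v has_real_derivative - ?h x) (at x)"
  proof -
    have "AE x in lebesgue. x \<in> {0..L} \<longrightarrow>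
        (\<exists>d. (?v has_real_derivative d) (at x within {0..L}) \<and> - d = ?h x)"
      using sol by (simp add: is_solution_def)
    then show ?thesis
    proof (rule AE_mp, intro AE_I2 impI)
      fix x assume "x \<in> {0..L} \<longrightarrow>
        (\<exists>d. (?v has_real_derivative d) (at x within {0..L}) \<and> - d = ?h x)" and x: "x \<in> {0<..<L}"
      then obtain d where d: "(?v has_real_derivative d) (at x within {0..L})" "- d = ?h x" by auto
      have "at x within {0..L} = at x" using x by (intro at_within_interior) auto
      with d show "(?v has_real_derivative - ?h x) (at x)" by (metis minus_minus)
    qed
  qed
  have "continuous_on {0..L} u"
    using der by (meson DERIV_continuous continuous_on_eq_continuous_within)
  then obtain B where B: "B > 0" "\<And>x. x \<in> {0..L} \<Longrightarrow> \<bar>u x\<bar> \<le> B"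
    by (rule continuous_on_Icc_bounded) (rule that)
  define M where "M = \<bar>\<mu>\<bar> * B + A * B powr p"
  have hM: "\<bar>- ?h x\<bar> \<le> M" if x: "x \<in> {0..L}" for x
  proof -
    have "\<bar>u x\<bar> powr (p - 1) * \<bar>u x\<bar> = \<bar>u x\<bar> powr p"
      by (cases "u x = 0") (auto simp: powr_diff)
    also have "\<dots> \<le> B powr p" using B(2)[OF x] \<open>0 < p\<close> by (intro powr_mono2) auto
    finally have 1: "\<bar>u x\<bar> powr (p - 1) * \<bar>u x\<bar> \<le> B powr p" .
    have "\<bar>- ?h x\<bar> \<le> \<bar>\<mu> * u x\<bar> + \<bar>a x * (\<bar>u x\<bar> powr (p - 1) * u x)\<bar>"
      using abs_triangle_ineq[of "\<mu> * u x" "a x * (\<bar>u x\<bar> powr (p - 1) * u x)"] by (simp only: abs_minus_cancel)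
    also have "\<dots> = \<bar>\<mu>\<bar> * \<bar>u x\<bar> + a x * (\<bar>u x\<bar> powr (p - 1) * \<bar>u x\<bar>)"
      using a[OF x] by (simp add: abs_mult)
    also have "\<dots> \<le> \<bar>\<mu>\<bar> * B + A * B powr p"
      using B(2)[OF x] a[OF x] 1 by (intro add_mono mult_mono) auto
    finally show ?thesis by (simp add: M_def)
  qed
  have "0 \<le> M" using hM[of 0] \<open>0 < L\<close> by auto
  have "M-lipschitz_on {0..L} ?v"
  proof (rule abs_continuous_bounded_deriv_imp_lipschitz[OF _ \<open>0 \<le> M\<close>])
    show "abs_continuous_on_interval 0 L ?v" using sol by (simp add: is_solution_def)
    show "AE x in lebesgue. x \<in> {0<..<L} \<longrightarrow> (\<exists>d. (?v has_real_derivative d) (at x) \<and> \<bar>d\<bar> \<le> M)"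
      using ae
    proof (rule AE_mp, intro AE_I2 impI)
      fix x assume "x \<in> {0<..<L} \<longrightarrow> (?v has_real_derivative - ?h x) (at x)" and x: "x \<in> {0<..<L}"
      then have "(?v has_real_derivative - ?h x) (at x)" by blast
      moreover have "\<bar>- ?h x\<bar> \<le> M" using hM[of x] x by auto
      ultimately show "\<exists>d. (?v has_real_derivative d) (at x) \<and> \<bar>d\<bar> \<le> M" by blast
    qed
  qed
  then show ?thesis using der ae unfolding lipschitz_solution_def by blast
qed

text \<open>
Let \<open>\<phi>\<close> be the positive Dirichlet eigenfunction of \<open>[\<alpha>, \<beta>]\<close>, with eigenvalue \<open>k\<^sup>2\<close>.  The Wronskian
\<open>W = u' \<phi> - u \<phi>'\<close> satisfies \<open>W' = - ((\<mu> - k\<^sup>2) u + a u\<^sup>p) \<phi> \<le> 0\<close>, whereas its boundary values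
\<open>W \<alpha> = - k u \<alpha>\<close> and \<open>W \<beta> = k u \<beta>\<close> satisfy \<open>W \<alpha> \<le> 0 \<le> W \<beta>\<close>.  Hence \<open>W = 0\<close> throughout, which
forces \<open>u \<alpha> = 0\<close> and, as \<open>W' = 0\<close> too, makes \<open>a\<close> vanish almost everywhere on \<open>(\<alpha>, \<beta>)\<close>.
\<close>

lemma sturm_comparison_positive:
  assumes sol: "lipschitz_solution L p \<mu> a u v"
    and ab: "0 \<le> \<alpha>" "\<alpha> < \<beta>" "\<beta> \<le> L" and k: "(pi / (\<beta> - \<alpha>))\<^sup>2 \<le> \<mu>"
    and a: "\<And>x. x \<in> {0..L} \<Longrightarrow> 0 \<le> a x"
    and pos: "\<And>x. x \<in> {\<alpha><..<\<beta>} \<Longrightarrow> 0 < u x"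
  shows "u \<alpha> = 0" and "\<alpha> < \<gamma> \<Longrightarrow> \<exists>x\<in>{\<alpha><..<\<gamma>} \<inter> {\<alpha><..<\<beta>}. a x = 0"
proof -
  define k where "k = pi / (\<beta> - \<alpha>)"
  have kpos: "k > 0" using ab by (simp add: k_def)
  have kk: "k\<^sup>2 \<le> \<mu>" using k by (simp add: k_def)
  define \<phi> where "\<phi> x = sin (k * (x - \<alpha>))" for x
  define \<phi>' where "\<phi>' x = k * cos (k * (x - \<alpha>))" for x
  define W where "W x = v x * \<phi> x - u x * \<phi>' x" for x
  define h where "h x = \<mu> * u x + a x * (\<bar>u x\<bar> powr (p - 1) * u x)" for x
  have d\<phi>: "(\<phi> has_real_derivative \<phi>' x) (at x within T)" for x T
    unfolding \<phi>_def[abs_def] \<phi>'_def by (auto intro!: derivative_eq_intros)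
  have d\<phi>': "(\<phi>' has_real_derivative - k\<^sup>2 * \<phi> x) (at x within T)" for x T
    unfolding \<phi>_def \<phi>'_def[abs_def] by (auto intro!: derivative_eq_intros simp: power2_eq_square)
  have du: "(u has_real_derivative v x) (at x within {0..L})" if "x \<in> {0..L}" for x
    using sol that by (simp add: lipschitz_solution_def)
  have \<phi>pos: "\<phi> x > 0" if "x \<in> {\<alpha><..<\<beta>}" for x
  proof -
    have "k * (x - \<alpha>) < k * (\<beta> - \<alpha>)" using that kpos by (intro mult_strict_left_mono) auto
    then have "k * (x - \<alpha>) < pi" using ab by (simp add: k_def)
    then show ?thesis using that kpos by (auto simp: \<phi>_def intro!: sin_gt_zero)
  qed
  have contu: "continuous_on {0..L} u"
    using du by (meson DERIV_continuous continuous_on_eq_continuous_within)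
  obtain M where vlip: "M-lipschitz_on {0..L} v" using sol by (auto simp: lipschitz_solution_def)
  have contv: "continuous_on {0..L} v" using vlip by (rule lipschitz_on_continuous_on)
  have bdd: "\<exists>B\<ge>0. \<forall>x\<in>{0..L}. \<bar>f x\<bar> \<le> B" if "continuous_on {0..L} f" for f :: "real \<Rightarrow> real"
    by (rule continuous_on_Icc_bounded[OF that]) (auto intro: less_imp_le)
  have lipC1: "\<exists>C. C-lipschitz_on {0..L} f"
    if "\<And>x. x \<in> {0..L} \<Longrightarrow> (f has_real_derivative f' x) (at x within {0..L})"
      and "continuous_on {0..L} f'" for f f' :: "real \<Rightarrow> real"
  proof -
    obtain B where B: "B \<ge> 0" "\<forall>x\<in>{0..L}. \<bar>f' x\<bar> \<le> B" using bdd[OF \<open>continuous_on {0..L} f'\<close>] by blast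
    have "B-lipschitz_on {0..L} f"
    proof (rule bounded_derivative_imp_lipschitz)
      show "(f has_derivative (*) (f' x)) (at x within {0..L})" if "x \<in> {0..L}" for x
        using \<open>\<And>x. x \<in> {0..L} \<Longrightarrow> (f has_real_derivative f' x) (at x within {0..L})\<close>[OF that]
        by (simp add: has_field_derivative_def)
      show "onorm ((*) (f' x)) \<le> B" if "x \<in> {0..L}" for x
        using B that by (intro onorm_le) (auto simp: abs_mult intro: mult_right_mono)
    qed (use B in auto)
    then show ?thesis by blast
  qed
  have c\<phi>: "continuous_on T \<phi>" "continuous_on T \<phi>'" for T
    unfolding \<phi>_def[abs_def] \<phi>'_def[abs_def] by (intro continuous_intros)+
  have lipprod: "\<exists>C. C-lipschitz_on {0..L} (\<lambda>x. f x * g x)"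
    if "\<exists>C. C-lipschitz_on {0..L} f" "\<exists>C. C-lipschitz_on {0..L} g" for f g :: "real \<Rightarrow> real"
  proof -
    from that obtain C C' where C: "C-lipschitz_on {0..L} f" "C'-lipschitz_on {0..L} g" by blast
    obtain B B' where "B \<ge> 0" "\<forall>x\<in>{0..L}. \<bar>f x\<bar> \<le> B" "B' \<ge> 0" "\<forall>x\<in>{0..L}. \<bar>g x\<bar> \<le> B'"
      using bdd[OF lipschitz_on_continuous_on[OF C(1)]] bdd[OF lipschitz_on_continuous_on[OF C(2)]] by blast
    then show ?thesis using lipschitz_on_mult_bounded[OF C(1) _ C(2)] by blast
  qed
  have "\<exists>C. C-lipschitz_on {0..L} (\<lambda>x. v x * \<phi> x)"
    using vlip lipC1[OF d\<phi> c\<phi>(2)] by (intro lipprod) auto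
  moreover have "\<exists>C. C-lipschitz_on {0..L} (\<lambda>x. u x * \<phi>' x)"
    using lipC1[OF du contv] lipC1[OF d\<phi>' continuous_on_mult_left[OF c\<phi>(1)]] by (intro lipprod) auto
  ultimately obtain C where C: "C-lipschitz_on {0..L} W"
    unfolding W_def[abs_def] using lipschitz_on_diff by blast
  have Wac: "abs_continuous_on_interval 0 L (\<lambda>x. - W x)"
  proof (rule lipschitz_imp_abs_continuous)
    show "\<bar>- W y - - W x\<bar> \<le> (C + 1) * (y - x)" if "0 \<le> x" "x \<le> y" "y \<le> L" for x y
    proof -
      have "\<bar>W x - W y\<bar> \<le> C * (y - x)"
        using lipschitz_onD[OF C, of x y] that by (simp add: dist_real_def)
      also have "\<dots> \<le> (C + 1) * (y - x)" using that by (intro mult_right_mono) auto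
      finally show ?thesis by simp
    qed
    show "0 \<le> C + 1" using lipschitz_on_nonneg[OF C] by simp
  qed
  have aev: "AE x in lebesgue. x \<in> {0<..<L} \<longrightarrow> (v has_real_derivative - h x) (at x)"
    using sol by (simp add: lipschitz_solution_def h_def)
  have dW: "(W has_real_derivative - ((\<mu> - k\<^sup>2) * u x + a x * (u x powr p)) * \<phi> x) (at x)"
    if x: "x \<in> {\<alpha><..<\<beta>}" and dv: "(v has_real_derivative - h x) (at x)" for x
  proof -
    have "at x within {0..L} = at x" using x ab by (intro at_within_interior) auto
    then have du': "(u has_real_derivative v x) (at x)" using du[of x] x ab by auto
    have *: "(W has_real_derivative (- h x * \<phi> x + \<phi>' x * v x - (v x * \<phi>' x + (- k\<^sup>2 * \<phi> x) * u x))) (at x)"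
      unfolding W_def[abs_def]
      by (intro DERIV_diff DERIV_mult dv du' d\<phi> d\<phi>')
    have "h x = \<mu> * u x + a x * (u x powr p)"
      using pos[OF x] by (simp add: h_def powr_diff)
    then have "- h x * \<phi> x + \<phi>' x * v x - (v x * \<phi>' x + (- k\<^sup>2 * \<phi> x) * u x)
        = - ((\<mu> - k\<^sup>2) * u x + a x * (u x powr p)) * \<phi> x"
      by (simp add: algebra_simps)
    then show ?thesis using * by simp
  qed
  have W': "((\<mu> - k\<^sup>2) * u x + a x * (u x powr p)) * \<phi> x \<ge> 0" if x: "x \<in> {\<alpha><..<\<beta>}" for x
    using pos[OF x] \<phi>pos[OF x] kk a[of x] x ab by auto
  have mono: "W d \<le> W c" if cd: "\<alpha> \<le> c" "c \<le> d" "d \<le> \<beta>" for c d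
  proof -
    have "- W c \<le> - W d"
    proof (rule abs_continuous_deriv_nonneg_imp_le[OF cd(2)])
      show "abs_continuous_on_interval c d (\<lambda>x. - W x)"
        using abs_continuous_subinterval[OF Wac] cd ab by auto
      show "AE x in lebesgue. x \<in> {c<..<d} \<longrightarrow> (\<exists>e\<ge>0. ((\<lambda>x. - W x) has_real_derivative e) (at x))"
        using aev
      proof (rule AE_mp, intro AE_I2 impI)
        fix x assume *: "x \<in> {0<..<L} \<longrightarrow> (v has_real_derivative - h x) (at x)" "x \<in> {c<..<d}"
        then have x: "x \<in> {\<alpha><..<\<beta>}" using cd by auto
        with * ab have "(v has_real_derivative - h x) (at x)" by auto
        from DERIV_minus[OF dW[OF x this]] W'[OF x]
        show "\<exists>e\<ge>0. ((\<lambda>x. - W x) has_real_derivative e) (at x)" by (metis minus_minus mult_minus_left)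
      qed
    qed
    then show ?thesis by simp
  qed
  have nonneg: "u x \<ge> 0" if "x \<in> {\<alpha>..\<beta>}" for x
  proof (rule continuous_ge_on_closure[of "{\<alpha><..<\<beta>}" u])
    show "continuous_on (closure {\<alpha><..<\<beta>}) u"
      using ab by (auto intro: continuous_on_subset[OF contu])
    show "x \<in> closure {\<alpha><..<\<beta>}" using ab that by auto
  qed (use pos in \<open>auto intro: less_imp_le\<close>)
  have W\<alpha>: "W \<alpha> = - (k * u \<alpha>)" by (simp add: W_def \<phi>_def \<phi>'_def)
  have "k * (\<beta> - \<alpha>) = pi" using ab by (simp add: k_def)
  then have W\<beta>: "W \<beta> = k * u \<beta>" by (simp add: W_def \<phi>_def \<phi>'_def)
  have "k * u \<beta> \<le> - (k * u \<alpha>)" using mono[of \<alpha> \<beta>] ab W\<alpha> W\<beta> by simp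
  moreover have "0 \<le> k * u \<alpha>" "0 \<le> k * u \<beta>" using kpos nonneg[of \<alpha>] nonneg[of \<beta>] ab by auto
  ultimately have *: "k * u \<alpha> = 0" "k * u \<beta> = 0" by linarith+
  then show "u \<alpha> = 0" using kpos by simp
  have W0: "W x = 0" if "x \<in> {\<alpha>..\<beta>}" for x
    using mono[of \<alpha> x] mono[of x \<beta>] that * W\<alpha> W\<beta> by auto
  show "\<exists>x\<in>{\<alpha><..<\<gamma>} \<inter> {\<alpha><..<\<beta>}. a x = 0" if "\<alpha> < \<gamma>"
  proof -
    obtain N where N: "N \<in> null_sets lebesgue"
      "{x \<in> space lebesgue. \<not> (x \<in> {0<..<L} \<longrightarrow> (v has_real_derivative - h x) (at x))} \<subseteq> N"
      using aev unfolding eventually_ae_filter by blast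
    have "\<not> negligible {\<alpha><..<min \<gamma> \<beta>}" using that ab by (intro open_not_negligible) auto
    then have "\<not> {\<alpha><..<min \<gamma> \<beta>} \<subseteq> N"
      using N(1) negligible_iff_null_sets negligible_subset by blast
    then obtain x where x: "x \<in> {\<alpha><..<min \<gamma> \<beta>}" "x \<notin> N" by blast
    then have x': "x \<in> {\<alpha><..<\<beta>}" by auto
    have "x \<notin> {x \<in> space lebesgue. \<not> (x \<in> {0<..<L} \<longrightarrow> (v has_real_derivative - h x) (at x))}"
      using N(2) x(2) by blast
    then have "(v has_real_derivative - h x) (at x)" using x' ab by auto
    note 1 = dW[OF x' this]
    have "((\<lambda>x. 0) has_real_derivative - ((\<mu> - k\<^sup>2) * u x + a x * (u x powr p)) * \<phi> x) (at x)"
    proof (rule has_field_derivative_transform_within_open[OF 1, of "{\<alpha><..<\<beta>}"])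
    qed (use W0 x' in auto)
    then have "((\<mu> - k\<^sup>2) * u x + a x * (u x powr p)) * \<phi> x = 0"
      using DERIV_unique[OF _ DERIV_const[of 0 "at x"]] by fastforce
    then have "(\<mu> - k\<^sup>2) * u x + a x * (u x powr p) = 0" using \<phi>pos[OF x'] by simp
    moreover have "(\<mu> - k\<^sup>2) * u x \<ge> 0" "a x * (u x powr p) \<ge> 0"
      using kk pos[OF x'] a[of x] x' ab by auto
    ultimately have "a x * (u x powr p) = 0" by linarith
    then have "a x = 0" using pos[OF x'] by auto
    then show ?thesis using x by auto
  qed
qed

lemma sturm_comparison:
  assumes sol: "lipschitz_solution L p \<mu> a u v"
    and ab: "0 \<le> \<alpha>" "\<alpha> < \<beta>" "\<beta> \<le> L" and k: "(pi / (\<beta> - \<alpha>))\<^sup>2 \<le> \<mu>"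
    and a: "\<And>x. x \<in> {0..L} \<Longrightarrow> 0 \<le> a x"
    and nz: "\<And>x. x \<in> {\<alpha><..<\<beta>} \<Longrightarrow> u x \<noteq> 0"
  shows "u \<alpha> = 0" and "\<alpha> < \<gamma> \<Longrightarrow> \<exists>x\<in>{\<alpha><..<\<gamma>} \<inter> {\<alpha><..<\<beta>}. a x = 0"
proof -
  have cont: "continuous_on {0..L} u"
    using sol unfolding lipschitz_solution_def by (meson DERIV_continuous continuous_on_eq_continuous_within)
  have "(\<forall>x\<in>{\<alpha><..<\<beta>}. 0 < u x) \<or> (\<forall>x\<in>{\<alpha><..<\<beta>}. 0 < - u x)"
  proof (rule ccontr)
    assume "\<not> ?thesis"
    then obtain x y where xy: "x \<in> {\<alpha><..<\<beta>}" "y \<in> {\<alpha><..<\<beta>}" "u x < 0" "u y > 0"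
      using nz by (metis linorder_neqE_linordered_idom neg_0_less_iff_less)
    have "connected (u ` {\<alpha><..<\<beta>})"
      using ab by (intro connected_continuous_image continuous_on_subset[OF cont]) auto
    then have "0 \<in> u ` {\<alpha><..<\<beta>}"
      using xy by (meson connectedD_interval image_eqI less_imp_le)
    then show False using nz by auto
  qed
  then consider "\<forall>x\<in>{\<alpha><..<\<beta>}. 0 < u x" | "\<forall>x\<in>{\<alpha><..<\<beta>}. 0 < - u x" by blast
  then have "u \<alpha> = 0 \<and> (\<alpha> < \<gamma> \<longrightarrow> (\<exists>x\<in>{\<alpha><..<\<gamma>} \<inter> {\<alpha><..<\<beta>}. a x = 0))"
  proof cases
    case 1
    then show ?thesis using sturm_comparison_positive[OF sol ab k a] by blast
  next
    case 2
    then show ?thesis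
      using sturm_comparison_positive[OF lipschitz_solution_uminus[OF sol] ab k a] by auto
  qed
  then show "u \<alpha> = 0" "\<alpha> < \<gamma> \<Longrightarrow> \<exists>x\<in>{\<alpha><..<\<gamma>} \<inter> {\<alpha><..<\<beta>}. a x = 0" by blast+
qed

text \<open>
The half-open intervals \<open>[\<alpha> j, \<alpha> (j + 1))\<close> of length \<open>L / n\<close> are disjoint, and comparison puts a zero
of \<open>u\<close> into each of them: inside, or at the left end.  For \<open>j = 0\<close> the left end is not an interior
point, but there \<open>a > 0\<close> leaves only the first alternative.
\<close>

lemma card_interior_nodes_ge:
  assumes sol: "lipschitz_solution L p \<mu> a u v" and L: "0 < L" and n: "1 \<le> n"
    and \<mu>: "dirichlet_eigenvalue L n \<le> \<mu>"
    and a: "\<And>x. x \<in> {0..L} \<Longrightarrow> 0 \<le> a x"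
    and s0: "0 < s0" "\<And>x. x \<in> {0<..<s0} \<Longrightarrow> 0 < a x"
    and fin: "finite (interior_nodes L u)"
  shows "n \<le> card (interior_nodes L u)"
proof -
  define \<alpha> where "\<alpha> j = real j * L / real n" for j :: nat
  have nn: "real n > 0" using n by simp
  have \<alpha>0: "\<alpha> 0 = 0" by (simp add: \<alpha>_def)
  have \<alpha>n: "\<alpha> n = L" using nn by (simp add: \<alpha>_def)
  have \<alpha>step: "\<alpha> (Suc j) - \<alpha> j = L / real n" for j
    by (simp add: \<alpha>_def diff_divide_distrib[symmetric] algebra_simps)
  have \<alpha>less: "\<alpha> j < \<alpha> (Suc j)" for j using \<alpha>step[of j] L nn by (metis diff_gt_0_iff_gt divide_pos_pos)
  have \<alpha>mono: "\<alpha> i \<le> \<alpha> j" if "i \<le> j" for i j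
    using that L nn by (auto simp: \<alpha>_def intro!: divide_right_mono mult_right_mono)
  have "\<exists>x. x \<in> interior_nodes L u \<and> \<alpha> j \<le> x \<and> x < \<alpha> (Suc j)" if j: "j < n" for j
  proof (cases "\<exists>x\<in>{\<alpha> j<..<\<alpha> (Suc j)}. u x = 0")
    case True
    then obtain x where x: "x \<in> {\<alpha> j<..<\<alpha> (Suc j)}" "u x = 0" by blast
    have "0 \<le> \<alpha> j" "\<alpha> (Suc j) \<le> L" using \<alpha>mono[of 0 j] \<alpha>mono[of "Suc j" n] j \<alpha>0 \<alpha>n by auto
    then show ?thesis using x by (intro exI[of _ x]) (auto simp: interior_nodes_def)
  next
    case False
    have 0: "0 \<le> \<alpha> j" "\<alpha> (Suc j) \<le> L" using \<alpha>mono[of 0 j] \<alpha>mono[of "Suc j" n] j \<alpha>0 \<alpha>n by auto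
    have "(pi / (\<alpha> (Suc j) - \<alpha> j))\<^sup>2 \<le> \<mu>"
      using \<mu> \<alpha>step[of j] by (simp add: dirichlet_eigenvalue_def mult.commute)
    note st = sturm_comparison[OF sol 0(1) \<alpha>less 0(2) this a]
    have u: "u (\<alpha> j) = 0" by (rule st(1)) (use False in auto)
    show ?thesis
    proof (cases "j = 0")
      case True
      have "\<alpha> j < s0" using True \<alpha>0 s0 by simp
      from st(2)[OF _ _ this] False obtain x where "x \<in> {\<alpha> j<..<s0}" "a x = 0" by blast
      then show ?thesis using s0(2)[of x] True \<alpha>0 by auto
    next
      case False
      then have "0 < \<alpha> j" using L nn by (auto simp: \<alpha>_def)
      moreover have "\<alpha> j < L" using \<alpha>less[of j] 0 by linarith
      ultimately show ?thesis using u \<alpha>less[of j] by (intro exI[of _ "\<alpha> j"]) (auto simp: interior_nodes_def)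
    qed
  qed
  then obtain z where z: "\<And>j. j < n \<Longrightarrow> z j \<in> interior_nodes L u \<and> \<alpha> j \<le> z j \<and> z j < \<alpha> (Suc j)"
    by metis
  have "inj_on z {..<n}"
  proof (rule linorder_inj_onI)
    fix i j assume ij: "i < j" "i \<in> {..<n}" "j \<in> {..<n}"
    have "z i < \<alpha> (Suc i)" "\<alpha> j \<le> z j" using z ij by auto
    moreover have "\<alpha> (Suc i) \<le> \<alpha> j" using ij by (intro \<alpha>mono) auto
    ultimately show "z i \<noteq> z j" by linarith
  qed auto
  then have "n = card (z ` {..<n})" by (simp add: card_image)
  also have "\<dots> \<le> card (interior_nodes L u)"
    using z fin by (intro card_mono) auto
  finally show ?thesis .
qed

section \<open>Shooting without uniqueness\<close>

text \<open>
The length of the part of \<open>[0, h]\<close> to the left of \<open>x\<close>.  Ramps of adjacent cells add up to the elapsed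
time, which makes an increment of an Euler polygon an average of slopes; see
\<open>euler_polygon_increment\<close>.
\<close>

definition ramp :: "real \<Rightarrow> real \<Rightarrow> real" where
  "ramp h x = min (max x 0) h"

lemma sum_ramp:
  assumes "0 \<le> h" "0 \<le> t"
  shows "(\<Sum>j<N. ramp h (t - real j * h)) = min t (real N * h)"
proof (induction N)
  case (Suc N)
  have "(\<Sum>j<Suc N. ramp h (t - real j * h)) = min t (real N * h) + ramp h (t - real N * h)"
    using Suc by simp
  also have "\<dots> = min t (real N * h + h)" using assms by (auto simp: ramp_def min_def max_def)
  finally show ?case by (simp add: algebra_simps)
qed (use assms in \<open>simp add: min_def\<close>)

primrec euler :: "(real \<Rightarrow> 'b \<Rightarrow> 'b) \<Rightarrow> real \<Rightarrow> 'b \<Rightarrow> nat \<Rightarrow> 'b::real_normed_vector" where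
  "euler F h z 0 = z"
| "euler F h z (Suc j) = euler F h z j + h *\<^sub>R F (real j * h) (euler F h z j)"

definition euler_polygon ::
    "(real \<Rightarrow> 'b \<Rightarrow> 'b) \<Rightarrow> real \<Rightarrow> nat \<Rightarrow> 'b \<Rightarrow> real \<Rightarrow> 'b::real_normed_vector" where
  "euler_polygon F h N z t =
     z + (\<Sum>j<N. ramp h (t - real j * h) *\<^sub>R F (real j * h) (euler F h z j))"

lemma euler_polygon_0: "0 \<le> h \<Longrightarrow> euler_polygon F h N z 0 = z"
  by (simp add: euler_polygon_def ramp_def)

lemma euler_polygon_node:
  assumes "0 \<le> h" "i \<le> N"
  shows "euler_polygon F h N z (real i * h) = euler F h z i"
proof -
  let ?v = "\<lambda>j. F (real j * h) (euler F h z j)"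
  have r: "ramp h (real i * h - real j * h) = (if j < i then h else 0)" for j
  proof -
    have e: "real i * h - real j * h = (real i - real j) * h" by (simp add: algebra_simps)
    show ?thesis
    proof (cases "j < i")
      case True
      then have "1 * h \<le> (real i - real j) * h" using assms by (intro mult_right_mono) auto
      then show ?thesis using True assms unfolding e by (simp add: ramp_def)
    next
      case False
      then have "(real i - real j) * h \<le> 0" using assms by (intro mult_nonpos_nonneg) auto
      then show ?thesis using False assms unfolding e by (simp add: ramp_def)
    qed
  qed
  have "(\<Sum>j<N. ramp h (real i * h - real j * h) *\<^sub>R ?v j) = (\<Sum>j<i. h *\<^sub>R ?v j)"
    unfolding r using assms(2)
    by (intro sum.mono_neutral_cong_right) auto
  moreover have "euler F h z i = z + (\<Sum>j<i. h *\<^sub>R ?v j)" by (induction i) (simp_all add: add.assoc)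
  ultimately show ?thesis by (simp add: euler_polygon_def)
qed

text \<open>
The increment from \<open>s\<close> to \<open>t\<close> is a combination of the slopes of the cells that meet \<open>[s, t]\<close>, with
nonnegative weights of sum \<open>t - s\<close>.
\<close>

lemma euler_polygon_increment:
  fixes F :: "real \<Rightarrow> 'b \<Rightarrow> 'b::real_normed_vector"
  assumes h: "0 \<le> h" and st: "0 \<le> s" "s \<le> t" "t \<le> real N * h"
    and close: "\<And>j. j < N \<Longrightarrow> real j * h < t \<Longrightarrow> s < real j * h + h \<Longrightarrow>
        norm (F (real j * h) (euler F h z j) - w) \<le> e"
  shows "norm (euler_polygon F h N z t - euler_polygon F h N z s - (t - s) *\<^sub>R w) \<le> e * (t - s)"
proof -
  define v where "v j = F (real j * h) (euler F h z j)" for j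
  define c where "c j = ramp h (t - real j * h) - ramp h (s - real j * h)" for j
  have c0: "0 \<le> c j" for j using h st by (auto simp: c_def ramp_def)
  have c1: "real j * h < t \<and> s < real j * h + h" if "c j \<noteq> 0" for j
    using that h st by (auto simp: c_def ramp_def min_def max_def split: if_splits)
  have sumc: "(\<Sum>j<N. c j) = t - s"
    using sum_ramp[OF h, of t N] sum_ramp[OF h, of s N] st by (simp add: c_def sum_subtractf)
  have "euler_polygon F h N z t - euler_polygon F h N z s - (t - s) *\<^sub>R w
      = (\<Sum>j<N. c j *\<^sub>R v j) - (\<Sum>j<N. c j) *\<^sub>R w"
    unfolding sumc by (simp add: euler_polygon_def c_def v_def scaleR_left_diff_distrib sum_subtractf)
  also have "\<dots> = (\<Sum>j<N. c j *\<^sub>R (v j - w))"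
    by (simp add: scaleR_right_diff_distrib sum_subtractf scaleR_left.sum)
  also have "norm \<dots> \<le> (\<Sum>j<N. c j * e)"
  proof (rule sum_norm_le)
    fix j assume "j \<in> {..<N}"
    then have "c j * norm (v j - w) \<le> c j * e"
      using close[of j] c0[of j] c1[of j] by (cases "c j = 0") (auto simp: v_def)
    then show "norm (c j *\<^sub>R (v j - w)) \<le> c j * e" using c0 by simp
  qed
  also have "\<dots> = e * (t - s)" unfolding sum_distrib_right[symmetric] sumc by simp
  finally show ?thesis .
qed

lemma euler_polygon_lipschitz:
  fixes F :: "real \<Rightarrow> 'b \<Rightarrow> 'b::real_normed_vector"
  assumes L: "0 < L" and N: "0 < N" and M: "\<forall>t\<in>{0..L}. \<forall>y. norm (F t y) \<le> M"
    and st: "s \<in> {0..L}" "t \<in> {0..L}"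
  shows "norm (euler_polygon F (L / N) N z t - euler_polygon F (L / N) N z s) \<le> M * \<bar>t - s\<bar>"
proof -
  have *: "norm (euler_polygon F (L / N) N z t - euler_polygon F (L / N) N z s) \<le> M * (t - s)"
    if "0 \<le> s" "s \<le> t" "t \<le> L" for s t
  proof -
    have "norm (euler_polygon F (L / N) N z t - euler_polygon F (L / N) N z s - (t - s) *\<^sub>R 0) \<le> M * (t - s)"
    proof (rule euler_polygon_increment)
      fix j assume "real j * (L / real N) < t"
      then have "real j * (L / real N) \<in> {0..L}" using that L N by auto
      then show "norm (F (real j * (L / real N)) (euler F (L / real N) z j) - 0) \<le> M" using M by simp
    qed (use that L N in auto)
    then show ?thesis by simp
  qed
  show ?thesis
    using *[of s t] *[of t s] st by (cases "s \<le> t") (auto simp: norm_minus_commute)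
qed

text \<open>
The polygons share a Lipschitz constant, so Arzela--Ascoli gives a uniform limit \<open>y\<close> of a subsequence.
Near a time \<open>t\<close> at which \<open>F\<close> is continuous, all slopes of a fine polygon close to \<open>y\<close> are values of
\<open>F\<close> near \<open>(t, y t)\<close>; averaging them gives \<open>y' = F t (y t)\<close> at \<open>t\<close>.
\<close>

lemma euler_polygon_subseq_limit:
  fixes F :: "real \<Rightarrow> 'b \<Rightarrow> 'b::euclidean_space"
  assumes L: "0 < L" and M: "\<forall>t\<in>{0..L}. \<forall>y. norm (F t y) \<le> M"
    and contF: "\<forall>t\<in>{0<..<L} - D. \<forall>y. isCont (\<lambda>x. F (fst x) (snd x)) (t, y)"
    and K: "\<And>i. 0 < K i" "filterlim K at_top sequentially" and Z: "Z \<longlonglongrightarrow> z"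
  obtains r y where "strict_mono (r :: nat \<Rightarrow> nat)" "continuous_on {0..L} y" "y 0 = z"
    "\<And>t. t \<in> {0<..<L} - D \<Longrightarrow> (y has_vector_derivative F t (y t)) (at t)"
    "(\<lambda>i. euler_polygon F (L / K (r i)) (K (r i)) (Z (r i)) L) \<longlonglongrightarrow> y L"
proof -
  define Y where "Y i t = euler_polygon F (L / K i) (K i) (Z i) t" for i t
  have M0: "0 \<le> M" using order_trans[OF norm_ge_zero M[rule_format, of 0 0]] L by simp
  have Y0: "Y i 0 = Z i" for i using L by (simp add: Y_def euler_polygon_0)
  have lip: "norm (Y i t - Y i s) \<le> M * \<bar>t - s\<bar>" if "s \<in> {0..L}" "t \<in> {0..L}" for i s t
    unfolding Y_def using euler_polygon_lipschitz[OF L K(1) M that] by blast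
  obtain B where B: "\<And>i. norm (Z i) \<le> B"
    using BseqE[OF convergent_imp_Bseq[OF convergentI[OF Z]]] by blast
  obtain y r where y: "continuous_on {0..L} y" "strict_mono (r :: nat \<Rightarrow> nat)"
    and unif: "\<And>e. 0 < e \<Longrightarrow> \<exists>N. \<forall>n x. n \<ge> N \<and> x \<in> {0..L} \<longrightarrow> norm (Y (r n) x - y x) < e"
  proof (rule Arzela_Ascoli[of "{0..L}" Y "B + M * L"])
    show "norm (Y i t) \<le> B + M * L" if t: "t \<in> {0..L}" for i t
    proof -
      have "norm (Y i t) \<le> norm (Y i 0) + norm (Y i t - Y i 0)" by (metis add.commute diff_add_cancel norm_triangle_ineq)
      also have "\<dots> \<le> B + M * \<bar>t - 0\<bar>" using B lip[of 0 t i] t L by (intro add_mono) (auto simp: Y0)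
      also have "\<dots> \<le> B + M * L" using t M0 by (auto intro: mult_left_mono)
      finally show ?thesis .
    qed
    show "\<exists>d. 0 < d \<and> (\<forall>n y. y \<in> {0..L} \<and> norm (x - y) < d \<longrightarrow> norm (Y n x - Y n y) < e)"
      if "x \<in> {0..L}" "0 < e" for x e
    proof (intro exI[of _ "e / (M + 1)"] conjI allI impI)
      show "0 < e / (M + 1)" using that M0 by simp
      fix n y assume y: "y \<in> {0..L} \<and> norm (x - y) < e / (M + 1)"
      have "norm (Y n x - Y n y) \<le> M * \<bar>x - y\<bar>" using lip[of y x n] y that by auto
      also have "\<dots> \<le> (M + 1) * \<bar>x - y\<bar>" by (intro mult_right_mono) auto
      also have "\<dots> < e" using y M0 by (simp add: field_simps)
      finally show "norm (Y n x - Y n y) < e" .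
    qed
  qed (use that in auto)
  have lim: "(\<lambda>i. Y (r i) t) \<longlonglongrightarrow> y t" if "t \<in> {0..L}" for t
    unfolding LIMSEQ_iff using unif that by blast
  have hlim: "(\<lambda>i. L / real (K (r i))) \<longlonglongrightarrow> 0"
  proof (rule tendsto_divide_0[OF tendsto_const])
    have "filterlim (\<lambda>i. K (r i)) at_top sequentially"
      by (rule filterlim_compose[OF K(2) filterlim_subseq[OF y(2)]])
    then show "filterlim (\<lambda>i. real (K (r i))) at_infinity sequentially"
      by (intro filterlim_at_top_imp_at_infinity filterlim_compose[OF filterlim_real_sequentially])
  qed
  show thesis
  proof (rule that[OF y(2,1)])
    have "(\<lambda>i. Y (r i) 0) \<longlonglongrightarrow> z"
      unfolding Y0 using LIMSEQ_subseq_LIMSEQ[OF Z y(2)] by (simp add: o_def)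
    then show "y 0 = z" using LIMSEQ_unique lim[of 0] L by auto
    show "(\<lambda>i. euler_polygon F (L / K (r i)) (K (r i)) (Z (r i)) L) \<longlonglongrightarrow> y L"
      using lim[of L] L by (simp add: Y_def)
    fix t assume t: "t \<in> {0<..<L} - D"
    define w where "w = F t (y t)"
    show "(y has_vector_derivative F t (y t)) (at t)"
      unfolding has_vector_derivative_def has_derivative_at_alt w_def[symmetric]
    proof (intro conjI allI impI)
      show "bounded_linear (\<lambda>x. x *\<^sub>R w)" by (rule bounded_linear_scaleR_left)
      fix e :: real assume e: "0 < e"
      obtain \<delta> where \<delta>: "\<delta> > 0" "\<And>x. dist x (t, y t) < \<delta> \<Longrightarrow> dist (F (fst x) (snd x)) w < e"
        using contF[rule_format, OF t, of "y t"] e unfolding continuous_at_eps_delta w_def by auto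
      \<comment> \<open>Cells that meet the \<open>\<eta>\<close>-neighbourhood of \<open>t\<close> lie within \<open>2 \<eta>\<close> of \<open>t\<close>, and there the polygon is
        within \<open>2 M \<eta> + \<delta> / 4\<close> of \<open>y t\<close>.\<close>
      define \<eta> where "\<eta> = Min {t, L - t, \<delta> / (8 * (M + 1))}"
      have \<eta>: "\<eta> > 0" "\<eta> \<le> t" "\<eta> \<le> L - t" "\<eta> \<le> \<delta> / (8 * (M + 1))"
        using t \<delta>(1) M0 by (auto simp: \<eta>_def)
      have M\<eta>: "(M + 1) * \<eta> \<le> \<delta> / 8" using \<eta>(4) M0 by (simp add: field_simps)
      have ev: "\<forall>\<^sub>F i in sequentially. L / real (K (r i)) < \<eta> \<and> norm (Y (r i) t - y t) < \<delta> / 4"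
      proof (rule eventually_conj)
        show "\<forall>\<^sub>F i in sequentially. L / real (K (r i)) < \<eta>" using order_tendstoD(2)[OF hlim \<eta>(1)] .
        show "\<forall>\<^sub>F i in sequentially. norm (Y (r i) t - y t) < \<delta> / 4"
          using tendstoD[OF lim[of t], of "\<delta> / 4"] t \<delta>(1) by (auto simp: dist_norm)
      qed
      have inc: "norm (y c - y b - (c - b) *\<^sub>R w) \<le> e * (c - b)"
        if bc: "b \<le> c" "t - \<eta> < b" "c < t + \<eta>" "b \<le> t" "t \<le> c" for b c
      proof -
        have bcL: "b \<in> {0..L}" "c \<in> {0..L}" using bc \<eta> t by auto
        have "(\<lambda>i. norm (Y (r i) c - Y (r i) b - (c - b) *\<^sub>R w)) \<longlonglongrightarrow> norm (y c - y b - (c - b) *\<^sub>R w)"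
          by (intro tendsto_intros lim bcL)
        then show ?thesis
        proof (rule tendsto_upperbound)
          show "\<forall>\<^sub>F i in sequentially. norm (Y (r i) c - Y (r i) b - (c - b) *\<^sub>R w) \<le> e * (c - b)"
            using ev
          proof eventually_elim
            case (elim i)
            define h where "h = L / real (K (r i))"
            have h: "0 < h" "h < \<eta>" "real (K (r i)) * h = L" using elim L K(1)[of "r i"] by (auto simp: h_def)
            show ?case
              unfolding Y_def h_def[symmetric]
            proof (rule euler_polygon_increment)
              fix j assume j: "j < K (r i)" "real j * h < c" "b < real j * h + h"
              have jL: "real j * h \<in> {0..L}" using j(2) bcL h by auto
              have jt: "\<bar>real j * h - t\<bar> \<le> 2 * \<eta>" using j h bc by auto
              have node: "euler F h (Z (r i)) j = Y (r i) (real j * h)"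
                using euler_polygon_node[of h j "K (r i)" F "Z (r i)"] h j by (simp add: Y_def h_def)
              have "norm (Y (r i) (real j * h) - y t)
                  \<le> norm (Y (r i) (real j * h) - Y (r i) t) + norm (Y (r i) t - y t)"
                using norm_triangle_ineq[of "Y (r i) (real j * h) - Y (r i) t" "Y (r i) t - y t"] by simp
              also have "\<dots> \<le> M * \<bar>real j * h - t\<bar> + \<delta> / 4"
                using lip[of t "real j * h" "r i"] jL t elim by auto
              also have "\<dots> \<le> M * (2 * \<eta>) + \<delta> / 4" using jt M0 by (auto intro: mult_left_mono)
              finally have yb: "norm (Y (r i) (real j * h) - y t) \<le> M * (2 * \<eta>) + \<delta> / 4" .
              have "dist (real j * h, Y (r i) (real j * h)) (t, y t)
                  \<le> \<bar>real j * h - t\<bar> + norm (Y (r i) (real j * h) - y t)"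
                unfolding dist_Pair_Pair
                by (rule order_trans[OF sqrt_sum_squares_le_sum_abs]) (simp add: dist_norm)
              also have "\<dots> \<le> 2 * \<eta> + (M * (2 * \<eta>) + \<delta> / 4)" using jt yb by linarith
              also have "\<dots> = 2 * ((M + 1) * \<eta>) + \<delta> / 4" by (simp add: algebra_simps)
              also have "\<dots> < \<delta>" using M\<eta> \<delta>(1) by linarith
              finally show "norm (F (real j * h) (euler F h (Z (r i)) j) - w) \<le> e"
                using \<delta>(2)[of "(real j * h, Y (r i) (real j * h))"] node by (simp add: dist_norm less_imp_le)
            qed (use h bc bcL in auto)
          qed
        qed simp
      qed
      show "\<exists>d>0. \<forall>s. norm (s - t) < d \<longrightarrow> norm (y s - y t - (s - t) *\<^sub>R w) \<le> e * norm (s - t)"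
      proof (intro exI[of _ \<eta>] conjI allI impI)
        fix s assume s: "norm (s - t) < \<eta>"
        show "norm (y s - y t - (s - t) *\<^sub>R w) \<le> e * norm (s - t)"
        proof (cases "t \<le> s")
          case True
          then show ?thesis using inc[of t s] s \<eta> by auto
        next
          case False
          have "norm (y s - y t - (s - t) *\<^sub>R w) = norm (y t - y s - (t - s) *\<^sub>R w)"
            by (subst norm_minus_cancel[symmetric]) (simp add: algebra_simps)
          then show ?thesis using inc[of s t] False s \<eta> by auto
        qed
      qed fact
    qed
  qed
qed

text \<open>
Times at which \<open>F\<close> jumps go into the exceptional set \<open>D\<close>; continuity of \<open>y\<close> links the pieces.
\<close>

definition solves_ivp ::
    "(real \<Rightarrow> 'b \<Rightarrow> 'b) \<Rightarrow> real \<Rightarrow> real set \<Rightarrow> 'b \<Rightarrow> (real \<Rightarrow> 'b::real_normed_vector) \<Rightarrow> bool" where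
  "solves_ivp F L D z y \<longleftrightarrow> continuous_on {0..L} y \<and> y 0 = z \<and>
     (\<forall>t\<in>{0<..<L} - D. (y has_vector_derivative F t (y t)) (at t))"

text \<open>
Otherwise infinitely many polygons would violate the strict bound, and a limit of some of them would
be a solution that violates it.
\<close>

lemma euler_polygon_eventually_less:
  fixes F :: "real \<Rightarrow> 'b \<Rightarrow> 'b::euclidean_space" and g :: "'b \<Rightarrow> real"
  assumes L: "0 < L" and M: "\<forall>t\<in>{0..L}. \<forall>y. norm (F t y) \<le> M"
    and contF: "\<forall>t\<in>{0<..<L} - D. \<forall>y. isCont (\<lambda>x. F (fst x) (snd x)) (t, y)"
    and g: "continuous_on UNIV g" and less: "\<forall>y. solves_ivp F L D z y \<longrightarrow> g (y L) < c"
  shows "\<forall>\<^sub>F k in sequentially. g (euler_polygon F (L / Suc k) (Suc k) z L) < c"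
proof (rule ccontr)
  assume "\<not> ?thesis"
  then have inf: "infinite {k. c \<le> g (euler_polygon F (L / Suc k) (Suc k) z L)}"
    by (simp add: cofinite_eq_sequentially[symmetric] eventually_cofinite not_less)
  define q where "q = enumerate {k. c \<le> g (euler_polygon F (L / Suc k) (Suc k) z L)}"
  have q: "strict_mono q" "\<And>i. c \<le> g (euler_polygon F (L / Suc (q i)) (Suc (q i)) z L)"
    using strict_mono_enumerate[OF inf] enumerate_in_set[OF inf] by (auto simp: q_def)
  have K: "filterlim (\<lambda>i. Suc (q i)) at_top sequentially"
    by (rule filterlim_compose[OF filterlim_Suc filterlim_subseq[OF q(1)]])
  obtain r y where ry: "strict_mono (r :: nat \<Rightarrow> nat)" "continuous_on {0..L} y" "y 0 = z"
    "\<And>t. t \<in> {0<..<L} - D \<Longrightarrow> (y has_vector_derivative F t (y t)) (at t)"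
    "(\<lambda>i. euler_polygon F (L / Suc (q (r i))) (Suc (q (r i))) z L) \<longlonglongrightarrow> y L"
    by (rule euler_polygon_subseq_limit[OF L M contF zero_less_Suc K tendsto_const[of z]]) (rule that)
  have "(\<lambda>i. g (euler_polygon F (L / Suc (q (r i))) (Suc (q (r i))) z L)) \<longlonglongrightarrow> g (y L)"
    using continuous_on_tendsto_compose[OF g ry(5)] by simp
  then have "c \<le> g (y L)"
    by (rule tendsto_lowerbound) (use q(2) in auto)
  moreover have "g (y L) < c" using ry by (intro less[rule_format]) (auto simp: solves_ivp_def)
  ultimately show False by simp
qed

lemma continuous_on_euler_polygon:
  fixes F :: "real \<Rightarrow> 'b \<Rightarrow> 'b::real_normed_vector"
  assumes "\<And>j. j < N \<Longrightarrow> continuous_on UNIV (F (real j * h))"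
  shows "continuous_on UNIV (\<lambda>z. euler_polygon F h N z t)"
proof -
  have eul: "continuous_on UNIV (\<lambda>z. euler F h z j)" if "j \<le> N" for j
    using that
  proof (induction j)
    case (Suc j)
    have "continuous_on UNIV (\<lambda>z. F (real j * h) (euler F h z j))"
      by (rule continuous_on_compose2[OF assms]) (use Suc in auto)
    then show ?case using Suc by (auto intro!: continuous_intros)
  qed simp
  have "continuous_on UNIV (\<lambda>z. F (real j * h) (euler F h z j))" if "j < N" for j
    by (rule continuous_on_compose2[OF assms[OF that] eul]) (use that in auto)
  then show ?thesis
    unfolding euler_polygon_def by (intro continuous_intros) auto
qed

text \<open>
Between the two ends of \<open>\<gamma>\<close> the intermediate value theorem yields, for every fine step size, an Euler
polygon with final value exactly \<open>c\<close>.  Compactness of \<open>[0, 1]\<close> and of the polygons yields a limiting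
parameter and a solution.
\<close>

theorem shooting_without_uniqueness:
  fixes F :: "real \<Rightarrow> 'b \<Rightarrow> 'b::euclidean_space" and g :: "'b \<Rightarrow> real" and \<gamma> :: "real \<Rightarrow> 'b"
  assumes L: "0 < L" and M: "\<forall>t\<in>{0..L}. \<forall>y. norm (F t y) \<le> M"
    and contF: "\<forall>t\<in>{0<..<L} - D. \<forall>y. isCont (\<lambda>x. F (fst x) (snd x)) (t, y)"
    and contFt: "\<forall>t\<in>{0..L}. continuous_on UNIV (F t)"
    and g: "continuous_on UNIV g" and \<gamma>: "continuous_on {0..1} \<gamma>"
    and less: "\<forall>y. solves_ivp F L D (\<gamma> 0) y \<longrightarrow> g (y L) < c"
    and greater: "\<forall>y. solves_ivp F L D (\<gamma> 1) y \<longrightarrow> c < g (y L)"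
  obtains \<sigma> y where "\<sigma> \<in> {0..1}" "solves_ivp F L D (\<gamma> \<sigma>) y" "g (y L) = c"
proof -
  define P where "P k z = euler_polygon F (L / Suc k) (Suc k) z L" for k z
  have "\<forall>\<^sub>F k in sequentially. g (P k (\<gamma> 0)) < c"
    unfolding P_def
  proof (intro euler_polygon_eventually_less[where M = M and D = D])
  qed (use L M contF g less in auto)
  moreover have "\<forall>\<^sub>F k in sequentially. - g (P k (\<gamma> 1)) < - c"
    unfolding P_def
  proof (intro euler_polygon_eventually_less[where M = M and D = D and g = "\<lambda>x. - g x"])
    show "continuous_on UNIV (\<lambda>x. - g x)" using g by (rule continuous_on_minus)
  qed (use L M contF greater in auto)
  ultimately have "\<forall>\<^sub>F k in sequentially. \<exists>\<sigma>\<in>{0..1}. g (P k (\<gamma> \<sigma>)) = c"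
  proof eventually_elim
    case (elim k)
    have P: "continuous_on UNIV (P k)"
      unfolding P_def
    proof (rule continuous_on_euler_polygon, rule contFt[rule_format])
      fix j assume "j < Suc k"
      then have "real j * L \<le> real (Suc k) * L" using L by (intro mult_right_mono) auto
      then show "real j * (L / real (Suc k)) \<in> {0..L}" using L by (simp add: field_simps)
    qed
    have "continuous_on {0..1} (\<lambda>\<sigma>. g (P k (\<gamma> \<sigma>)))"
      by (intro continuous_on_compose2[OF g] continuous_on_compose2[OF P] \<gamma>) auto
    then show ?case
      using IVT'[of "\<lambda>\<sigma>. g (P k (\<gamma> \<sigma>))" 0 c 1] elim by auto
  qed
  then obtain k0 where "\<And>k. k \<ge> k0 \<Longrightarrow> \<exists>\<sigma>\<in>{0..1}. g (P k (\<gamma> \<sigma>)) = c"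
    unfolding eventually_sequentially by blast
  then have "\<forall>i. \<exists>\<sigma>. \<sigma> \<in> {0..1} \<and> g (P (k0 + i) (\<gamma> \<sigma>)) = c" by (meson le_add1)
  then obtain \<tau> where \<tau>: "\<And>i. \<tau> i \<in> {0..1}" "\<And>i. g (P (k0 + i) (\<gamma> (\<tau> i))) = c" by metis
  obtain \<sigma> q where \<sigma>: "\<sigma> \<in> {0..1::real}" and q: "strict_mono (q :: nat \<Rightarrow> nat)" "(\<tau> \<circ> q) \<longlonglongrightarrow> \<sigma>"
    using \<tau>(1) compact_Icc[of 0 "1::real"] unfolding compact_def by metis
  have Z: "(\<lambda>i. \<gamma> (\<tau> (q i))) \<longlonglongrightarrow> \<gamma> \<sigma>"
    using continuous_on_tendsto_compose[OF \<gamma> q(2) \<sigma>] \<tau>(1) by (simp add: o_def)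
  have K: "filterlim (\<lambda>i. Suc (k0 + q i)) at_top sequentially"
  proof (rule filterlim_compose[OF filterlim_Suc])
    show "filterlim (\<lambda>i. k0 + q i) at_top sequentially"
      by (rule filterlim_at_top_mono[OF filterlim_subseq[OF q(1)]]) auto
  qed
  obtain r y where ry: "strict_mono (r :: nat \<Rightarrow> nat)" "continuous_on {0..L} y" "y 0 = \<gamma> \<sigma>"
    "\<And>t. t \<in> {0<..<L} - D \<Longrightarrow> (y has_vector_derivative F t (y t)) (at t)"
    "(\<lambda>i. euler_polygon F (L / Suc (k0 + q (r i))) (Suc (k0 + q (r i))) (\<gamma> (\<tau> (q (r i)))) L) \<longlonglongrightarrow> y L"
    by (rule euler_polygon_subseq_limit[OF L M contF zero_less_Suc K Z]) (rule that)
  have "(\<lambda>i. g (P (k0 + q (r i)) (\<gamma> (\<tau> (q (r i)))))) \<longlonglongrightarrow> g (y L)"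
    using continuous_on_tendsto_compose[OF g ry(5)] by (simp add: P_def)
  then have "g (y L) = c" unfolding \<tau>(2) by (simp add: LIMSEQ_const_iff)
  then show thesis using that[OF \<sigma>, of y] ry by (simp add: solves_ivp_def)
qed

section \<open>Growth of solutions over half a turn\<close>

text \<open>
Where \<open>f < 0\<close> the differential inequality makes \<open>e\<^bsup>- \<kappa> x\<^esup> f\<close> increasing, so \<open>f\<close> cannot become
negative; where \<open>f \<ge> 0\<close> it makes \<open>e\<^bsup>\<kappa> x\<^esup> f\<close> strictly increasing.
\<close>

lemma positive_barrier:
  fixes f :: "real \<Rightarrow> real"
  assumes D: "finite D" and ab: "a < b" and cont: "continuous_on {a..b} f"
    and der: "\<And>x. x \<in> {a<..<b} - D \<Longrightarrow> (f has_real_derivative f' x) (at x)"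
    and ge: "\<And>x. x \<in> {a<..<b} - D \<Longrightarrow> 1 - \<kappa> * \<bar>f x\<bar> \<le> f' x"
    and fa: "0 \<le> f a"
  shows "0 < f b"
proof -
  have nonneg: "0 \<le> f d" if d: "d \<in> {a..b}" for d
  proof (rule ccontr)
    assume neg: "\<not> 0 \<le> f d"
    define T where "T = {a..d} \<inter> f -` {0..}"
    have cd: "continuous_on {a..d} f" using cont by (rule continuous_on_subset) (use d in auto)
    have "closed T" unfolding T_def by (rule continuous_closed_preimage[OF cd]) auto
    moreover have "bounded T" unfolding T_def by (rule bounded_subset[OF bounded_closed_interval[of a d]]) auto
    ultimately have "compact T" by (simp add: compact_eq_bounded_closed)
    moreover have "a \<in> T" using d fa by (auto simp: T_def)
    ultimately obtain c where c: "c \<in> T" "\<And>x. x \<in> T \<Longrightarrow> x \<le> c"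
      using compact_attains_sup[of T] by blast
    have cd': "c \<in> {a..d}" "0 \<le> f c" "c < d" using c neg by (auto simp: T_def order.strict_iff_order)
    have fneg: "f x < 0" if "x \<in> {c<..d}" for x
    proof (rule ccontr)
      assume "\<not> f x < 0"
      then have "x \<in> T" using that cd' by (auto simp: T_def)
      then show False using c(2)[of x] that by auto
    qed
    \<comment> \<open>Here \<open>c\<close> is the last point before \<open>d\<close> with \<open>f c \<ge> 0\<close>.\<close>
    have "0 * (d - c) \<le> exp (- \<kappa> * d) * f d - exp (- \<kappa> * c) * f c"
    proof (rule deriv_ge_imp_increment_ge[OF D, where f' = "\<lambda>x. exp (- \<kappa> * x) * (f' x - \<kappa> * f x)"])
      show "continuous_on {c..d} (\<lambda>x. exp (- \<kappa> * x) * f x)"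
        using cd' d by (intro continuous_intros continuous_on_subset[OF cont]) auto
      fix x assume x: "x \<in> {c<..<d} - D"
      then have x': "x \<in> {a<..<b} - D" using cd' d by auto
      show "((\<lambda>x. exp (- \<kappa> * x) * f x) has_real_derivative exp (- \<kappa> * x) * (f' x - \<kappa> * f x)) (at x)"
        by (auto intro!: derivative_eq_intros der[OF x'] simp: algebra_simps)
      have "f x < 0" using fneg x by auto
      then have "0 \<le> f' x - \<kappa> * f x" using ge[OF x'] by (simp add: abs_if)
      then show "0 \<le> exp (- \<kappa> * x) * (f' x - \<kappa> * f x)" by simp
    qed (use cd' in auto)
    moreover have "exp (- \<kappa> * d) * f d < 0" using neg by (simp add: mult_pos_neg)
    moreover have "0 \<le> exp (- \<kappa> * c) * f c" using cd' by simp
    ultimately show False by linarith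
  qed
  define m where "m = min (exp (\<kappa> * a)) (exp (\<kappa> * b))"
  have m: "0 < m" by (simp add: m_def)
  have "m * (b - a) \<le> exp (\<kappa> * b) * f b - exp (\<kappa> * a) * f a"
  proof (rule deriv_ge_imp_increment_ge[OF D, where f' = "\<lambda>x. exp (\<kappa> * x) * (f' x + \<kappa> * f x)"])
    show "continuous_on {a..b} (\<lambda>x. exp (\<kappa> * x) * f x)"
      by (intro continuous_intros cont)
    fix x assume x: "x \<in> {a<..<b} - D"
    show "((\<lambda>x. exp (\<kappa> * x) * f x) has_real_derivative exp (\<kappa> * x) * (f' x + \<kappa> * f x)) (at x)"
      by (auto intro!: derivative_eq_intros der[OF x] simp: algebra_simps)
    have "1 \<le> f' x + \<kappa> * f x" using ge[OF x] nonneg[of x] x by (simp add: abs_if)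
    moreover have "m \<le> exp (\<kappa> * x)"
    proof (cases "\<kappa> \<ge> 0")
      case True
      then have "\<kappa> * a \<le> \<kappa> * x" using x by (intro mult_left_mono) auto
      then show ?thesis by (simp add: m_def min_le_iff_disj)
    next
      case False
      then have "\<kappa> * b \<le> \<kappa> * x" using x by (intro mult_left_mono_neg) auto
      then show ?thesis by (simp add: m_def min_le_iff_disj)
    qed
    ultimately have "m * 1 \<le> exp (\<kappa> * x) * (f' x + \<kappa> * f x)" using m by (intro mult_mono) auto
    then show "m \<le> exp (\<kappa> * x) * (f' x + \<kappa> * f x)" by simp
  qed (use ab in auto)
  moreover have "0 < m * (b - a)" "0 \<le> exp (\<kappa> * a) * f a" using m ab fa by auto
  ultimately have "0 < exp (\<kappa> * b) * f b" by linarith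
  then show ?thesis by (simp add: zero_less_mult_iff)
qed

definition growth_factor :: "real \<Rightarrow> real \<Rightarrow> real" where
  "growth_factor L \<mu> = 1 + (1 + \<bar>\<mu>\<bar>) * L * exp ((1 + \<bar>\<mu>\<bar>) * L)"

text \<open>
The explicit bound that \<open>growth_forward\<close> produces.  The properties that matter are monotonicity in
\<open>r\<close>, the value \<open>0\<close> at \<open>r = 0\<close> with continuity there, and independence of the forcing.
\<close>

definition growth_bound :: "real \<Rightarrow> real \<Rightarrow> real \<Rightarrow> real \<Rightarrow> real \<Rightarrow> real" where
  "growth_bound L p \<mu> A r = (let b = growth_factor L \<mu> * r in
     b + r + L * (\<bar>\<mu>\<bar> * b + A * b powr p))"

text \<open>
On an interval where \<open>u \<ge> 0\<close> the forcing \<open>h\<close> only bends \<open>u\<close> downwards, so \<open>u'' \<le> \<bar>\<mu>\<bar> u\<close>.  This bounds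
\<open>u\<close> by the data at the left end, whatever \<open>h\<close> is.  A bound on \<open>u\<close> bounds \<open>h\<close> and then, by
integration, \<open>w = u'\<close> from both sides.
\<close>

lemma growth_forward:
  fixes u w h :: "real \<Rightarrow> real"
  assumes D: "finite D" and L: "0 \<le> \<beta> - \<alpha>" "\<beta> - \<alpha> \<le> L" and p: "0 < p" and A: "0 \<le> A"
    and cont: "continuous_on {\<alpha>..\<beta>} u" "continuous_on {\<alpha>..\<beta>} w"
    and du: "\<And>x. x \<in> {\<alpha><..<\<beta>} - D \<Longrightarrow> (u has_real_derivative w x) (at x)"
    and dw: "\<And>x. x \<in> {\<alpha><..<\<beta>} - D \<Longrightarrow> (w has_real_derivative - (\<mu> * u x + h x)) (at x)"
    and h: "\<And>x. x \<in> {\<alpha><..<\<beta>} \<Longrightarrow> 0 \<le> h x \<and> h x \<le> A * u x powr p"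
    and u: "\<And>x. x \<in> {\<alpha>..\<beta>} \<Longrightarrow> 0 \<le> u x"
  shows "\<bar>u \<beta>\<bar> + \<bar>w \<beta>\<bar> \<le> growth_bound L p \<mu> A (\<bar>u \<alpha>\<bar> + \<bar>w \<alpha>\<bar>)"
proof -
  define \<kappa> where "\<kappa> = 1 + \<bar>\<mu>\<bar>"
  define r where "r = \<bar>u \<alpha>\<bar> + \<bar>w \<alpha>\<bar>"
  have r0: "0 \<le> r" by (simp add: r_def)
  have \<kappa>: "1 \<le> \<kappa>" by (simp add: \<kappa>_def)
  have L0: "0 \<le> L" using L by linarith
  have \<kappa>\<mu>: "- \<mu> \<le> \<kappa>\<^sup>2"
  proof -
    have "- \<mu> \<le> \<kappa> * 1" by (simp add: \<kappa>_def)
    also have "\<dots> \<le> \<kappa> * \<kappa>" using \<kappa> by (intro mult_left_mono) auto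
    finally show ?thesis by (simp add: power2_eq_square)
  qed
  have w1: "w x \<le> \<kappa> * r * exp (\<kappa> * L)" if x: "x \<in> {\<alpha>..\<beta>}" for x
  proof -
    \<comment> \<open>From \<open>u'' \<le> \<kappa>\<^sup>2 u\<close> follows \<open>(\<kappa> u + u')' \<le> \<kappa> (\<kappa> u + u')\<close>, a one-sided Gronwall inequality.\<close>
    have "exp (- \<kappa> * x) * (\<kappa> * u x + w x) - exp (- \<kappa> * \<alpha>) * (\<kappa> * u \<alpha> + w \<alpha>) \<le> 0 * (x - \<alpha>)"
    proof (rule deriv_le_imp_increment_le[OF D,
          where f' = "\<lambda>x. exp (- \<kappa> * x) * (- (\<mu> * u x + h x) - \<kappa>\<^sup>2 * u x)"])
      show "continuous_on {\<alpha>..x} (\<lambda>x. exp (- \<kappa> * x) * (\<kappa> * u x + w x))"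
        using x by (intro continuous_intros continuous_on_subset[OF cont(1)] continuous_on_subset[OF cont(2)]) auto
      fix t assume t: "t \<in> {\<alpha><..<x} - D"
      then have t': "t \<in> {\<alpha><..<\<beta>} - D" using x by auto
      show "((\<lambda>x. exp (- \<kappa> * x) * (\<kappa> * u x + w x)) has_real_derivative
          exp (- \<kappa> * t) * (- (\<mu> * u t + h t) - \<kappa>\<^sup>2 * u t)) (at t)"
        by (auto intro!: derivative_eq_intros du[OF t'] dw[OF t'] simp: algebra_simps power2_eq_square)
      have "- \<mu> * u t \<le> \<kappa>\<^sup>2 * u t" using \<kappa>\<mu> u[of t] t' by (intro mult_right_mono) auto
      then have "- (\<mu> * u t + h t) - \<kappa>\<^sup>2 * u t \<le> 0" using h[of t] t' by auto
      then show "exp (- \<kappa> * t) * (- (\<mu> * u t + h t) - \<kappa>\<^sup>2 * u t) \<le> 0" by (simp add: mult_nonneg_nonpos)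
    qed (use x in auto)
    then have "exp (- \<kappa> * x) * (\<kappa> * u x + w x) \<le> exp (- \<kappa> * \<alpha>) * (\<kappa> * u \<alpha> + w \<alpha>)" by simp
    also have "\<kappa> * u \<alpha> + w \<alpha> \<le> \<kappa> * r"
    proof -
      have "\<kappa> * u \<alpha> + w \<alpha> \<le> \<kappa> * \<bar>u \<alpha>\<bar> + 1 * \<bar>w \<alpha>\<bar>" using \<kappa> by (intro add_mono mult_left_mono) auto
      also have "\<dots> \<le> \<kappa> * \<bar>u \<alpha>\<bar> + \<kappa> * \<bar>w \<alpha>\<bar>" using \<kappa> by (intro add_mono mult_right_mono) auto
      finally show ?thesis by (simp add: r_def algebra_simps)
    qed
    finally have "exp (- \<kappa> * x) * (\<kappa> * u x + w x) \<le> exp (- \<kappa> * \<alpha>) * (\<kappa> * r)" by simp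
    then have "exp (\<kappa> * x) * (exp (- \<kappa> * x) * (\<kappa> * u x + w x)) \<le> exp (\<kappa> * x) * (exp (- \<kappa> * \<alpha>) * (\<kappa> * r))"
      by (intro mult_left_mono) auto
    then have "\<kappa> * u x + w x \<le> exp (\<kappa> * (x - \<alpha>)) * (\<kappa> * r)"
    proof -
      have "exp (\<kappa> * x) * exp (- \<kappa> * x) = 1" "exp (\<kappa> * x) * exp (- \<kappa> * \<alpha>) = exp (\<kappa> * (x - \<alpha>))"
        by (simp_all add: exp_add[symmetric] right_diff_distrib)
      then have "exp (\<kappa> * x) * (exp (- \<kappa> * x) * y) = y"
        "exp (\<kappa> * x) * (exp (- \<kappa> * \<alpha>) * y) = exp (\<kappa> * (x - \<alpha>)) * y" for y
        by (simp_all only: mult.assoc[symmetric] mult_1_left)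
      then show ?thesis using \<open>exp (\<kappa> * x) * (exp (- \<kappa> * x) * _) \<le> _\<close> by (simp only:)
    qed
    also have "\<dots> \<le> exp (\<kappa> * L) * (\<kappa> * r)"
    proof (rule mult_right_mono)
      have "\<kappa> * (x - \<alpha>) \<le> \<kappa> * L" using x L \<kappa> by (intro mult_left_mono) auto
      then show "exp (\<kappa> * (x - \<alpha>)) \<le> exp (\<kappa> * L)" by simp
    qed (use \<kappa> r0 in auto)
    also have "\<dots> = \<kappa> * r * exp (\<kappa> * L)" by (simp add: mult_ac)
    finally have "\<kappa> * u x + w x \<le> \<kappa> * r * exp (\<kappa> * L)" .
    moreover have "0 \<le> \<kappa> * u x" using u[OF x] \<kappa> by simp
    ultimately show ?thesis by linarith
  qed
  define B where "B = growth_factor L \<mu> * r"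
  have B: "B = r + \<kappa> * r * exp (\<kappa> * L) * L" by (simp add: B_def growth_factor_def \<kappa>_def algebra_simps)
  have B0: "0 \<le> B" unfolding B using r0 \<kappa> L0 by (intro add_nonneg_nonneg mult_nonneg_nonneg) auto
  have uB: "u x \<le> B" if x: "x \<in> {\<alpha>..\<beta>}" for x
  proof -
    have "u x - u \<alpha> \<le> (\<kappa> * r * exp (\<kappa> * L)) * (x - \<alpha>)"
    proof (rule deriv_le_imp_increment_le[OF D, where f' = w])
      show "continuous_on {\<alpha>..x} u" using x by (intro continuous_on_subset[OF cont(1)]) auto
      fix t assume t: "t \<in> {\<alpha><..<x} - D"
      then have t': "t \<in> {\<alpha><..<\<beta>} - D" using x by auto
      show "(u has_real_derivative w t) (at t)" by (rule du[OF t'])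
      show "w t \<le> \<kappa> * r * exp (\<kappa> * L)" using w1[of t] t' by auto
    qed (use x in auto)
    also have "\<dots> \<le> (\<kappa> * r * exp (\<kappa> * L)) * L"
      using x L \<kappa> r0 by (intro mult_left_mono) auto
    finally show ?thesis using r_def unfolding B by linarith
  qed
  have hB: "0 \<le> h x \<and> h x \<le> A * B powr p" if x: "x \<in> {\<alpha><..<\<beta>}" for x
  proof -
    have "u x powr p \<le> B powr p" using u[of x] uB[of x] x p by (intro powr_mono2) auto
    then have "A * u x powr p \<le> A * B powr p" using A by (rule mult_left_mono)
    then show ?thesis using h[OF x] by auto
  qed
  have \<mu>u: "\<bar>\<mu> * u x\<bar> \<le> \<bar>\<mu>\<bar> * B" if x: "x \<in> {\<alpha><..<\<beta>}" for x
    using u[of x] uB[of x] x by (auto simp: abs_mult intro: mult_left_mono)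
  define M where "M = \<bar>\<mu>\<bar> * B + A * B powr p"
  have M0: "0 \<le> M" using B0 A by (simp add: M_def)
  have w': "- (\<mu> * u x + h x) \<le> M" "- M \<le> - (\<mu> * u x + h x)" if x: "x \<in> {\<alpha><..<\<beta>} - D" for x
  proof -
    have "\<bar>\<mu> * u x\<bar> \<le> \<bar>\<mu>\<bar> * B" "0 \<le> h x" "h x \<le> A * B powr p" "0 \<le> A * B powr p"
      using \<mu>u[of x] hB[of x] x A by auto
    then show "- (\<mu> * u x + h x) \<le> M" "- M \<le> - (\<mu> * u x + h x)" unfolding M_def by linarith+
  qed
  have "\<alpha> \<le> \<beta>" using L by simp
  have "w \<beta> - w \<alpha> \<le> M * (\<beta> - \<alpha>)"
    by (rule deriv_le_imp_increment_le[OF D \<open>\<alpha> \<le> \<beta>\<close> cont(2) dw w'(1)])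
  moreover have "- M * (\<beta> - \<alpha>) \<le> w \<beta> - w \<alpha>"
    by (rule deriv_ge_imp_increment_ge[OF D \<open>\<alpha> \<le> \<beta>\<close> cont(2) dw w'(2)])
  moreover have "M * (\<beta> - \<alpha>) \<le> M * L" using L M0 by (intro mult_left_mono) auto
  ultimately have "\<bar>w \<beta>\<bar> \<le> \<bar>w \<alpha>\<bar> + M * L" by (simp add: abs_if split: if_splits)
  moreover have "\<bar>w \<alpha>\<bar> \<le> r" by (simp add: r_def)
  moreover have "\<bar>u \<beta>\<bar> \<le> B" using uB[of \<beta>] u[of \<beta>] L by auto
  ultimately have "\<bar>u \<beta>\<bar> + \<bar>w \<beta>\<bar> \<le> B + r + L * M" by (simp add: mult.commute)
  then show ?thesis by (simp add: growth_bound_def Let_def B_def M_def r_def)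
qed

lemma growth_bound_mono:
  assumes "0 \<le> L" "0 < p" "0 \<le> A" "0 \<le> r" "r \<le> r'"
  shows "growth_bound L p \<mu> A r \<le> growth_bound L p \<mu> A r'"
proof -
  have g: "0 \<le> growth_factor L \<mu>" using assms by (simp add: growth_factor_def)
  then have "growth_factor L \<mu> * r \<le> growth_factor L \<mu> * r'" "0 \<le> growth_factor L \<mu> * r"
    using assms by (auto intro: mult_left_mono)
  then show ?thesis
    unfolding growth_bound_def Let_def using assms g
    by (intro add_mono mult_left_mono powr_mono2) auto
qed

lemma growth_bound_ge:
  assumes "0 \<le> L" "0 \<le> A" "0 \<le> r"
  shows "r \<le> growth_bound L p \<mu> A r"
proof -
  have g: "0 \<le> growth_factor L \<mu>" using assms by (simp add: growth_factor_def)
  show ?thesis using assms g by (simp add: growth_bound_def Let_def)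
qed

text \<open>
The amplitude \<open>e\<^sup>\<rho>\<close> is comparable to \<open>\<bar>u\<bar> + \<bar>u'\<bar>\<close> up to the factor \<open>2\<close>.
\<close>

definition half_turn_bound :: "real \<Rightarrow> real \<Rightarrow> real \<Rightarrow> real \<Rightarrow> real \<Rightarrow> real" where
  "half_turn_bound L p \<mu> A r = growth_bound L p \<mu> A (2 * r)"

context
  fixes L p \<mu> A :: real
  assumes params: "0 \<le> L" "0 < p" "0 \<le> A"
begin

lemma half_turn_bound_ge: "0 \<le> r \<Longrightarrow> r \<le> half_turn_bound L p \<mu> A r"
  using growth_bound_ge[OF params(1,3), of "2 * r" p \<mu>] by (simp add: half_turn_bound_def)

lemma half_turn_bound_mono: "0 \<le> r \<Longrightarrow> r \<le> r' \<Longrightarrow> half_turn_bound L p \<mu> A r \<le> half_turn_bound L p \<mu> A r'"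
  unfolding half_turn_bound_def using params by (intro growth_bound_mono) auto

lemma half_turn_bound_funpow_nonneg: "0 \<le> r \<Longrightarrow> 0 \<le> (half_turn_bound L p \<mu> A ^^ n) r"
proof (induction n)
  case (Suc n)
  then show ?case using half_turn_bound_ge[of "(half_turn_bound L p \<mu> A ^^ n) r"] by simp
qed simp

lemma half_turn_bound_funpow_mono:
  "0 \<le> r \<Longrightarrow> r \<le> r' \<Longrightarrow> (half_turn_bound L p \<mu> A ^^ n) r \<le> (half_turn_bound L p \<mu> A ^^ n) r'"
proof (induction n)
  case (Suc n)
  then show ?case by (simp add: half_turn_bound_mono half_turn_bound_funpow_nonneg)
qed simp

lemma half_turn_bound_funpow_small:
  assumes "0 < e"
  obtains \<delta> where "0 < \<delta>" "(half_turn_bound L p \<mu> A ^^ n) \<delta> < e"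
proof -
  have "\<exists>\<delta>>0. (half_turn_bound L p \<mu> A ^^ n) \<delta> < e"
    using assms
  proof (induction n arbitrary: e)
    case 0
    then show ?case by (intro exI[of _ "e / 2"]) auto
  next
    case (Suc n)
    let ?f = "half_turn_bound L p \<mu> A"
    have f0: "?f 0 = 0" by (simp add: half_turn_bound_def growth_bound_def)
    have "(?f \<longlongrightarrow> 0) (at_right 0)"
    proof -
      define G where "G = growth_factor L \<mu>"
      have "0 \<le> G" using params by (simp add: G_def growth_factor_def)
      have lin: "((\<lambda>r::real. c * (2 * r)) \<longlongrightarrow> 0) (at_right 0)" for c
        by (auto intro!: tendsto_eq_intros)
      have pw: "((\<lambda>r::real. (G * (2 * r)) powr p) \<longlongrightarrow> 0) (at_right 0)"
      proof (rule tendsto_zero_powrI[OF lin tendsto_const])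
        show "\<forall>\<^sub>F r in at_right 0. 0 \<le> G * (2 * r)"
          using eventually_at_right_less[of "0::real"] by eventually_elim (use \<open>0 \<le> G\<close> in simp)
      qed (use params in simp)
      have "((\<lambda>r. G * (2 * r) + 1 * (2 * r) + L * (\<bar>\<mu>\<bar> * (G * (2 * r)) + A * (G * (2 * r)) powr p))
          \<longlongrightarrow> 0 + 0 + L * (\<bar>\<mu>\<bar> * 0 + A * 0)) (at_right 0)"
        by (intro tendsto_add tendsto_mult_left lin pw)
      then show ?thesis
        by (simp add: half_turn_bound_def[abs_def] growth_bound_def Let_def G_def)
    qed
    then have "\<forall>\<^sub>F x in at_right 0. ?f x < e" using Suc(2) by (simp add: order_tendstoD)
    then obtain d where d: "0 < d" "\<And>x. 0 < x \<Longrightarrow> x < d \<Longrightarrow> ?f x < e"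
      unfolding eventually_at_right_field by auto
    obtain \<delta> where \<delta>: "\<delta> > 0" "(?f ^^ n) \<delta> < d" using Suc(1)[OF d(1)] by blast
    have "?f ((?f ^^ n) \<delta>) < e"
    proof (cases "(?f ^^ n) \<delta> = 0")
      case True
      then show ?thesis using f0 Suc(2) by simp
    next
      case False
      then show ?thesis using d(2) \<delta> half_turn_bound_funpow_nonneg[of \<delta> n] by auto
    qed
    then show ?case using \<delta>(1) by auto
  qed
  then show thesis using that by blast
qed

end

section \<open>Rescaled angles\<close>

text \<open>
The angle \<open>\<psi>\<close> with \<open>tan \<psi> = k tan x\<close> that agrees with \<open>x\<close> at the multiples of \<open>\<pi>\<close>; the argument of
\<open>arctan\<close> is \<open>tan (\<psi> - x)\<close>, which has no poles.  A solution of \<open>x' = cos\<^sup>2 x + k\<^sup>2 sin\<^sup>2 x\<close> has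
constant speed \<open>k\<close> in this angle.
\<close>

definition rescaled_angle :: "real \<Rightarrow> real \<Rightarrow> real" where
  "rescaled_angle k x = x + arctan ((k - 1) * sin x * cos x / ((cos x)\<^sup>2 + k * (sin x)\<^sup>2))"

lemma cos_sin_sq_pos:
  fixes k :: real
  assumes "0 < k"
  shows "0 < (cos x)\<^sup>2 + k * (sin x)\<^sup>2"
proof (cases "sin x = 0")
  case True
  then show ?thesis using sin_cos_squared_add[of x] by simp
next
  case False
  then show ?thesis using assms by (simp add: add_nonneg_pos)
qed

lemma rescaled_angle_npi: "rescaled_angle k (real n * pi) = real n * pi"
  by (simp add: rescaled_angle_def)

lemma has_real_derivative_rescaled_angle:
  assumes k: "0 < k"
  shows "(rescaled_angle k has_real_derivative k / ((cos x)\<^sup>2 + k\<^sup>2 * (sin x)\<^sup>2)) (at x)"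
proof -
  define s c where "s = sin x" and "c = cos x"
  have sc: "s\<^sup>2 + c\<^sup>2 = 1" by (simp add: s_def c_def)
  define N d where "N = (k - 1) * s * c" and "d = c\<^sup>2 + k * s\<^sup>2"
  have d: "0 < d" using cos_sin_sq_pos[OF k, of x] by (simp add: d_def s_def c_def)
  have e: "0 < c\<^sup>2 + k\<^sup>2 * s\<^sup>2" using cos_sin_sq_pos[of "k\<^sup>2" x] k by (simp add: s_def c_def)
  define N' d' where "N' = (k - 1) * (c\<^sup>2 - s\<^sup>2)" and "d' = 2 * (k - 1) * s * c"
  have N': "((\<lambda>x. (k - 1) * sin x * cos x) has_real_derivative N') (at x)"
    unfolding N'_def s_def c_def
    by (auto intro!: derivative_eq_intros simp: power2_eq_square algebra_simps)
  have d': "((\<lambda>x. (cos x)\<^sup>2 + k * (sin x)\<^sup>2) has_real_derivative d') (at x)"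
    unfolding d'_def s_def c_def
    by (auto intro!: derivative_eq_intros simp: power2_eq_square algebra_simps)
  have "(cos x)\<^sup>2 + k * (sin x)\<^sup>2 \<noteq> 0" using d by (simp add: d_def s_def c_def)
  from DERIV_divide[OF N' d' this]
  have "((\<lambda>x. (k - 1) * sin x * cos x / ((cos x)\<^sup>2 + k * (sin x)\<^sup>2)) has_real_derivative
      (N' * d - N * d') / (d * d)) (at x)"
    unfolding N_def d_def s_def c_def .
  from DERIV_chain2[OF DERIV_arctan this]
  have "((\<lambda>x. arctan ((k - 1) * sin x * cos x / ((cos x)\<^sup>2 + k * (sin x)\<^sup>2))) has_real_derivative
      inverse (1 + (N / d)\<^sup>2) * ((N' * d - N * d') / (d * d))) (at x)"
    by (simp add: N_def d_def s_def c_def)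
  from DERIV_add[OF DERIV_ident this]
  have der: "(rescaled_angle k has_real_derivative
      1 + inverse (1 + (N / d)\<^sup>2) * ((N' * d - N * d') / (d * d))) (at x)"
    by (simp add: rescaled_angle_def[abs_def])
  have 1: "d\<^sup>2 + N\<^sup>2 = c\<^sup>2 + k\<^sup>2 * s\<^sup>2"
  proof -
    have "d\<^sup>2 + N\<^sup>2 = (c\<^sup>2 + k\<^sup>2 * s\<^sup>2) * (s\<^sup>2 + c\<^sup>2)"
      by (simp add: d_def N_def power2_eq_square algebra_simps)
    then show ?thesis using sc by simp
  qed
  have 2: "N' * d - N * d' = (k - 1) * (c\<^sup>2 - k * s\<^sup>2)"
  proof -
    have "N' * d - N * d' = (k - 1) * (c\<^sup>2 - k * s\<^sup>2) * (s\<^sup>2 + c\<^sup>2)"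
      by (simp add: d_def N_def N'_def d'_def power2_eq_square algebra_simps)
    then show ?thesis using sc by simp
  qed
  have "inverse (1 + (N / d)\<^sup>2) * ((N' * d - N * d') / (d * d)) = (N' * d - N * d') / (d\<^sup>2 + N\<^sup>2)"
  proof -
    have "1 + (N / d)\<^sup>2 = (d\<^sup>2 + N\<^sup>2) / d\<^sup>2" using d by (simp add: power_divide add_divide_distrib)
    then show ?thesis using d by (simp add: power2_eq_square)
  qed
  also have "1 + \<dots> = k / (c\<^sup>2 + k\<^sup>2 * s\<^sup>2)"
  proof -
    have "(c\<^sup>2 + k\<^sup>2 * s\<^sup>2) + (k - 1) * (c\<^sup>2 - k * s\<^sup>2) = k * (s\<^sup>2 + c\<^sup>2)"
      by (simp add: power2_eq_square algebra_simps)
    then have "(c\<^sup>2 + k\<^sup>2 * s\<^sup>2) + (k - 1) * (c\<^sup>2 - k * s\<^sup>2) = k" unfolding sc by simp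
    moreover have "1 + x / y = (y + x) / y" if "0 < y" for x y :: real using that by (simp add: add_divide_distrib)
    ultimately show ?thesis unfolding 1 2 using e by presburger
  qed
  finally show ?thesis using der by (simp add: s_def c_def)
qed

lemma rescaled_angle_mono:
  assumes "0 < k" "x \<le> y"
  shows "rescaled_angle k x \<le> rescaled_angle k y"
proof (rule DERIV_nonneg_imp_nondecreasing[OF assms(2)])
  fix x
  show "\<exists>y. (rescaled_angle k has_real_derivative y) (at x) \<and> 0 \<le> y"
    using has_real_derivative_rescaled_angle[OF assms(1), of x] cos_sin_sq_pos[of "k\<^sup>2" x] assms(1)
    by (intro exI conjI) auto
qed

lemma rescaled_speed_le:
  fixes k :: real
  assumes "0 < k"
  shows "k / ((cos x)\<^sup>2 + k\<^sup>2 * (sin x)\<^sup>2) \<le> k + 1 / k"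
proof -
  have pos: "0 < (cos x)\<^sup>2 + k\<^sup>2 * (sin x)\<^sup>2" using cos_sin_sq_pos[of "k\<^sup>2" x] assms by simp
  have "k = k * ((cos x)\<^sup>2 + (sin x)\<^sup>2)" by simp
  also have "\<dots> \<le> k * ((cos x)\<^sup>2 + (sin x)\<^sup>2) + ((cos x)\<^sup>2 / k + k ^ 3 * (sin x)\<^sup>2)"
    using assms by (simp only: le_add_same_cancel1) simp
  also have "k * (X + Y) + (X / k + k ^ 3 * Y) = (k + 1 / k) * (X + k\<^sup>2 * Y)" for X Y
    using assms by (simp add: field_simps power2_eq_square power3_eq_cube)
  finally show ?thesis using pos by (simp add: divide_le_eq)
qed

section \<open>Trajectories in polar coordinates\<close>

definition signed_pow :: "real \<Rightarrow> real \<Rightarrow> real" where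
  "signed_pow p x = \<bar>x\<bar> powr (p - 1) * x"

lemma signed_pow_eq: "signed_pow p x = sgn x * \<bar>x\<bar> powr p"
  by (cases "x = 0") (auto simp: signed_pow_def powr_diff sgn_if)

lemma signed_pow_minus: "signed_pow p (- x) = - signed_pow p x"
  by (simp add: signed_pow_def)

lemma signed_pow_nonneg: "0 \<le> x \<Longrightarrow> signed_pow p x = x powr p"
  by (auto simp: signed_pow_eq sgn_if)

lemma signed_pow_mult_self: "x * signed_pow p x = \<bar>x\<bar> powr (p + 1)"
  by (cases "x = 0") (auto simp: signed_pow_eq sgn_if powr_add)

lemma continuous_signed_pow:
  assumes "0 < p"
  shows "continuous_on UNIV (signed_pow p)"
proof -
  have "signed_pow p = (\<lambda>x. (max x 0) powr p - (max (- x) 0) powr p)"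
    by (auto simp: fun_eq_iff signed_pow_eq sgn_if max_def)
  moreover have "continuous_on UNIV (\<lambda>x::real. (max x 0) powr p - (max (- x) 0) powr p)"
    using assms by (intro continuous_on_diff continuous_on_powr' continuous_on_max continuous_intros) auto
  ultimately show ?thesis by simp
qed

text \<open>
The coupling \<open>e\<^bsup>(p - 1) \<rho>\<^esup>\<close>, capped at \<open>C\<close> so that the speeds below are bounded.
\<close>

definition capped_exp :: "real \<Rightarrow> real \<Rightarrow> real \<Rightarrow> real" where
  "capped_exp p C \<rho> = min (exp ((p - 1) * \<rho>)) C"

text \<open>
Substituting \<open>u = e\<^sup>\<rho> sin \<theta>\<close> and \<open>u' = e\<^sup>\<rho> cos \<theta>\<close> into \<open>- u'' = \<mu> u + a \<bar>u\<bar>\<^bsup>p - 1\<^esup> u\<close> gives these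
speeds of \<open>\<theta>\<close> and \<open>\<rho>\<close>.  They are continuous in \<open>(\<theta>, \<rho>)\<close> also for \<open>p < 1\<close>.
\<close>

definition angle_speed :: "real \<Rightarrow> real \<Rightarrow> (real \<Rightarrow> real) \<Rightarrow> real \<Rightarrow> real \<Rightarrow> real \<Rightarrow> real \<Rightarrow> real" where
  "angle_speed p \<mu> a C t \<theta> \<rho> = (cos \<theta>)\<^sup>2 + \<mu> * (sin \<theta>)\<^sup>2
     + a t * capped_exp p C \<rho> * (sin \<theta> * signed_pow p (sin \<theta>))"

definition log_radius_speed :: "real \<Rightarrow> real \<Rightarrow> (real \<Rightarrow> real) \<Rightarrow> real \<Rightarrow> real \<Rightarrow> real \<Rightarrow> real \<Rightarrow> real" where
  "log_radius_speed p \<mu> a C t \<theta> \<rho> = (1 - \<mu>) * sin \<theta> * cos \<theta>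
     - a t * capped_exp p C \<rho> * (signed_pow p (sin \<theta>) * cos \<theta>)"

locale prufer_trajectory =
  fixes L p \<mu> A :: real and a :: "real \<Rightarrow> real" and D :: "real set" and C :: real
    and \<theta> \<rho> :: "real \<Rightarrow> real"
  assumes L: "0 < L" and p: "0 < p" and C: "0 < C" and D: "finite D"
    and a: "\<And>x. x \<in> {0..L} \<Longrightarrow> 0 \<le> a x \<and> a x \<le> A"
    and cont_\<theta>: "continuous_on {0..L} \<theta>" and cont_\<rho>: "continuous_on {0..L} \<rho>" and \<theta>_0: "\<theta> 0 = 0"
    and d\<theta>: "\<And>t. t \<in> {0<..<L} - D \<Longrightarrow> (\<theta> has_real_derivative angle_speed p \<mu> a C t (\<theta> t) (\<rho> t)) (at t)"
    and d\<rho>: "\<And>t. t \<in> {0<..<L} - D \<Longrightarrow> (\<rho> has_real_derivative log_radius_speed p \<mu> a C t (\<theta> t) (\<rho> t)) (at t)"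
begin

lemma A_nonneg: "0 \<le> A" using a[of 0] L by auto

lemma capped_exp_pos: "0 < capped_exp p C r"
  using C by (simp add: capped_exp_def)

definition u :: "real \<Rightarrow> real" where "u t = exp (\<rho> t) * sin (\<theta> t)"
definition w :: "real \<Rightarrow> real" where "w t = exp (\<rho> t) * cos (\<theta> t)"

definition forcing :: "real \<Rightarrow> real" where
  "forcing t = a t * capped_exp p C (\<rho> t) * exp (\<rho> t) * signed_pow p (sin (\<theta> t))"

lemma sin_mult_signed_pow_nonneg: "0 \<le> sin x * signed_pow p (sin x)"
  by (simp add: signed_pow_mult_self)

lemma du: "t \<in> {0<..<L} - D \<Longrightarrow> (u has_real_derivative w t) (at t)"
proof -
  assume t: "t \<in> {0<..<L} - D"
  define s c E S where "s = sin (\<theta> t)" and "c = cos (\<theta> t)" and "E = a t * capped_exp p C (\<rho> t)"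
    and "S = signed_pow p s"
  have sc: "s\<^sup>2 + c\<^sup>2 = 1" by (simp add: s_def c_def)
  have "(u has_real_derivative exp (\<rho> t) * log_radius_speed p \<mu> a C t (\<theta> t) (\<rho> t) * s
      + exp (\<rho> t) * (c * angle_speed p \<mu> a C t (\<theta> t) (\<rho> t))) (at t)"
    unfolding u_def[abs_def] s_def c_def
    by (auto intro!: derivative_eq_intros d\<theta>[OF t] d\<rho>[OF t])
  moreover have "exp (\<rho> t) * log_radius_speed p \<mu> a C t (\<theta> t) (\<rho> t) * s
      + exp (\<rho> t) * (c * angle_speed p \<mu> a C t (\<theta> t) (\<rho> t)) = exp (\<rho> t) * (c * (s\<^sup>2 + c\<^sup>2))"
    unfolding log_radius_speed_def angle_speed_def s_def[symmetric] c_def[symmetric] E_def[symmetric]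
      S_def[symmetric]
    by (simp add: algebra_simps power2_eq_square)
  ultimately show ?thesis using sc by (simp add: w_def c_def)
qed

lemma dw: "t \<in> {0<..<L} - D \<Longrightarrow> (w has_real_derivative - (\<mu> * u t + forcing t)) (at t)"
proof -
  assume t: "t \<in> {0<..<L} - D"
  define s c E S where "s = sin (\<theta> t)" and "c = cos (\<theta> t)" and "E = a t * capped_exp p C (\<rho> t)"
    and "S = signed_pow p s"
  have sc: "s\<^sup>2 + c\<^sup>2 = 1" by (simp add: s_def c_def)
  have "(w has_real_derivative exp (\<rho> t) * log_radius_speed p \<mu> a C t (\<theta> t) (\<rho> t) * c
      - exp (\<rho> t) * (s * angle_speed p \<mu> a C t (\<theta> t) (\<rho> t))) (at t)"
    unfolding w_def[abs_def] s_def c_def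
    by (auto intro!: derivative_eq_intros d\<theta>[OF t] d\<rho>[OF t])
  moreover have "exp (\<rho> t) * log_radius_speed p \<mu> a C t (\<theta> t) (\<rho> t) * c
      - exp (\<rho> t) * (s * angle_speed p \<mu> a C t (\<theta> t) (\<rho> t))
      = - ((\<mu> * (exp (\<rho> t) * s) + E * exp (\<rho> t) * S) * (s\<^sup>2 + c\<^sup>2))"
    unfolding log_radius_speed_def angle_speed_def s_def[symmetric] c_def[symmetric] E_def[symmetric]
      S_def[symmetric]
    by (simp add: algebra_simps power2_eq_square)
  ultimately show ?thesis using sc by (simp add: u_def forcing_def s_def E_def S_def)
qed

lemma cont_u: "continuous_on {0..L} u" and cont_w: "continuous_on {0..L} w"
  unfolding u_def[abs_def] w_def[abs_def]
  by (intro continuous_intros cont_\<theta> cont_\<rho>)+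

text \<open>
At a multiple of \<open>\<pi>\<close> the sine vanishes and the angle has speed \<open>1\<close>.  In general the speed is at least
\<open>1 - (1 + \<bar>\<mu>\<bar>) sin\<^sup>2 \<theta>\<close>, and \<open>sin\<^sup>2 \<theta>\<close> is at most the distance to the node.
\<close>

lemma angle_passes_node:
  assumes t: "0 \<le> t" "t < t'" "t' \<le> L" and j: "real j * pi \<le> \<theta> t"
  shows "real j * pi < \<theta> t'"
proof -
  have "0 < \<theta> t' - real j * pi"
  proof (rule positive_barrier[OF D t(2), where \<kappa> = "1 + \<bar>\<mu>\<bar>"])
    show "continuous_on {t..t'} (\<lambda>x. \<theta> x - real j * pi)"
      using t by (intro continuous_intros continuous_on_subset[OF cont_\<theta>]) auto
    fix x assume x: "x \<in> {t<..<t'} - D"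
    then have x': "x \<in> {0<..<L} - D" using t by auto
    show "((\<lambda>x. \<theta> x - real j * pi) has_real_derivative angle_speed p \<mu> a C x (\<theta> x) (\<rho> x)) (at x)"
      using DERIV_diff[OF d\<theta>[OF x'] DERIV_const[of "real j * pi"]] by simp
    define z where "z = \<theta> x - real j * pi"
    have "sin (\<theta> x) = sin (z + real j * pi)" by (simp add: z_def)
    also have "\<dots> = sin z * (-1) ^ j" by (simp add: sin_add)
    finally have s: "(sin (\<theta> x))\<^sup>2 = (sin z)\<^sup>2" by (simp add: power_mult_distrib power_mult[symmetric] mult.commute)
    have "(sin z)\<^sup>2 = \<bar>sin z\<bar> * \<bar>sin z\<bar>" by (simp add: power2_eq_square abs_mult[symmetric])
    also have "\<dots> \<le> 1 * \<bar>z\<bar>" by (intro mult_mono abs_sin_x_le_abs_x) auto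
    finally have sz: "(sin z)\<^sup>2 \<le> \<bar>z\<bar>" by simp
    have "1 - (1 + \<bar>\<mu>\<bar>) * \<bar>z\<bar> \<le> 1 - (1 + \<bar>\<mu>\<bar>) * (sin z)\<^sup>2"
      using sz by (intro diff_left_mono mult_left_mono) auto
    also have "\<dots> \<le> 1 - (1 - \<mu>) * (sin z)\<^sup>2"
      by (intro diff_left_mono mult_right_mono) auto
    also have "\<dots> = (cos (\<theta> x))\<^sup>2 + \<mu> * (sin (\<theta> x))\<^sup>2"
      unfolding s[symmetric] by (simp add: cos_squared_eq algebra_simps)
    also have "\<dots> \<le> angle_speed p \<mu> a C x (\<theta> x) (\<rho> x)"
      using a[of x] x' capped_exp_pos[of "\<rho> x"] sin_mult_signed_pow_nonneg[of "\<theta> x"]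
      by (simp add: angle_speed_def)
    finally show "1 - (1 + \<bar>\<mu>\<bar>) * \<bar>\<theta> x - real j * pi\<bar> \<le> angle_speed p \<mu> a C x (\<theta> x) (\<rho> x)"
      by (simp add: z_def)
  qed (use j in auto)
  then show ?thesis by simp
qed

lemma angle_le_before: "0 \<le> t \<Longrightarrow> t \<le> t' \<Longrightarrow> t' \<le> L \<Longrightarrow> \<theta> t' \<le> real j * pi \<Longrightarrow> \<theta> t \<le> real j * pi"
  using angle_passes_node[of t t' j] by (cases "t = t'") force+

lemma forcing_bounds:
  assumes t: "t \<in> {0..L}" and \<sigma>: "\<sigma> = 1 \<or> \<sigma> = - 1" and u: "0 \<le> \<sigma> * u t"
  shows "0 \<le> \<sigma> * forcing t \<and> \<sigma> * forcing t \<le> A * (\<sigma> * u t) powr p"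
proof -
  have "\<sigma> * u t = exp (\<rho> t) * (\<sigma> * sin (\<theta> t))" by (simp add: u_def)
  with u have s: "0 \<le> \<sigma> * sin (\<theta> t)"
    using exp_gt_zero[of "\<rho> t"] zero_le_mult_iff[of "exp (\<rho> t)" "\<sigma> * sin (\<theta> t)"] by linarith
  have "\<sigma> * signed_pow p (sin (\<theta> t)) = signed_pow p (\<sigma> * sin (\<theta> t))"
    using \<sigma> signed_pow_minus by auto
  also have "\<dots> = (\<sigma> * sin (\<theta> t)) powr p" by (rule signed_pow_nonneg[OF s])
  finally have S: "\<sigma> * forcing t = a t * capped_exp p C (\<rho> t) * exp (\<rho> t) * (\<sigma> * sin (\<theta> t)) powr p"
    by (simp add: forcing_def)
  have "capped_exp p C (\<rho> t) * exp (\<rho> t) \<le> exp ((p - 1) * \<rho> t) * exp (\<rho> t)"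
    by (intro mult_right_mono) (auto simp: capped_exp_def)
  also have "\<dots> = exp (\<rho> t) powr p" by (simp add: powr_def exp_add[symmetric] algebra_simps)
  finally have "capped_exp p C (\<rho> t) * exp (\<rho> t) * (\<sigma> * sin (\<theta> t)) powr p
      \<le> exp (\<rho> t) powr p * (\<sigma> * sin (\<theta> t)) powr p"
    by (intro mult_right_mono) auto
  also have "\<dots> = (\<sigma> * u t) powr p" using s by (simp add: u_def powr_mult[symmetric] mult_ac)
  finally have 1: "capped_exp p C (\<rho> t) * exp (\<rho> t) * (\<sigma> * sin (\<theta> t)) powr p \<le> (\<sigma> * u t) powr p" .
  have 0: "0 \<le> capped_exp p C (\<rho> t) * exp (\<rho> t) * (\<sigma> * sin (\<theta> t)) powr p"
    using capped_exp_pos[of "\<rho> t"] by simp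
  have "a t * (capped_exp p C (\<rho> t) * exp (\<rho> t) * (\<sigma> * sin (\<theta> t)) powr p) \<le> A * (\<sigma> * u t) powr p"
    using a[OF t] 1 0 by (intro mult_mono) auto
  moreover have "0 \<le> a t * (capped_exp p C (\<rho> t) * exp (\<rho> t) * (\<sigma> * sin (\<theta> t)) powr p)"
    by (rule mult_nonneg_nonneg[OF conjunct1[OF a[OF t]] 0])
  ultimately show ?thesis unfolding S by (simp add: mult_ac)
qed

lemma abs_u_plus_abs_w: "exp (\<rho> t) \<le> \<bar>u t\<bar> + \<bar>w t\<bar>" "\<bar>u t\<bar> + \<bar>w t\<bar> \<le> 2 * exp (\<rho> t)"
proof -
  have e: "\<bar>u t\<bar> + \<bar>w t\<bar> = exp (\<rho> t) * (\<bar>sin (\<theta> t)\<bar> + \<bar>cos (\<theta> t)\<bar>)"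
    by (simp add: u_def w_def abs_mult algebra_simps)
  have sq: "(sin x)\<^sup>2 \<le> \<bar>sin x\<bar>" "(cos x)\<^sup>2 \<le> \<bar>cos x\<bar>" for x :: real
    using power_decreasing[of 1 2 "\<bar>sin x\<bar>"] power_decreasing[of 1 2 "\<bar>cos x\<bar>"] by auto
  have "1 \<le> \<bar>sin (\<theta> t)\<bar> + \<bar>cos (\<theta> t)\<bar>"
    using sq[of "\<theta> t"] sin_cos_squared_add[of "\<theta> t"] by linarith
  then show "exp (\<rho> t) \<le> \<bar>u t\<bar> + \<bar>w t\<bar>" unfolding e by simp
  have "\<bar>sin (\<theta> t)\<bar> + \<bar>cos (\<theta> t)\<bar> \<le> 2"
    using abs_sin_le_one[of "\<theta> t"] abs_cos_le_one[of "\<theta> t"] by linarith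
  then show "\<bar>u t\<bar> + \<bar>w t\<bar> \<le> 2 * exp (\<rho> t)" unfolding e by simp
qed

text \<open>
The second bound is the first one for the time-reversed trajectory: \<open>u (- x)\<close> satisfies the same
equation, with derivative \<open>- w (- x)\<close>.
\<close>

lemma growth_on_signed_interval:
  assumes \<sigma>: "\<sigma> = 1 \<or> \<sigma> = - 1" and I: "0 \<le> \<alpha>" "\<alpha> \<le> \<beta>" "\<beta> \<le> L"
    and sign: "\<And>x. x \<in> {\<alpha>..\<beta>} \<Longrightarrow> 0 \<le> \<sigma> * u x"
  shows "\<bar>u \<beta>\<bar> + \<bar>w \<beta>\<bar> \<le> growth_bound L p \<mu> A (\<bar>u \<alpha>\<bar> + \<bar>w \<alpha>\<bar>)"
    and "\<bar>u \<alpha>\<bar> + \<bar>w \<alpha>\<bar> \<le> growth_bound L p \<mu> A (\<bar>u \<beta>\<bar> + \<bar>w \<beta>\<bar>)"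
proof -
  have abs: "abs (\<sigma> * x) = abs x" "abs (- (\<sigma> * x)) = abs x" for x using \<sigma> by auto
  have sub: "{\<alpha>..\<beta>} \<subseteq> {0..L}" using I by auto
  have "\<bar>\<sigma> * u \<beta>\<bar> + \<bar>\<sigma> * w \<beta>\<bar> \<le> growth_bound L p \<mu> A (\<bar>\<sigma> * u \<alpha>\<bar> + \<bar>\<sigma> * w \<alpha>\<bar>)"
  proof (rule growth_forward[OF D, where h = "\<lambda>x. \<sigma> * forcing x"])
    show "continuous_on {\<alpha>..\<beta>} (\<lambda>x. \<sigma> * u x)" "continuous_on {\<alpha>..\<beta>} (\<lambda>x. \<sigma> * w x)"
      using sub by (auto intro!: continuous_intros intro: continuous_on_subset[OF cont_u] continuous_on_subset[OF cont_w])
    fix x assume x: "x \<in> {\<alpha><..<\<beta>} - D"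
    then have x': "x \<in> {0<..<L} - D" using I by auto
    show "((\<lambda>x. \<sigma> * u x) has_real_derivative \<sigma> * w x) (at x)"
      by (rule DERIV_cmult[OF du[OF x']])
    have "((\<lambda>x. \<sigma> * w x) has_real_derivative \<sigma> * - (\<mu> * u x + forcing x)) (at x)"
      by (rule DERIV_cmult[OF dw[OF x']])
    then show "((\<lambda>x. \<sigma> * w x) has_real_derivative - (\<mu> * (\<sigma> * u x) + \<sigma> * forcing x)) (at x)"
      by (simp add: algebra_simps)
  next
    fix x assume "x \<in> {\<alpha><..<\<beta>}"
    then show "0 \<le> \<sigma> * forcing x \<and> \<sigma> * forcing x \<le> A * (\<sigma> * u x) powr p"
      using I sign[of x] by (intro forcing_bounds[OF _ \<sigma>]) auto
  qed (use I p A_nonneg sign in auto)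
  then show "\<bar>u \<beta>\<bar> + \<bar>w \<beta>\<bar> \<le> growth_bound L p \<mu> A (\<bar>u \<alpha>\<bar> + \<bar>w \<alpha>\<bar>)" by (simp only: abs)
  have refl: "((\<lambda>x. f (- x)) has_real_derivative - d) (at x)"
    if "(f has_real_derivative d) (at (- x))" for f d and x :: real
    using DERIV_mirror[of f d x] that by simp
  have "abs (\<sigma> * u (- (- \<alpha>))) + abs (- (\<sigma> * w (- (- \<alpha>))))
      \<le> growth_bound L p \<mu> A (abs (\<sigma> * u (- (- \<beta>))) + abs (- (\<sigma> * w (- (- \<beta>)))))"
  proof (rule growth_forward[of "uminus ` D" "- \<alpha>" "- \<beta>", where u = "\<lambda>x. \<sigma> * u (- x)"
        and w = "\<lambda>x. - (\<sigma> * w (- x))" and h = "\<lambda>x. \<sigma> * forcing (- x)"])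
    have "uminus ` {- \<beta>..- \<alpha>} \<subseteq> {0..L}" using I by auto
    then show "continuous_on {- \<beta>..- \<alpha>} (\<lambda>x. \<sigma> * u (- x))" "continuous_on {- \<beta>..- \<alpha>} (\<lambda>x. - (\<sigma> * w (- x)))"
      by (auto intro!: continuous_intros intro: continuous_on_compose2[OF cont_u] continuous_on_compose2[OF cont_w])
    fix x assume x: "x \<in> {- \<beta><..<- \<alpha>} - uminus ` D"
    then have "- x \<notin> D" by (metis DiffD2 image_eqI minus_minus)
    then have x': "- x \<in> {0<..<L} - D" using I x by auto
    show "((\<lambda>x. \<sigma> * u (- x)) has_real_derivative - (\<sigma> * w (- x))) (at x)"
      using DERIV_cmult[OF refl[OF du[OF x']], of \<sigma>] by simp
    have "((\<lambda>x. - (\<sigma> * w (- x))) has_real_derivative - (\<sigma> * (- (- (\<mu> * u (- x) + forcing (- x)))))) (at x)"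
      by (intro DERIV_minus DERIV_cmult refl dw[OF x'])
    then show "((\<lambda>x. - (\<sigma> * w (- x))) has_real_derivative - (\<mu> * (\<sigma> * u (- x)) + \<sigma> * forcing (- x))) (at x)"
      by (simp add: algebra_simps)
  next
    fix x assume "x \<in> {- \<beta><..<- \<alpha>}"
    then show "0 \<le> \<sigma> * forcing (- x) \<and> \<sigma> * forcing (- x) \<le> A * (\<sigma> * u (- x)) powr p"
      using I sign[of "- x"] by (intro forcing_bounds[OF _ \<sigma>]) auto
  qed (use I p A_nonneg sign D in auto)
  then show "\<bar>u \<alpha>\<bar> + \<bar>w \<alpha>\<bar> \<le> growth_bound L p \<mu> A (\<bar>u \<beta>\<bar> + \<bar>w \<beta>\<bar>)"
    by (simp only: abs minus_minus)
qed

lemma growth_on_half_turn: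
  assumes I: "0 \<le> \<alpha>" "\<alpha> \<le> \<beta>" "\<beta> \<le> L" and j: "real j * pi \<le> \<theta> \<alpha>" "\<theta> \<beta> \<le> real (Suc j) * pi"
  shows "exp (\<rho> \<beta>) \<le> half_turn_bound L p \<mu> A (exp (\<rho> \<alpha>))"
    and "exp (\<rho> \<alpha>) \<le> half_turn_bound L p \<mu> A (exp (\<rho> \<beta>))"
proof -
  define \<sigma> :: real where "\<sigma> = (-1) ^ j"
  have \<sigma>: "\<sigma> = 1 \<or> \<sigma> = - 1" unfolding \<sigma>_def by (cases "even j") auto
  have sign: "0 \<le> \<sigma> * u x" if x: "x \<in> {\<alpha>..\<beta>}" for x
  proof -
    have "real j * pi \<le> \<theta> x" using angle_passes_node[of \<alpha> x j] x I j by (cases "\<alpha> = x") auto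
    moreover have "\<theta> x \<le> real (Suc j) * pi" using angle_le_before[of x \<beta> "Suc j"] x I j by auto
    ultimately have "0 \<le> \<theta> x - real j * pi" "\<theta> x - real j * pi \<le> pi" by (auto simp: algebra_simps)
    then have "0 \<le> sin (\<theta> x - real j * pi)" by (rule sin_ge_zero)
    also have "\<dots> = sin (\<theta> x) * (-1) ^ j" by (simp add: sin_diff)
    finally show ?thesis by (simp add: u_def \<sigma>_def mult_ac)
  qed
  note g = growth_on_signed_interval[OF \<sigma> I sign]
  have m: "growth_bound L p \<mu> A (\<bar>u t\<bar> + \<bar>w t\<bar>) \<le> half_turn_bound L p \<mu> A (exp (\<rho> t))" for t
    unfolding half_turn_bound_def using abs_u_plus_abs_w[of t] L p A_nonneg by (intro growth_bound_mono) auto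
  show "exp (\<rho> \<beta>) \<le> half_turn_bound L p \<mu> A (exp (\<rho> \<alpha>))"
    using abs_u_plus_abs_w(1)[of \<beta>] g(1) m[of \<alpha>] by linarith
  show "exp (\<rho> \<alpha>) \<le> half_turn_bound L p \<mu> A (exp (\<rho> \<beta>))"
    using abs_u_plus_abs_w(1)[of \<alpha>] g(2) m[of \<beta>] by linarith
qed

text \<open>
After at most \<open>j\<close> half turns the amplitude is controlled by \<open>j\<close> iterations of the bound for one half
turn, and the initial amplitude by the present one in the same way.
\<close>

lemma growth_over_half_turns:
  assumes "0 \<le> t" "t \<le> L" "\<theta> t \<le> real j * pi"
  shows "exp (\<rho> t) \<le> (half_turn_bound L p \<mu> A ^^ j) (exp (\<rho> 0)) \<and>
    exp (\<rho> 0) \<le> (half_turn_bound L p \<mu> A ^^ j) (exp (\<rho> t))"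
  using assms
proof (induction j arbitrary: t)
  case 0
  then have "t = 0" using angle_passes_node[of 0 t 0] \<theta>_0 by (cases "t = 0") auto
  then show ?case by simp
next
  case (Suc j)
  let ?f = "half_turn_bound L p \<mu> A"
  have par: "0 \<le> L" "0 < p" "0 \<le> A" using L p A_nonneg by auto
  show ?case
  proof (cases "\<theta> t \<le> real j * pi")
    case True
    then have IH: "exp (\<rho> t) \<le> (?f ^^ j) (exp (\<rho> 0))" "exp (\<rho> 0) \<le> (?f ^^ j) (exp (\<rho> t))"
      using Suc by auto
    have "(?f ^^ j) r \<le> (?f ^^ Suc j) r" if "0 \<le> r" for r
      using half_turn_bound_ge[OF par half_turn_bound_funpow_nonneg[OF par that]] by simp
    then show ?thesis using IH order_trans exp_ge_zero by meson
  next
    case False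
    have "continuous_on {0..t} \<theta>" using Suc.prems by (intro continuous_on_subset[OF cont_\<theta>]) auto
    then obtain \<tau> where \<tau>: "0 \<le> \<tau>" "\<tau> \<le> t" "\<theta> \<tau> = real j * pi"
      using IVT'[of \<theta> 0 "real j * pi" t] \<theta>_0 False Suc.prems by auto
    have IH: "exp (\<rho> \<tau>) \<le> (?f ^^ j) (exp (\<rho> 0))" "exp (\<rho> 0) \<le> (?f ^^ j) (exp (\<rho> \<tau>))"
      using Suc.IH[of \<tau>] \<tau> Suc.prems by auto
    have g: "exp (\<rho> t) \<le> ?f (exp (\<rho> \<tau>))" "exp (\<rho> \<tau>) \<le> ?f (exp (\<rho> t))"
      using growth_on_half_turn[of \<tau> t j] \<tau> Suc.prems by auto
    have "exp (\<rho> t) \<le> ?f ((?f ^^ j) (exp (\<rho> 0)))"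
      using g(1) half_turn_bound_mono[OF par _ IH(1)] by (meson exp_ge_zero order_trans)
    moreover have "exp (\<rho> 0) \<le> (?f ^^ j) (?f (exp (\<rho> t)))"
      using IH(2) half_turn_bound_funpow_mono[OF par _ g(2)] by (meson exp_ge_zero order_trans)
    ultimately show ?thesis by (simp add: funpow_swap1)
  qed
qed

text \<open>
An error \<open>e\<close> in the speed of \<open>\<theta>\<close> is multiplied by the derivative of the rescaled angle, which is at
most \<open>k + 1 / k\<close>.
\<close>

lemma rescaled_angle_increment:
  assumes k: "0 < k" and I: "0 \<le> \<alpha>" "\<alpha> \<le> \<beta>" "\<beta> \<le> L"
  shows "(\<And>t. t \<in> {\<alpha><..<\<beta>} \<Longrightarrow> angle_speed p \<mu> a C t (\<theta> t) (\<rho> t) \<le> (cos (\<theta> t))\<^sup>2 + k\<^sup>2 * (sin (\<theta> t))\<^sup>2 + e)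
      \<Longrightarrow> 0 \<le> e \<Longrightarrow>
      rescaled_angle k (\<theta> \<beta>) - rescaled_angle k (\<theta> \<alpha>) \<le> (k + e * (k + 1 / k)) * (\<beta> - \<alpha>)"
    and "(\<And>t. t \<in> {\<alpha><..<\<beta>} \<Longrightarrow> (cos (\<theta> t))\<^sup>2 + k\<^sup>2 * (sin (\<theta> t))\<^sup>2 - e \<le> angle_speed p \<mu> a C t (\<theta> t) (\<rho> t))
      \<Longrightarrow> 0 \<le> e \<Longrightarrow>
      (k - e * (k + 1 / k)) * (\<beta> - \<alpha>) \<le> rescaled_angle k (\<theta> \<beta>) - rescaled_angle k (\<theta> \<alpha>)"
proof -
  define q where "q t = (cos (\<theta> t))\<^sup>2 + k\<^sup>2 * (sin (\<theta> t))\<^sup>2" for t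
  have q: "0 < q t" for t unfolding q_def using cos_sin_sq_pos[of "k\<^sup>2"] k by simp
  have kq: "k / q t \<le> k + 1 / k" for t unfolding q_def by (rule rescaled_speed_le[OF k])
  have cont: "continuous_on {\<alpha>..\<beta>} (\<lambda>t. rescaled_angle k (\<theta> t))"
  proof (rule continuous_on_compose2[of UNIV "rescaled_angle k"])
    show "continuous_on UNIV (rescaled_angle k)"
      using has_real_derivative_rescaled_angle[OF k] by (meson DERIV_isCont continuous_at_imp_continuous_on)
    show "continuous_on {\<alpha>..\<beta>} \<theta>" using I by (intro continuous_on_subset[OF cont_\<theta>]) auto
  qed auto
  have der: "((\<lambda>t. rescaled_angle k (\<theta> t)) has_real_derivative
      k / q t * angle_speed p \<mu> a C t (\<theta> t) (\<rho> t)) (at t)" if "t \<in> {\<alpha><..<\<beta>} - D" for t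
    unfolding q_def using that I
    by (intro DERIV_chain2[OF has_real_derivative_rescaled_angle[OF k] d\<theta>]) auto
  {
    assume up: "\<And>t. t \<in> {\<alpha><..<\<beta>} \<Longrightarrow> angle_speed p \<mu> a C t (\<theta> t) (\<rho> t)
        \<le> (cos (\<theta> t))\<^sup>2 + k\<^sup>2 * (sin (\<theta> t))\<^sup>2 + e" and e: "0 \<le> e"
    show "rescaled_angle k (\<theta> \<beta>) - rescaled_angle k (\<theta> \<alpha>) \<le> (k + e * (k + 1 / k)) * (\<beta> - \<alpha>)"
    proof (rule deriv_le_imp_increment_le[OF D I(2) cont der])
      fix t assume t: "t \<in> {\<alpha><..<\<beta>} - D"
      have "k / q t * angle_speed p \<mu> a C t (\<theta> t) (\<rho> t) \<le> k / q t * (q t + e)"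
        using up[of t] t q[of t] k by (intro mult_left_mono) (auto simp: q_def)
      also have "\<dots> = k + k / q t * e" using q[of t] by (simp add: field_simps)
      also have "\<dots> \<le> k + (k + 1 / k) * e" using kq[of t] e by (intro add_left_mono mult_right_mono) auto
      finally show "k / q t * angle_speed p \<mu> a C t (\<theta> t) (\<rho> t) \<le> k + e * (k + 1 / k)"
        by (simp add: mult.commute)
    qed
  next
    assume lo: "\<And>t. t \<in> {\<alpha><..<\<beta>} \<Longrightarrow> (cos (\<theta> t))\<^sup>2 + k\<^sup>2 * (sin (\<theta> t))\<^sup>2 - e
        \<le> angle_speed p \<mu> a C t (\<theta> t) (\<rho> t)" and e: "0 \<le> e"
    show "(k - e * (k + 1 / k)) * (\<beta> - \<alpha>) \<le> rescaled_angle k (\<theta> \<beta>) - rescaled_angle k (\<theta> \<alpha>)"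
    proof (rule deriv_ge_imp_increment_ge[OF D I(2) cont der])
      fix t assume t: "t \<in> {\<alpha><..<\<beta>} - D"
      have "k - (k + 1 / k) * e \<le> k - k / q t * e" using kq[of t] e by (intro diff_left_mono mult_right_mono) auto
      also have "\<dots> = k / q t * (q t - e)" using q[of t] by (simp add: field_simps)
      also have "\<dots> \<le> k / q t * angle_speed p \<mu> a C t (\<theta> t) (\<rho> t)"
        using lo[of t] t q[of t] k by (intro mult_left_mono) (auto simp: q_def)
      finally show "k - e * (k + 1 / k) \<le> k / q t * angle_speed p \<mu> a C t (\<theta> t) (\<rho> t)"
        by (simp add: mult.commute)
    qed
  }
qed

text \<open>
With \<open>\<mu> \<le> k\<^sup>2\<close> and a nonlinear term of size \<open>e\<close> the speed of the rescaled angle exceeds \<open>k\<close> by a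
multiple of \<open>e\<close> only.  The coupling is known to be weak only while \<open>\<theta> \<le> n \<pi>\<close>, so the comparison is made up
to the first passage \<open>T\<close> of \<open>\<theta>\<close> through \<open>n \<pi>\<close>.
\<close>

lemma weak_coupling_angle_less:
  assumes k: "0 < k" "\<mu> \<le> k\<^sup>2" and e: "0 \<le> e" "(k + e * (k + 1 / k)) * L < real n * pi"
    and weak: "\<And>t. t \<in> {0..L} \<Longrightarrow> \<theta> t \<le> real n * pi \<Longrightarrow> A * exp ((p - 1) * \<rho> t) \<le> e"
  shows "\<theta> L < real n * pi"
proof (rule ccontr)
  assume "\<not> \<theta> L < real n * pi"
  then obtain T where T: "0 \<le> T" "T \<le> L" "\<theta> T = real n * pi"
    using IVT'[of \<theta> 0 "real n * pi" L] \<theta>_0 cont_\<theta> L by auto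
  have "rescaled_angle k (\<theta> T) - rescaled_angle k (\<theta> 0) \<le> (k + e * (k + 1 / k)) * (T - 0)"
  proof (rule rescaled_angle_increment(1)[OF k(1) _ _ _ _ e(1)])
    fix t assume t: "t \<in> {0<..<T}"
    then have t': "t \<in> {0..L}" using T by auto
    have "\<theta> t \<le> real n * pi" using angle_le_before[of t T n] t T by auto
    note wk = weak[OF t' this]
    have sp: "0 \<le> sin x * signed_pow p (sin x)" "sin x * signed_pow p (sin x) \<le> 1" for x
    proof -
      have "\<bar>sin x\<bar> powr (p + 1) \<le> 1 powr (p + 1)" using p by (intro powr_mono2) auto
      then show "0 \<le> sin x * signed_pow p (sin x)" "sin x * signed_pow p (sin x) \<le> 1"
        by (simp_all add: signed_pow_mult_self)
    qed
    have "a t * capped_exp p C (\<rho> t) * (sin (\<theta> t) * signed_pow p (sin (\<theta> t))) \<le> (A * exp ((p - 1) * \<rho> t)) * 1"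
    proof (rule mult_mono)
      show "a t * capped_exp p C (\<rho> t) \<le> A * exp ((p - 1) * \<rho> t)"
        using a[OF t'] A_nonneg capped_exp_pos[of "\<rho> t"] by (intro mult_mono) (auto simp: capped_exp_def)
    qed (use sp A_nonneg in auto)
    then have 1: "a t * capped_exp p C (\<rho> t) * (sin (\<theta> t) * signed_pow p (sin (\<theta> t))) \<le> e" using wk by linarith
    have "\<mu> * (sin (\<theta> t))\<^sup>2 \<le> k\<^sup>2 * (sin (\<theta> t))\<^sup>2" using k by (intro mult_right_mono) auto
    with 1 show "angle_speed p \<mu> a C t (\<theta> t) (\<rho> t) \<le> (cos (\<theta> t))\<^sup>2 + k\<^sup>2 * (sin (\<theta> t))\<^sup>2 + e"
      unfolding angle_speed_def by linarith
  qed (use T in auto)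
  also have "\<dots> \<le> (k + e * (k + 1 / k)) * L"
    using T k e by (intro mult_left_mono) auto
  finally show False
    using e(2) rescaled_angle_npi[of k n] rescaled_angle_npi[of k 0] T \<theta>_0 by simp
qed

text \<open>
Strong coupling makes the term with \<open>a\<close> dominate on \<open>[0, s0]\<close>, so that the rescaled angle has speed
at least \<open>k\<close> up to a multiple of \<open>e\<close>, and it leaves \<open>[0, n \<pi>]\<close> within time \<open>s0\<close>.
\<close>

lemma strong_coupling_angle_greater:
  assumes s0: "0 < s0" "s0 \<le> L" and a0: "0 \<le> a0" "\<And>t. t \<in> {0<..<s0} \<Longrightarrow> a0 \<le> a t"
    and k: "0 < k" and e: "0 \<le> e" "real n * pi < (k - e * (k + 1 / k)) * s0"
    and Q: "\<And>x::real. \<bar>x\<bar> \<le> 1 \<Longrightarrow> k\<^sup>2 * x\<^sup>2 - e \<le> \<mu> * x\<^sup>2 + a0 * Q * \<bar>x\<bar> powr (p + 1)" and "0 \<le> Q"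
    and strong: "\<And>t. t \<in> {0..L} \<Longrightarrow> \<theta> t \<le> real n * pi \<Longrightarrow> Q \<le> capped_exp p C (\<rho> t)"
  shows "real n * pi < \<theta> L"
proof (rule ccontr)
  assume "\<not> real n * pi < \<theta> L"
  then have le: "\<theta> t \<le> real n * pi" if "t \<in> {0..L}" for t
    using angle_le_before[of t L n] that by auto
  have "(k - e * (k + 1 / k)) * (s0 - 0) \<le> rescaled_angle k (\<theta> s0) - rescaled_angle k (\<theta> 0)"
  proof (rule rescaled_angle_increment(2)[OF k _ _ _ _ e(1)])
    fix t assume t: "t \<in> {0<..<s0}"
    then have t': "t \<in> {0..L}" using s0 by auto
    have "a0 * Q * \<bar>sin (\<theta> t)\<bar> powr (p + 1) \<le> a t * capped_exp p C (\<rho> t) * \<bar>sin (\<theta> t)\<bar> powr (p + 1)"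
      using a0 t strong[OF t' le[OF t']] \<open>0 \<le> Q\<close> by (intro mult_right_mono mult_mono) (auto intro: order_trans)
    then show "(cos (\<theta> t))\<^sup>2 + k\<^sup>2 * (sin (\<theta> t))\<^sup>2 - e \<le> angle_speed p \<mu> a C t (\<theta> t) (\<rho> t)"
      using Q[of "sin (\<theta> t)"] unfolding angle_speed_def signed_pow_mult_self by simp
  qed (use s0 in auto)
  moreover have "rescaled_angle k (\<theta> s0) \<le> rescaled_angle k (real n * pi)"
    using le[of s0] s0 by (intro rescaled_angle_mono[OF k]) auto
  ultimately show False
    using e(2) rescaled_angle_npi[of k n] rescaled_angle_npi[of k 0] \<theta>_0 by simp
qed

end

definition prufer_field ::
    "real \<Rightarrow> real \<Rightarrow> (real \<Rightarrow> real) \<Rightarrow> real \<Rightarrow> real \<Rightarrow> real \<times> real \<Rightarrow> real \<times> real" where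
  "prufer_field p \<mu> a C t y =
     (angle_speed p \<mu> a C t (fst y) (snd y), log_radius_speed p \<mu> a C t (fst y) (snd y))"

lemma solves_ivp_prufer_field_imp_trajectory:
  assumes L: "0 < L" and p: "0 < p" and C: "0 < C" and D: "finite D"
    and a: "\<And>x. x \<in> {0..L} \<Longrightarrow> 0 \<le> a x \<and> a x \<le> A"
    and y: "solves_ivp (prufer_field p \<mu> a C) L D (0, \<rho>0) y"
  shows "prufer_trajectory L p \<mu> A a D C (\<lambda>t. fst (y t)) (\<lambda>t. snd (y t))"
proof
  have cont: "continuous_on {0..L} y"
    and der: "\<And>t. t \<in> {0<..<L} - D \<Longrightarrow> (y has_vector_derivative prufer_field p \<mu> a C t (y t)) (at t)"
    using y by (auto simp: solves_ivp_def)
  show "continuous_on {0..L} (\<lambda>t. fst (y t))" "continuous_on {0..L} (\<lambda>t. snd (y t))"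
    by (intro continuous_intros cont)+
  show "fst (y 0) = 0" using y by (simp add: solves_ivp_def)
  fix t assume t: "t \<in> {0<..<L} - D"
  show "((\<lambda>t. fst (y t)) has_real_derivative angle_speed p \<mu> a C t (fst (y t)) (snd (y t))) (at t)"
    using bounded_linear.has_vector_derivative[OF bounded_linear_fst der[OF t]]
    by (simp add: prufer_field_def has_real_derivative_iff_has_vector_derivative)
  show "((\<lambda>t. snd (y t)) has_real_derivative log_radius_speed p \<mu> a C t (fst (y t)) (snd (y t))) (at t)"
    using bounded_linear.has_vector_derivative[OF bounded_linear_snd der[OF t]]
    by (simp add: prufer_field_def has_real_derivative_iff_has_vector_derivative)
qed (use assms in auto)

lemma prufer_field_bounded:
  assumes p: "0 < p" and C: "0 < C" and a: "0 \<le> a t" "a t \<le> A"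
  shows "norm (prufer_field p \<mu> a C t y) \<le> 2 * (1 + \<bar>\<mu>\<bar> + A * C)"
proof -
  obtain \<theta> \<rho> where y: "y = (\<theta>, \<rho>)" by (cases y)
  define s c S E where "s = sin \<theta>" and "c = cos \<theta>" and "S = signed_pow p s" and "E = capped_exp p C \<rho>"
  have sc: "\<bar>s\<bar> \<le> 1" "\<bar>c\<bar> \<le> 1" by (simp_all add: s_def c_def)
  have S: "\<bar>S\<bar> \<le> 1"
  proof -
    have "\<bar>S\<bar> \<le> \<bar>s\<bar> powr p" by (simp add: S_def signed_pow_eq abs_mult sgn_if)
    also have "\<dots> \<le> 1 powr p" using sc p by (intro powr_mono2) auto
    finally show ?thesis by simp
  qed
  have E: "0 \<le> E" "E \<le> C" using C by (auto simp: E_def capped_exp_def)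
  have prod: "\<bar>x * z\<bar> \<le> 1" if "\<bar>x\<bar> \<le> 1" "\<bar>z\<bar> \<le> 1" for x z :: real
    using mult_mono[OF that] by (simp add: abs_mult)
  have aE: "0 \<le> a t * E" "a t * E \<le> A * C" using a E by (auto intro: mult_mono)
  have scale: "\<bar>k * x\<bar> \<le> \<bar>k\<bar>" if "\<bar>x\<bar> \<le> 1" for k x :: real
    using mult_left_mono[OF that abs_ge_zero[of k]] by (simp add: abs_mult)
  have big: "\<bar>a t * E * x\<bar> \<le> A * C" if "\<bar>x\<bar> \<le> 1" for x
    using scale[OF that, of "a t * E"] aE by linarith
  have c2: "\<bar>c\<^sup>2\<bar> \<le> 1" "\<bar>s\<^sup>2\<bar> \<le> 1" using prod[OF sc(2) sc(2)] prod[OF sc(1) sc(1)] by (simp_all add: power2_eq_square)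
  have 1: "\<bar>angle_speed p \<mu> a C t \<theta> \<rho>\<bar> \<le> 1 + \<bar>\<mu>\<bar> + A * C"
    unfolding angle_speed_def s_def[symmetric] c_def[symmetric] S_def[symmetric] E_def[symmetric]
    using c2(1) scale[OF c2(2), of \<mu>] big[OF prod[OF sc(1) S]] by linarith
  have "\<bar>(1 - \<mu>) * s * c\<bar> \<le> \<bar>1 - \<mu>\<bar>" using scale[OF prod[OF sc], of "1 - \<mu>"] by (simp add: mult.assoc)
  then have 2: "\<bar>log_radius_speed p \<mu> a C t \<theta> \<rho>\<bar> \<le> 1 + \<bar>\<mu>\<bar> + A * C"
    unfolding log_radius_speed_def s_def[symmetric] c_def[symmetric] S_def[symmetric] E_def[symmetric]
    using big[OF prod[OF S sc(2)]] by linarith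
  have "norm (prufer_field p \<mu> a C t y) \<le> \<bar>angle_speed p \<mu> a C t \<theta> \<rho>\<bar> + \<bar>log_radius_speed p \<mu> a C t \<theta> \<rho>\<bar>"
    unfolding prufer_field_def y norm_Pair fst_conv snd_conv real_norm_def
    using sqrt_sum_squares_le_sum_abs[of "angle_speed p \<mu> a C t \<theta> \<rho>"] by simp
  also have "\<dots> \<le> (1 + \<bar>\<mu>\<bar> + A * C) + (1 + \<bar>\<mu>\<bar> + A * C)" by (rule add_mono[OF 1 2])
  finally show ?thesis by simp
qed

lemma prufer_field_continuous:
  assumes p: "0 < p"
  shows "isCont a t \<Longrightarrow> isCont (\<lambda>x. prufer_field p \<mu> a C (fst x) (snd x)) (t, y)"
    and "continuous_on UNIV (prufer_field p \<mu> a C t)"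
proof -
  have S: "isCont (signed_pow p) x" for x
    using continuous_signed_pow[OF p] by (simp add: continuous_on_eq_continuous_at)
  have S': "isCont (\<lambda>x. signed_pow p (f x)) x" if "isCont f x" for f :: "'b::t2_space \<Rightarrow> real" and x
    using isCont_o2[OF that S] .
  show "isCont (\<lambda>x. prufer_field p \<mu> a C (fst x) (snd x)) (t, y)" if "isCont a t"
  proof -
    have a': "isCont (\<lambda>x. a (fst x)) (t, y)"
      by (rule isCont_o2[where g = a]) (use that in \<open>auto intro: continuous_intros\<close>)
    show ?thesis
      unfolding prufer_field_def angle_speed_def log_radius_speed_def capped_exp_def
      by (intro continuous_intros S' a')
  qed
  have S'': "continuous_on UNIV (\<lambda>x. signed_pow p (f x))" if "continuous_on UNIV f" for f :: "'b::t2_space \<Rightarrow> real"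
    by (rule continuous_on_compose2[OF continuous_signed_pow[OF p] that]) auto
  show "continuous_on UNIV (prufer_field p \<mu> a C t)"
    unfolding prufer_field_def[abs_def] angle_speed_def log_radius_speed_def capped_exp_def
    by (intro continuous_intros S'')
qed

section \<open>Choice of the initial amplitudes\<close>

text \<open>
For \<open>\<bar>x\<bar>\<close> below \<open>\<delta>\<close> the error \<open>e\<close> absorbs the quadratic terms; above \<open>\<delta>\<close> the power is bounded away
from \<open>0\<close>, and a large factor \<open>Q\<close> lifts it above them.
\<close>

lemma strong_coupling_threshold:
  fixes k \<mu> a0 e p :: real
  assumes "0 < a0" "0 < e" "0 < p"
  obtains Q where "0 < Q"
    "\<And>x. \<bar>x\<bar> \<le> 1 \<Longrightarrow> k\<^sup>2 * x\<^sup>2 - e \<le> \<mu> * x\<^sup>2 + a0 * Q * \<bar>x\<bar> powr (p + 1)"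
proof -
  define K where "K = k\<^sup>2 + \<bar>\<mu>\<bar> + 1"
  have K: "0 < K" "k\<^sup>2 - \<mu> \<le> K" by (auto simp: K_def add_nonneg_pos)
  define \<delta> where "\<delta> = sqrt (e / K)"
  have \<delta>: "0 < \<delta>" "\<delta>\<^sup>2 = e / K" using K assms by (auto simp: \<delta>_def)
  define Q where "Q = K / (a0 * \<delta> powr (p + 1))"
  have Q: "0 < Q" "a0 * Q * \<delta> powr (p + 1) = K" using K \<delta> assms by (auto simp: Q_def)
  show thesis
  proof (rule that[OF Q(1)])
    fix x :: real assume x: "\<bar>x\<bar> \<le> 1"
    have "(k\<^sup>2 - \<mu>) * x\<^sup>2 \<le> K * x\<^sup>2" using K by (intro mult_right_mono) auto
    also have "K * x\<^sup>2 \<le> e + a0 * Q * \<bar>x\<bar> powr (p + 1)"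
    proof (cases "\<bar>x\<bar> \<le> \<delta>")
      case True
      then have "x\<^sup>2 \<le> \<delta>\<^sup>2" using \<delta>(1) by (simp add: abs_le_square_iff[symmetric])
      then have "K * x\<^sup>2 \<le> e" using K \<delta>(2) by (simp add: field_simps)
      moreover have "0 \<le> a0 * Q * \<bar>x\<bar> powr (p + 1)" using assms Q by simp
      ultimately show ?thesis by linarith
    next
      case False
      have "x\<^sup>2 \<le> 1" using x by (simp add: abs_square_le_1)
      then have "K * x\<^sup>2 \<le> K" using K by (simp add: mult_left_le)
      also have "K = a0 * Q * \<delta> powr (p + 1)" using Q by simp
      also have "\<dots> \<le> a0 * Q * \<bar>x\<bar> powr (p + 1)"
        using False \<delta> assms Q by (intro mult_left_mono powr_mono2) auto
      finally show ?thesis using assms by linarith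
    qed
    finally show "k\<^sup>2 * x\<^sup>2 - e \<le> \<mu> * x\<^sup>2 + a0 * Q * \<bar>x\<bar> powr (p + 1)"
      by (simp add: algebra_simps)
  qed
qed

context
  fixes L p \<mu> A :: real and a :: "real \<Rightarrow> real" and D :: "real set" and n :: nat
  assumes par: "0 \<le> L" "0 < p" "0 \<le> A"
begin

text \<open>
Iterates of the half-turn bound tend to \<open>0\<close> with their argument, so a small initial amplitude keeps the
amplitude small.
\<close>

lemma trajectory_small:
  assumes "0 < M"
  obtains R where "\<And>C \<theta> \<rho> t. prufer_trajectory L p \<mu> A a D C \<theta> \<rho> \<Longrightarrow> \<rho> 0 \<le> R \<Longrightarrow>
    t \<in> {0..L} \<Longrightarrow> \<theta> t \<le> real n * pi \<Longrightarrow> exp (\<rho> t) \<le> M"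
proof -
  obtain \<delta> where \<delta>: "0 < \<delta>" "(half_turn_bound L p \<mu> A ^^ n) \<delta> < M"
    using half_turn_bound_funpow_small[OF par assms] by blast
  show thesis
  proof (rule that[of "ln \<delta>"])
    fix C \<theta> \<rho> t assume tr: "prufer_trajectory L p \<mu> A a D C \<theta> \<rho>" and R: "\<rho> 0 \<le> ln \<delta>"
      and t: "t \<in> {0..L}" "\<theta> t \<le> real n * pi"
    have "exp (\<rho> t) \<le> (half_turn_bound L p \<mu> A ^^ n) (exp (\<rho> 0))"
      using prufer_trajectory.growth_over_half_turns[OF tr] t by auto
    also have "exp (\<rho> 0) \<le> \<delta>" using R \<delta>(1) by (simp add: ln_ge_iff)
    then have "(half_turn_bound L p \<mu> A ^^ n) (exp (\<rho> 0)) \<le> (half_turn_bound L p \<mu> A ^^ n) \<delta>"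
      by (intro half_turn_bound_funpow_mono[OF par]) auto
    finally show "exp (\<rho> t) \<le> M" using \<delta>(2) by simp
  qed
qed

text \<open>
In backward time a present amplitude below \<open>M\<close> bounds the initial one.
\<close>

lemma trajectory_large:
  obtains R where "\<And>C \<theta> \<rho> t. prufer_trajectory L p \<mu> A a D C \<theta> \<rho> \<Longrightarrow> R \<le> \<rho> 0 \<Longrightarrow>
    t \<in> {0..L} \<Longrightarrow> \<theta> t \<le> real n * pi \<Longrightarrow> M \<le> exp (\<rho> t)"
proof -
  define B where "B = (half_turn_bound L p \<mu> A ^^ n) \<bar>M\<bar>"
  have B: "0 \<le> B" unfolding B_def by (intro half_turn_bound_funpow_nonneg[OF par]) simp
  show thesis
  proof (rule that[of "ln (B + 1)"], rule ccontr)
    fix C \<theta> \<rho> t assume tr: "prufer_trajectory L p \<mu> A a D C \<theta> \<rho>" and R: "ln (B + 1) \<le> \<rho> 0"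
      and t: "t \<in> {0..L}" "\<theta> t \<le> real n * pi" and M: "\<not> M \<le> exp (\<rho> t)"
    have "exp (ln (B + 1)) \<le> exp (\<rho> 0)" using R by (simp only: exp_le_cancel_iff)
    then have "B + 1 \<le> exp (\<rho> 0)" using B by simp
    also have "\<dots> \<le> (half_turn_bound L p \<mu> A ^^ n) (exp (\<rho> t))"
      using prufer_trajectory.growth_over_half_turns[OF tr] t by auto
    also have "\<dots> \<le> B" unfolding B_def using M by (intro half_turn_bound_funpow_mono[OF par]) auto
    finally show False by simp
  qed
qed

lemma exp_scaled_eq_powr: "exp ((p - 1) * r) = exp r powr (p - 1)"
  by (simp add: powr_def)

text \<open>
Weak coupling is a small amplitude for \<open>p > 1\<close> and a large one for \<open>p < 1\<close>.
\<close>

lemma coupling_small: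
  assumes "p \<noteq> 1" "0 < \<eta>"
  obtains R where "\<And>C \<theta> \<rho> t. prufer_trajectory L p \<mu> A a D C \<theta> \<rho> \<Longrightarrow> \<rho> 0 = R \<Longrightarrow>
    t \<in> {0..L} \<Longrightarrow> \<theta> t \<le> real n * pi \<Longrightarrow> exp ((p - 1) * \<rho> t) \<le> \<eta>"
proof (cases "1 < p")
  case True
  obtain R where R: "\<And>C \<theta> \<rho> t. prufer_trajectory L p \<mu> A a D C \<theta> \<rho> \<Longrightarrow> \<rho> 0 \<le> R \<Longrightarrow>
    t \<in> {0..L} \<Longrightarrow> \<theta> t \<le> real n * pi \<Longrightarrow> exp (\<rho> t) \<le> \<eta> powr (1 / (p - 1))"
    using trajectory_small[of "\<eta> powr (1 / (p - 1))"] assms(2) by (metis powr_gt_zero less_numeral_extra(3))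
  show thesis
  proof (rule that[of R])
    fix C \<theta> \<rho> t assume tr: "prufer_trajectory L p \<mu> A a D C \<theta> \<rho>" "\<rho> 0 = R"
      "t \<in> {0..L}" "\<theta> t \<le> real n * pi"
    have "exp (\<rho> t) powr (p - 1) \<le> (\<eta> powr (1 / (p - 1))) powr (p - 1)"
      using R[OF tr(1) _ tr(3,4)] tr(2) True by (intro powr_mono2) auto
    also have "\<dots> = \<eta>" using True assms by (simp add: powr_powr)
    finally show "exp ((p - 1) * \<rho> t) \<le> \<eta>" by (simp add: exp_scaled_eq_powr)
  qed
next
  case False
  obtain R where R: "\<And>C \<theta> \<rho> t. prufer_trajectory L p \<mu> A a D C \<theta> \<rho> \<Longrightarrow> R \<le> \<rho> 0 \<Longrightarrow>
    t \<in> {0..L} \<Longrightarrow> \<theta> t \<le> real n * pi \<Longrightarrow> \<eta> powr (1 / (p - 1)) \<le> exp (\<rho> t)"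
    using trajectory_large[of "\<eta> powr (1 / (p - 1))"] by metis
  show thesis
  proof (rule that[of R])
    fix C \<theta> \<rho> t assume tr: "prufer_trajectory L p \<mu> A a D C \<theta> \<rho>" "\<rho> 0 = R"
      "t \<in> {0..L}" "\<theta> t \<le> real n * pi"
    have "exp (\<rho> t) powr (p - 1) \<le> (\<eta> powr (1 / (p - 1))) powr (p - 1)"
      using R[OF tr(1) _ tr(3,4)] tr(2) False assms by (intro powr_mono2') auto
    also have "\<dots> = \<eta>" using assms by (simp add: powr_powr)
    finally show "exp ((p - 1) * \<rho> t) \<le> \<eta>" by (simp add: exp_scaled_eq_powr)
  qed
qed

lemma coupling_large:
  assumes "p \<noteq> 1" "0 < \<eta>"
  obtains R where "\<And>C \<theta> \<rho> t. prufer_trajectory L p \<mu> A a D C \<theta> \<rho> \<Longrightarrow> \<rho> 0 = R \<Longrightarrow>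
    t \<in> {0..L} \<Longrightarrow> \<theta> t \<le> real n * pi \<Longrightarrow> \<eta> \<le> exp ((p - 1) * \<rho> t)"
proof (cases "1 < p")
  case True
  obtain R where R: "\<And>C \<theta> \<rho> t. prufer_trajectory L p \<mu> A a D C \<theta> \<rho> \<Longrightarrow> R \<le> \<rho> 0 \<Longrightarrow>
    t \<in> {0..L} \<Longrightarrow> \<theta> t \<le> real n * pi \<Longrightarrow> \<eta> powr (1 / (p - 1)) \<le> exp (\<rho> t)"
    using trajectory_large[of "\<eta> powr (1 / (p - 1))"] by metis
  show thesis
  proof (rule that[of R])
    fix C \<theta> \<rho> t assume tr: "prufer_trajectory L p \<mu> A a D C \<theta> \<rho>" "\<rho> 0 = R"
      "t \<in> {0..L}" "\<theta> t \<le> real n * pi"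
    have "\<eta> = (\<eta> powr (1 / (p - 1))) powr (p - 1)" using assms by (simp add: powr_powr)
    also have "\<dots> \<le> exp (\<rho> t) powr (p - 1)"
      using R[OF tr(1) _ tr(3,4)] tr(2) True by (intro powr_mono2) auto
    finally show "\<eta> \<le> exp ((p - 1) * \<rho> t)" by (simp add: exp_scaled_eq_powr)
  qed
next
  case False
  obtain R where R: "\<And>C \<theta> \<rho> t. prufer_trajectory L p \<mu> A a D C \<theta> \<rho> \<Longrightarrow> \<rho> 0 \<le> R \<Longrightarrow>
    t \<in> {0..L} \<Longrightarrow> \<theta> t \<le> real n * pi \<Longrightarrow> exp (\<rho> t) \<le> \<eta> powr (1 / (p - 1))"
    using trajectory_small[of "\<eta> powr (1 / (p - 1))"] assms(2) by (metis powr_gt_zero less_numeral_extra(3))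
  show thesis
  proof (rule that[of R])
    fix C \<theta> \<rho> t assume tr: "prufer_trajectory L p \<mu> A a D C \<theta> \<rho>" "\<rho> 0 = R"
      "t \<in> {0..L}" "\<theta> t \<le> real n * pi"
    have "\<eta> = (\<eta> powr (1 / (p - 1))) powr (p - 1)" using assms by (simp add: powr_powr)
    also have "\<dots> \<le> exp (\<rho> t) powr (p - 1)"
      using R[OF tr(1) _ tr(3,4)] tr(2) False by (intro powr_mono2') auto
    finally show "\<eta> \<le> exp ((p - 1) * \<rho> t)" by (simp add: exp_scaled_eq_powr)
  qed
qed

text \<open>
The coupling could become large only for large amplitudes if \<open>p > 1\<close>, and only for small ones if
\<open>p < 1\<close>; for initial amplitudes in a compact range both are out of reach, uniformly in the cap \<open>C\<close>.
This uniformity allows the cap to be chosen afterwards, above the bound.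
\<close>

lemma coupling_bounded:
  obtains K where "\<And>C \<theta> \<rho> t. prufer_trajectory L p \<mu> A a D C \<theta> \<rho> \<Longrightarrow> \<rho> 0 \<in> {R1..R2} \<Longrightarrow>
    t \<in> {0..L} \<Longrightarrow> \<theta> t \<le> real n * pi \<Longrightarrow> exp ((p - 1) * \<rho> t) \<le> K"
proof -
  let ?G = "half_turn_bound L p \<mu> A ^^ n"
  obtain \<delta> where \<delta>: "0 < \<delta>" "?G \<delta> < exp R1"
    using half_turn_bound_funpow_small[OF par, of "exp R1"] by auto
  show thesis
  proof (rule that[of "max (?G (exp R2) powr (p - 1)) (\<delta> powr (p - 1))"])
    fix C \<theta> \<rho> t assume tr: "prufer_trajectory L p \<mu> A a D C \<theta> \<rho>" "\<rho> 0 \<in> {R1..R2}"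
      "t \<in> {0..L}" "\<theta> t \<le> real n * pi"
    note g = prufer_trajectory.growth_over_half_turns[OF tr(1), of t n]
    show "exp ((p - 1) * \<rho> t) \<le> max (?G (exp R2) powr (p - 1)) (\<delta> powr (p - 1))"
    proof (cases "1 \<le> p")
      case True
      have "exp (\<rho> t) \<le> ?G (exp (\<rho> 0))" using g tr by auto
      also have "\<dots> \<le> ?G (exp R2)" using tr(2) by (intro half_turn_bound_funpow_mono[OF par]) auto
      finally have "exp (\<rho> t) powr (p - 1) \<le> ?G (exp R2) powr (p - 1)" using True by (intro powr_mono2) auto
      then show ?thesis by (simp add: exp_scaled_eq_powr)
    next
      case False
      have "\<delta> \<le> exp (\<rho> t)"
      proof (rule ccontr)
        assume "\<not> ?thesis"
        then have "?G (exp (\<rho> t)) \<le> ?G \<delta>" by (intro half_turn_bound_funpow_mono[OF par]) auto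
        moreover have "exp (\<rho> 0) \<le> ?G (exp (\<rho> t))" using g tr by auto
        ultimately have "exp (\<rho> 0) < exp R1" using \<delta>(2) by linarith
        then show False using tr(2) by simp
      qed
      then have "exp (\<rho> t) powr (p - 1) \<le> \<delta> powr (p - 1)" using \<delta>(1) False by (intro powr_mono2') auto
      then show ?thesis by (simp add: exp_scaled_eq_powr)
    qed
  qed
qed

end

text \<open>
The bounds that fix the initial values \<open>Rw\<close> (weak coupling) and \<open>Rs\<close> (strong coupling) and the range
\<open>K\<close> of the coupling in between hold for every cap, so the cap can be taken above \<open>Q\<close>, where strong
coupling begins, and above \<open>K\<close>, where it no longer changes the equation.
\<close>

lemma nodal_trajectory_exists:
  assumes L: "0 < L" and p: "0 < p" "p \<noteq> 1" and n: "1 \<le> n" and \<mu>: "\<mu> < dirichlet_eigenvalue L n"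
    and D: "finite D" and a: "\<And>x. x \<in> {0..L} \<Longrightarrow> 0 \<le> a x \<and> a x \<le> A"
    and conta: "\<And>x. x \<in> {0<..<L} - D \<Longrightarrow> isCont a x"
    and s0: "0 < s0" "s0 \<le> L" and a0: "0 < a0" "\<And>x. x \<in> {0..s0} \<Longrightarrow> a0 \<le> a x"
  obtains C \<theta> \<rho> where "prufer_trajectory L p \<mu> A a D C \<theta> \<rho>" "\<theta> L = real n * pi"
    "\<And>t. t \<in> {0..L} \<Longrightarrow> exp ((p - 1) * \<rho> t) \<le> C"
proof -
  have A: "0 \<le> A" using a[of 0] L by auto
  have par: "0 \<le> L" "0 < p" "0 \<le> A" using L p A by auto
  define N where "N = real n * pi"
  have N: "0 < N" using n by (simp add: N_def)
  \<comment> \<open>A positive \<open>k\<close> with \<open>\<mu> \<le> k\<^sup>2\<close> and \<open>k L < n \<pi>\<close>; the second argument keeps it positive for \<open>\<mu> \<le> 0\<close>.\<close>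
  define kw where "kw = max (sqrt (max \<mu> 0)) (N / (2 * L))"
  have kw: "0 < kw" using N L by (auto simp: kw_def max_def)
  have \<mu>kw: "\<mu> \<le> kw\<^sup>2"
  proof -
    have "\<mu> \<le> (sqrt (max \<mu> 0))\<^sup>2" by simp
    also have "\<dots> \<le> kw\<^sup>2" by (intro power_mono) (auto simp: kw_def)
    finally show ?thesis .
  qed
  have kwN: "kw * L < N"
  proof -
    have "max \<mu> 0 < (N / L)\<^sup>2" using \<mu> N L n by (simp add: dirichlet_eigenvalue_def N_def)
    then have "sqrt (max \<mu> 0) < N / L" using N L by (intro real_less_lsqrt) auto
    moreover have "N / (2 * L) < N / L" using N L by (simp add: field_simps)
    ultimately have "kw < N / L" by (simp add: kw_def)
    then show ?thesis using L by (simp add: field_simps)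
  qed
  define kk where "kk = (kw + 1 / kw) * L"
  have kk: "0 < kk" using kw L by (simp add: kk_def add_pos_pos)
  define ew where "ew = (N - kw * L) / (2 * kk)"
  have ew: "0 < ew" using kwN kk by (simp add: ew_def)
  have ewN: "(kw + ew * (kw + 1 / kw)) * L < N"
  proof -
    have "(kw + ew * (kw + 1 / kw)) * L = kw * L + ew * kk" by (simp add: kk_def algebra_simps)
    also have "ew * kk = (N - kw * L) / 2" using kk by (simp add: ew_def)
    also have "x + (N - x) / 2 < N" if "x < N" for x using that by (simp add: field_simps)
    then have "kw * L + (N - kw * L) / 2 < N" using kwN by blast
    finally show ?thesis .
  qed
  obtain Rw where Rw: "\<And>C \<theta> \<rho> t. prufer_trajectory L p \<mu> A a D C \<theta> \<rho> \<Longrightarrow> \<rho> 0 = Rw \<Longrightarrow>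
    t \<in> {0..L} \<Longrightarrow> \<theta> t \<le> real n * pi \<Longrightarrow> exp ((p - 1) * \<rho> t) \<le> ew / (A + 1)"
    by (rule coupling_small[OF par p(2), of "ew / (A + 1)" \<mu> a D n]) (use ew A in auto)
  \<comment> \<open>Speed \<open>ks\<close> on \<open>[0, s0]\<close> gives the angle \<open>n \<pi> + 1\<close>; the error \<open>es\<close> costs \<open>1 / 2\<close> of it.\<close>
  define ks where "ks = (N + 1) / s0"
  have ks: "0 < ks" "ks * s0 = N + 1" using N s0 by (auto simp: ks_def)
  define es where "es = 1 / (2 * ((ks + 1 / ks) * s0))"
  have es: "0 < es" using ks s0 by (simp add: es_def add_pos_pos)
  have esN: "N < (ks - es * (ks + 1 / ks)) * s0"
  proof -
    have "(ks - es * (ks + 1 / ks)) * s0 = ks * s0 - es * ((ks + 1 / ks) * s0)" by (simp add: algebra_simps)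
    also have "es * ((ks + 1 / ks) * s0) = 1 / 2"
    proof -
      have "0 < (ks + 1 / ks) * s0" using ks s0 by (simp add: add_pos_pos)
      moreover have "1 / (2 * z) * z = 1 / 2" if "0 < z" for z :: real using that by simp
      ultimately show ?thesis unfolding es_def by blast
    qed
    finally show ?thesis using ks by simp
  qed
  obtain Q where Q: "0 < Q" "\<And>x. \<bar>x\<bar> \<le> 1 \<Longrightarrow> ks\<^sup>2 * x\<^sup>2 - es \<le> \<mu> * x\<^sup>2 + a0 * Q * \<bar>x\<bar> powr (p + 1)"
    using strong_coupling_threshold[OF a0(1) es p(1)] by metis
  obtain Rs where Rs: "\<And>C \<theta> \<rho> t. prufer_trajectory L p \<mu> A a D C \<theta> \<rho> \<Longrightarrow> \<rho> 0 = Rs \<Longrightarrow>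
    t \<in> {0..L} \<Longrightarrow> \<theta> t \<le> real n * pi \<Longrightarrow> Q \<le> exp ((p - 1) * \<rho> t)"
    by (rule coupling_large[OF par p(2) Q(1), of \<mu> a D n]) auto
  obtain K where K: "\<And>C \<theta> \<rho> t. prufer_trajectory L p \<mu> A a D C \<theta> \<rho> \<Longrightarrow> \<rho> 0 \<in> {min Rw Rs..max Rw Rs} \<Longrightarrow>
    t \<in> {0..L} \<Longrightarrow> \<theta> t \<le> real n * pi \<Longrightarrow> exp ((p - 1) * \<rho> t) \<le> K"
    by (rule coupling_bounded[OF par, of \<mu> a D "min Rw Rs" "max Rw Rs" n]) auto
  define C where "C = max Q K"
  have C: "0 < C" "Q \<le> C" "K \<le> C" using Q by (auto simp: C_def)
  define \<gamma> where "\<gamma> \<sigma> = (0::real, Rw + \<sigma> * (Rs - Rw))" for \<sigma>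
  let ?F = "prufer_field p \<mu> a C"
  have traj: "prufer_trajectory L p \<mu> A a D C (\<lambda>t. fst (y t)) (\<lambda>t. snd (y t))"
    if "solves_ivp ?F L D (\<gamma> \<sigma>) y" for y \<sigma>
  proof (rule solves_ivp_prufer_field_imp_trajectory[OF L p(1) C(1) D])
    show "0 \<le> a x \<and> a x \<le> A" if "x \<in> {0..L}" for x using a[OF that] .
    show "solves_ivp ?F L D (0, Rw + \<sigma> * (Rs - Rw)) y" using that by (simp add: \<gamma>_def)
  qed
  have init: "snd (y 0) = Rw + \<sigma> * (Rs - Rw)" if "solves_ivp ?F L D (\<gamma> \<sigma>) y" for y \<sigma>
    using that by (simp add: solves_ivp_def \<gamma>_def)
  obtain \<sigma> y where sol: "\<sigma> \<in> {0..1}" "solves_ivp ?F L D (\<gamma> \<sigma>) y" "fst (y L) = N"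
  proof (rule shooting_without_uniqueness[OF L, of ?F "2 * (1 + \<bar>\<mu>\<bar> + A * C)" D fst \<gamma> N])
    show "\<forall>t\<in>{0..L}. \<forall>y. norm (?F t y) \<le> 2 * (1 + \<bar>\<mu>\<bar> + A * C)"
      using prufer_field_bounded[OF p(1) C(1)] a by blast
    show "\<forall>t\<in>{0<..<L} - D. \<forall>y. isCont (\<lambda>x. ?F (fst x) (snd x)) (t, y)"
      using prufer_field_continuous(1)[OF p(1)] conta by blast
    show "\<forall>t\<in>{0..L}. continuous_on UNIV (?F t)"
      using prufer_field_continuous(2)[OF p(1)] by blast
    show "continuous_on UNIV (fst :: real \<times> real \<Rightarrow> real)" by (intro continuous_intros)
    show "continuous_on {0..1} \<gamma>" unfolding \<gamma>_def[abs_def] by (intro continuous_intros)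
    show "\<forall>y. solves_ivp ?F L D (\<gamma> 0) y \<longrightarrow> fst (y L) < N"
    proof (intro allI impI)
      fix y assume y: "solves_ivp ?F L D (\<gamma> 0) y"
      show "fst (y L) < N"
        unfolding N_def
      proof (rule prufer_trajectory.weak_coupling_angle_less[OF traj[OF y] kw \<mu>kw less_imp_le[OF ew]])
        show "(kw + ew * (kw + 1 / kw)) * L < real n * pi" using ewN by (simp add: N_def)
        fix t assume t: "t \<in> {0..L}" "fst (y t) \<le> real n * pi"
        have "A * exp ((p - 1) * snd (y t)) \<le> A * (ew / (A + 1))"
          using Rw[OF traj[OF y] _ t] init[OF y] A by (intro mult_left_mono) auto
        also have "\<dots> \<le> ew" using A ew by (simp add: field_simps)
        finally show "A * exp ((p - 1) * snd (y t)) \<le> ew" .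
      qed
    qed
    show "\<forall>y. solves_ivp ?F L D (\<gamma> 1) y \<longrightarrow> N < fst (y L)"
    proof (intro allI impI)
      fix y assume y: "solves_ivp ?F L D (\<gamma> 1) y"
      show "N < fst (y L)"
        unfolding N_def
      proof (rule prufer_trajectory.strong_coupling_angle_greater[OF traj[OF y] s0 less_imp_le[OF a0(1)] _ ks(1)
            less_imp_le[OF es] _ Q(2) less_imp_le[OF Q(1)]])
        show "a0 \<le> a t" if "t \<in> {0<..<s0}" for t using a0(2) that by simp
        show "real n * pi < (ks - es * (ks + 1 / ks)) * s0" using esN by (simp add: N_def)
        fix t assume t: "t \<in> {0..L}" "fst (y t) \<le> real n * pi"
        show "Q \<le> capped_exp p C (snd (y t))"
          using Rs[OF traj[OF y] _ t] init[OF y] C by (simp add: capped_exp_def)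
      qed auto
    qed
  qed (use that in blast)
  have between: "snd (y 0) \<in> {min Rw Rs..max Rw Rs}"
  proof -
    have "Rw + \<sigma> * (Rs - Rw) = (1 - \<sigma>) * Rw + \<sigma> * Rs" by (simp add: algebra_simps)
    then show ?thesis
      using init[OF sol(2)] sol(1) convex_bound_le[of Rw "max Rw Rs" Rs "1 - \<sigma>" \<sigma>]
        convex_bound_le[of "- Rw" "- min Rw Rs" "- Rs" "1 - \<sigma>" \<sigma>] by auto
  qed
  show thesis
  proof (rule that[OF traj[OF sol(2)]])
    show "fst (y L) = real n * pi" using sol(3) by (simp add: N_def)
    fix t assume t: "t \<in> {0..L}"
    have "fst (y t) \<le> real n * pi"
      using prufer_trajectory.angle_le_before[OF traj[OF sol(2)], of t L n] t sol(3) by (auto simp: N_def)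
    then show "exp ((p - 1) * snd (y t)) \<le> C" using K[OF traj[OF sol(2)] between t] C by simp
  qed
qed

section \<open>From trajectories to nodal solutions\<close>

lemma deriv_within_eq:
  assumes "0 < L" "x \<in> {0..L}" "(u has_real_derivative d) (at x within {0..L})"
  shows "deriv_within 0 L u x = d"
  unfolding deriv_within_def
  using vector_derivative_within_closed_interval[OF assms(1,2)] assms(3)
  by (simp add: has_real_derivative_iff_has_vector_derivative)

lemma is_solutionI:
  assumes L: "0 < L"
    and du: "\<And>x. x \<in> {0..L} \<Longrightarrow> (u has_real_derivative w x) (at x within {0..L})"
    and w: "continuous_on {0..L} w" "abs_continuous_on_interval 0 L w"
    and ae: "AE x in lebesgue. x \<in> {0..L} \<longrightarrow>
        (w has_real_derivative - (\<mu> * u x + a x * (\<bar>u x\<bar> powr (p - 1) * u x))) (at x within {0..L})"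
    and "u 0 = 0" "u L = 0" "\<exists>x\<in>{0..L}. u x \<noteq> 0"
  shows "is_solution L p \<mu> a u"
proof -
  have eq: "deriv_within 0 L u x = w x" if "x \<in> {0..L}" for x
    by (rule deriv_within_eq[OF L that du[OF that]])
  have "u differentiable_on {0..L}"
    unfolding differentiable_on_def using du real_differentiable_def by blast
  moreover have "continuous_on {0..L} (deriv_within 0 L u)"
    by (rule continuous_on_eq[OF w(1)]) (simp add: eq)
  moreover have "abs_continuous_on_interval 0 L (deriv_within 0 L u)"
    by (rule abs_continuous_cong[OF w(2) eq])
  moreover have "AE x in lebesgue. x \<in> {0..L} \<longrightarrow>
        (\<exists>d. (deriv_within 0 L u has_real_derivative d) (at x within {0..L}) \<and>
             - d = \<mu> * u x + a x * (\<bar>u x\<bar> powr (p - 1) * u x))"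
    using ae
  proof (rule AE_mp, intro AE_I2 impI)
    fix x assume x: "x \<in> {0..L}" and "x \<in> {0..L} \<longrightarrow>
        (w has_real_derivative - (\<mu> * u x + a x * (\<bar>u x\<bar> powr (p - 1) * u x))) (at x within {0..L})"
    then have "(w has_vector_derivative - (\<mu> * u x + a x * (\<bar>u x\<bar> powr (p - 1) * u x))) (at x within {0..L})"
      by (simp add: has_real_derivative_iff_has_vector_derivative)
    then have "(deriv_within 0 L u has_vector_derivative - (\<mu> * u x + a x * (\<bar>u x\<bar> powr (p - 1) * u x))) (at x within {0..L})"
      by (rule has_vector_derivative_transform[OF x, rotated]) (simp add: eq)
    then show "\<exists>d. (deriv_within 0 L u has_real_derivative d) (at x within {0..L}) \<and>
             - d = \<mu> * u x + a x * (\<bar>u x\<bar> powr (p - 1) * u x)"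
      by (auto simp: has_real_derivative_iff_has_vector_derivative)
  qed
  ultimately show ?thesis using assms unfolding is_solution_def C1_on_interval_def by blast
qed

lemma nodal_solution_uminus:
  assumes L: "0 < L" and "nodal_solution L p \<mu> a k u"
  shows "nodal_solution L p \<mu> a k (\<lambda>x. - u x)"
proof -
  have sol: "is_solution L p \<mu> a u" using assms by (simp add: nodal_solution_def)
  let ?v = "deriv_within 0 L u"
  note der = is_solution_has_derivative[OF sol]
  have "is_solution L p \<mu> a (\<lambda>x. - u x)"
  proof (rule is_solutionI[OF L])
    show "((\<lambda>x. - u x) has_real_derivative - ?v x) (at x within {0..L})" if "x \<in> {0..L}" for x
      by (rule DERIV_minus[OF der[OF that]])
    show "continuous_on {0..L} (\<lambda>x. - ?v x)"
      using sol by (auto simp: is_solution_def C1_on_interval_def intro: continuous_on_minus)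
    show "abs_continuous_on_interval 0 L (\<lambda>x. - ?v x)"
      using sol by (auto simp: is_solution_def intro: abs_continuous_uminus)
    have "AE x in lebesgue. x \<in> {0..L} \<longrightarrow>
        (\<exists>d. (?v has_real_derivative d) (at x within {0..L}) \<and>
             - d = \<mu> * u x + a x * (\<bar>u x\<bar> powr (p - 1) * u x))"
      using sol by (simp add: is_solution_def)
    then show "AE x in lebesgue. x \<in> {0..L} \<longrightarrow>
        ((\<lambda>x. - ?v x) has_real_derivative - (\<mu> * - u x + a x * (\<bar>- u x\<bar> powr (p - 1) * - u x))) (at x within {0..L})"
    proof (rule AE_mp, intro AE_I2 impI)
      fix x assume "x \<in> {0..L} \<longrightarrow> (\<exists>d. (?v has_real_derivative d) (at x within {0..L}) \<and>
             - d = \<mu> * u x + a x * (\<bar>u x\<bar> powr (p - 1) * u x))" "x \<in> {0..L}"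
      then obtain d where d: "(?v has_real_derivative d) (at x within {0..L})"
        "- d = \<mu> * u x + a x * (\<bar>u x\<bar> powr (p - 1) * u x)" by blast
      have "- (\<mu> * - u x + a x * (\<bar>- u x\<bar> powr (p - 1) * - u x)) = - d"
        unfolding d(2) by simp
      then show "((\<lambda>x. - ?v x) has_real_derivative - (\<mu> * - u x + a x * (\<bar>- u x\<bar> powr (p - 1) * - u x))) (at x within {0..L})"
        using DERIV_minus[OF d(1)] by simp
    qed
  qed (use sol in \<open>auto simp: is_solution_def\<close>)
  moreover have "interior_nodes L (\<lambda>x. - u x) = interior_nodes L u" by (simp add: interior_nodes_def)
  ultimately show ?thesis using assms(2) by (simp add: nodal_solution_def)
qed

context prufer_trajectory
begin

lemma forcing_eq:
  assumes "exp ((p - 1) * \<rho> t) \<le> C"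
  shows "forcing t = a t * (\<bar>u t\<bar> powr (p - 1) * u t)"
proof -
  have "capped_exp p C (\<rho> t) = exp (\<rho> t) powr (p - 1)"
    using assms by (simp add: capped_exp_def powr_def min_def)
  moreover have "\<bar>u t\<bar> powr (p - 1) = exp (\<rho> t) powr (p - 1) * \<bar>sin (\<theta> t)\<bar> powr (p - 1)"
    by (simp add: u_def abs_mult powr_mult)
  ultimately show ?thesis by (simp add: forcing_def signed_pow_def u_def mult_ac)
qed

text \<open>
Off the exceptional set this is known.  As \<open>w\<close> is continuous, the fundamental theorem of calculus
extends it to the exceptional points and the end points.
\<close>

lemma du_within: "x \<in> {0..L} \<Longrightarrow> (u has_real_derivative w x) (at x within {0..L})"
proof -
  assume x: "x \<in> {0..L}"
  have int: "integral {0..y} w = u y - u 0" if y: "y \<in> {0..L}" for y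
  proof (rule integral_unique, rule fundamental_theorem_of_calculus_interior_strong[OF D])
    show "(u has_vector_derivative w t) (at t)" if "t \<in> {0<..<y} - D" for t
      using du[of t] that y by (simp add: has_real_derivative_iff_has_vector_derivative)
    show "continuous_on {0..y} u" using y by (intro continuous_on_subset[OF cont_u]) auto
  qed (use y in auto)
  have "((\<lambda>y. integral {0..y} w) has_vector_derivative w x) (at x within {0..L})"
    by (rule integral_has_vector_derivative[OF cont_w x])
  then have "((\<lambda>y. integral {0..y} w + u 0) has_vector_derivative w x) (at x within {0..L})"
    using has_vector_derivative_add[OF _ has_vector_derivative_const] by fastforce
  then have "(u has_vector_derivative w x) (at x within {0..L})"
    by (rule has_vector_derivative_transform[OF x, rotated]) (simp add: int)
  then show ?thesis by (simp add: has_real_derivative_iff_has_vector_derivative)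
qed

lemma w_abs_continuous: "abs_continuous_on_interval 0 L w"
proof -
  obtain B where B: "0 < B" "\<And>x. x \<in> {0..L} \<Longrightarrow> \<bar>u x\<bar> \<le> B"
    by (rule continuous_on_Icc_bounded[OF cont_u]) (rule that)
  define M where "M = \<bar>\<mu>\<bar> * B + A * B powr p + 1"
  have M: "0 < M" using B A_nonneg by (simp add: M_def add_nonneg_pos)
  have bd: "\<bar>- (\<mu> * u x + forcing x)\<bar> \<le> M" if x: "x \<in> {0..L}" for x
  proof -
    define \<sigma> :: real where "\<sigma> = (if 0 \<le> u x then 1 else - 1)"
    have \<sigma>: "\<sigma> = 1 \<or> \<sigma> = - 1" "\<sigma> * u x = \<bar>u x\<bar>" by (auto simp: \<sigma>_def)
    have "0 \<le> \<sigma> * forcing x \<and> \<sigma> * forcing x \<le> A * \<bar>u x\<bar> powr p"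
      using forcing_bounds[OF x \<sigma>(1)] \<sigma>(2) by simp
    then have "\<bar>forcing x\<bar> \<le> A * \<bar>u x\<bar> powr p" using \<sigma>(1) by auto
    also have "\<dots> \<le> A * B powr p" using B(2)[OF x] p A_nonneg by (intro mult_left_mono powr_mono2) auto
    finally have "\<bar>forcing x\<bar> \<le> A * B powr p" .
    moreover have "\<bar>\<mu> * u x\<bar> \<le> \<bar>\<mu>\<bar> * B" using B(2)[OF x] by (simp add: abs_mult mult_left_mono)
    ultimately show ?thesis unfolding M_def by linarith
  qed
  show ?thesis
  proof (rule lipschitz_imp_abs_continuous[OF _ less_imp_le[OF M]])
    fix x y assume xy: "0 \<le> x" "x \<le> y" "y \<le> L"
    have c: "continuous_on {x..y} w" using xy by (intro continuous_on_subset[OF cont_w]) auto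
    have d: "(w has_real_derivative - (\<mu> * u t + forcing t)) (at t)" if "t \<in> {x<..<y} - D" for t
      using dw[of t] that xy by auto
    have b: "- (\<mu> * u t + forcing t) \<le> M" "- M \<le> - (\<mu> * u t + forcing t)" if "t \<in> {x<..<y} - D" for t
      using bd[of t] that xy by (auto simp: abs_le_iff)
    have "w y - w x \<le> M * (y - x)"
      by (rule deriv_le_imp_increment_le[OF D xy(2) c d b(1)])
    moreover have "- M * (y - x) \<le> w y - w x"
      by (rule deriv_ge_imp_increment_ge[OF D xy(2) c d b(2)])
    ultimately show "\<bar>w y - w x\<bar> \<le> M * (y - x)" by (simp add: abs_le_iff)
  qed
qed

lemma trajectory_is_solution:
  assumes C': "\<And>t. t \<in> {0..L} \<Longrightarrow> exp ((p - 1) * \<rho> t) \<le> C" and \<theta>_L: "\<theta> L = real n * pi"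
  shows "is_solution L p \<mu> a u"
proof (rule is_solutionI[OF L du_within cont_w w_abs_continuous])
  have "D \<union> {0, L} \<in> null_sets lebesgue"
    using D by (intro null_sets_completionI finite_imp_null_set_lborel) auto
  then show "AE x in lebesgue. x \<in> {0..L} \<longrightarrow>
      (w has_real_derivative - (\<mu> * u x + a x * (\<bar>u x\<bar> powr (p - 1) * u x))) (at x within {0..L})"
  proof (rule AE_I')
    have "(w has_real_derivative - (\<mu> * u x + a x * (\<bar>u x\<bar> powr (p - 1) * u x))) (at x within {0..L})"
      if x: "x \<in> {0..L}" "x \<notin> D \<union> {0, L}" for x
    proof -
      have "(w has_real_derivative - (\<mu> * u x + forcing x)) (at x)" using x by (intro dw) auto
      then show ?thesis
        unfolding forcing_eq[OF C'[OF x(1)]] by (rule has_field_derivative_at_within)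
    qed
    then show "{x \<in> space lebesgue. \<not> (x \<in> {0..L} \<longrightarrow>
        (w has_real_derivative - (\<mu> * u x + a x * (\<bar>u x\<bar> powr (p - 1) * u x))) (at x within {0..L}))}
        \<subseteq> D \<union> {0, L}"
      by blast
  qed
  show "u 0 = 0" by (simp add: u_def \<theta>_0)
  show "u L = 0" by (simp add: u_def \<theta>_L)
  show "\<exists>x\<in>{0..L}. u x \<noteq> 0"
  proof (rule ccontr)
    assume "\<not> ?thesis"
    then have "(u has_vector_derivative 0) (at 0 within {0..L})"
      using L by (intro has_vector_derivative_transform[of 0 "{0..L}" u "\<lambda>_. 0"] has_vector_derivative_const) auto
    then have "w 0 = 0"
      using du_within[of 0] L deriv_within_eq[of L 0 u]
      by (metis atLeastAtMost_iff has_real_derivative_iff_has_vector_derivative less_imp_le order_refl)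
    then show False by (simp add: w_def \<theta>_0)
  qed
qed

text \<open>
By \<open>angle_passes_node\<close> the angle takes each value \<open>j \<pi>\<close> at most once, and by continuity it takes each
of \<open>\<pi>, \<dots>, (n - 1) \<pi>\<close>; the values \<open>0\<close> and \<open>n \<pi>\<close> belong to the end points.
\<close>

lemma card_interior_nodes:
  assumes n: "1 \<le> n" and \<theta>_L: "\<theta> L = real n * pi"
  shows "finite (interior_nodes L u) \<and> card (interior_nodes L u) = n - 1"
proof -
  have "\<exists>x. x \<in> {0..L} \<and> \<theta> x = real j * pi" if "j < n" for j
    using IVT'[of \<theta> 0 "real j * pi" L] cont_\<theta> \<theta>_0 \<theta>_L that L by auto
  then obtain z where z: "\<And>j. j < n \<Longrightarrow> z j \<in> {0..L} \<and> \<theta> (z j) = real j * pi" by metis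
  have uniq: "x = y" if "x \<in> {0..L}" "y \<in> {0..L}" "\<theta> x = real j * pi" "\<theta> y = real j * pi" for x y j
    using angle_passes_node[of x y j] angle_passes_node[of y x j] that by (cases x y rule: linorder_cases) auto
  have "interior_nodes L u = z ` {1..<n}"
  proof (rule set_eqI, rule iffI)
    fix x assume "x \<in> interior_nodes L u"
    then have x: "0 < x" "x < L" "sin (\<theta> x) = 0" by (auto simp: interior_nodes_def u_def)
    then obtain i :: int where i: "\<theta> x = of_int i * pi" by (auto simp: sin_zero_iff_int2)
    have "0 < \<theta> x" using angle_passes_node[of 0 x 0] x \<theta>_0 by auto
    moreover have "\<theta> x < real n * pi"
    proof (rule ccontr)
      assume "\<not> ?thesis"
      then have "real n * pi \<le> \<theta> x" by simp
      then show False using angle_passes_node[of x L n] x \<theta>_L by simp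
    qed
    ultimately have "0 < real_of_int i * pi" "real_of_int i * pi < real n * pi" unfolding i by simp_all
    then have "0 < real_of_int i" "real_of_int i < real n" by (simp_all add: zero_less_mult_iff)
    then have "0 < i" "i < int n" by linarith+
    then have ij: "nat i \<in> {1..<n}" "\<theta> x = real (nat i) * pi" using i by auto
    have "x = z (nat i)" using z[of "nat i"] ij x by (intro uniq[of x "z (nat i)" "nat i"]) auto
    then show "x \<in> z ` {1..<n}" using ij by blast
  next
    fix x assume "x \<in> z ` {1..<n}"
    then obtain j where j: "x = z j" "1 \<le> j" "j < n" by auto
    have x: "x \<in> {0..L}" "\<theta> x = real j * pi" using z j by auto
    moreover have "x \<noteq> 0" using x(2) j \<theta>_0 by auto
    moreover have "x \<noteq> L" using x(2) j \<theta>_L by auto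
    ultimately show "x \<in> interior_nodes L u" by (auto simp: interior_nodes_def u_def)
  qed
  moreover have "inj_on z {1..<n}"
  proof (rule inj_onI)
    fix i j assume "i \<in> {1..<n}" "j \<in> {1..<n}" "z i = z j"
    moreover have "\<theta> (z i) = real i * pi" "\<theta> (z j) = real j * pi" using calculation(1,2) z by simp_all
    ultimately have "real i * pi = real j * pi" by (simp only:)
    then show "i = j" by simp
  qed
  ultimately show ?thesis by (simp add: card_image)
qed

end

section \<open>Existence, necessity and multiplicity\<close>

text \<open>
What the existence and the necessity part use of the weight: it is bounded, continuous off the finitely
many points \<open>t i\<close> and \<open>s i\<close>, and bounded below by a positive constant on the first interval.
\<close>

lemma admissible_weight_props:
  assumes adm: "admissible_weight L m t s a"
  obtains A a0 s0 D where "finite D" "\<And>x. x \<in> {0..L} \<Longrightarrow> 0 \<le> a x \<and> a x \<le> A"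
    "\<And>x. x \<in> {0<..<L} - D \<Longrightarrow> isCont a x"
    "0 < s0" "s0 \<le> L" "0 < a0" "\<And>x. x \<in> {0..s0} \<Longrightarrow> a0 \<le> a x"
proof -
  have t0: "t 0 = 0" and sm: "s m = L" and ts: "\<And>i. i \<le> m \<Longrightarrow> t i < s i"
    and st: "\<And>j. j < m \<Longrightarrow> s j < t (Suc j)"
    and nn: "\<And>x. x \<in> {0..L} \<Longrightarrow> 0 \<le> a x"
    and cont: "\<And>i. i \<le> m \<Longrightarrow> continuous_on {t i..s i} a"
    and pos: "\<And>i x. i \<le> m \<Longrightarrow> x \<in> {t i..s i} \<Longrightarrow> 0 < a x"
    and gap: "\<And>j x. j < m \<Longrightarrow> x \<in> {s j<..<t (Suc j)} \<Longrightarrow> a x = 0"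
    using adm unfolding admissible_weight_def by blast+
  have cover: "(\<exists>i\<le>k. x \<in> {t i..s i}) \<or> (\<exists>j<k. x \<in> {s j<..<t (Suc j)})"
    if "k \<le> m" "0 \<le> x" "x \<le> s k" for k x
    using that
  proof (induction k)
    case 0
    then show ?case using t0 by auto
  next
    case (Suc k)
    consider "x \<le> s k" | "x \<in> {s k<..<t (Suc k)}" | "x \<in> {t (Suc k)..s (Suc k)}"
      using Suc.prems by force
    then show ?case
    proof cases
      case 1
      then show ?thesis using Suc by (meson Suc_leD le_SucI less_SucI)
    qed auto
  qed
  have s_mono: "s 0 \<le> s k" if "k \<le> m" for k
    using that
  proof (induction k)
    case (Suc k)
    then show ?case using st[of k] ts[of "Suc k"] by simp
  qed simp
  have "\<exists>B\<ge>0. \<forall>x\<in>{t i..s i}. a x \<le> B" if "i \<le> m" for i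
  proof -
    have "{t i..s i} \<noteq> {}" using ts[OF that] by simp
    from continuous_attains_sup[OF compact_Icc this cont[OF that]]
    obtain x where x: "x \<in> {t i..s i}" "\<forall>y\<in>{t i..s i}. a y \<le> a x" by blast
    then show ?thesis using pos[OF that x(1)] by (intro exI[of _ "a x"]) auto
  qed
  then obtain B where B: "\<And>i. i \<le> m \<Longrightarrow> 0 \<le> B i" "\<And>i x. i \<le> m \<Longrightarrow> x \<in> {t i..s i} \<Longrightarrow> a x \<le> B i"
    by metis
  define A where "A = (\<Sum>i\<le>m. B i)"
  have BA: "B i \<le> A" if "i \<le> m" for i
    unfolding A_def using that B(1) by (intro member_le_sum) auto
  have A0: "0 \<le> A" unfolding A_def using B(1) by (intro sum_nonneg) auto
  have "{t 0..s 0} \<noteq> {}" using ts[of 0] by simp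
  from continuous_attains_inf[OF compact_Icc this cont[of 0]]
  obtain x0 where x0: "x0 \<in> {t 0..s 0}" "\<forall>y\<in>{t 0..s 0}. a x0 \<le> a y" by auto
  show thesis
  proof (rule that[of "t ` {..m} \<union> s ` {..m}" A "s 0" "a x0"])
    show "0 \<le> a x \<and> a x \<le> A" if x: "x \<in> {0..L}" for x
    proof -
      consider i where "i \<le> m" "x \<in> {t i..s i}" | j where "j < m" "x \<in> {s j<..<t (Suc j)}"
        using cover[of m x] x sm by auto
      then have "a x \<le> A"
      proof cases
        case 1
        then show ?thesis using B(2) BA order_trans by blast
      next
        case 2
        then show ?thesis using gap A0 by simp
      qed
      then show ?thesis using nn[OF x] by simp
    qed
    show "isCont a x" if x: "x \<in> {0<..<L} - (t ` {..m} \<union> s ` {..m})" for x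
    proof -
      consider i where "i \<le> m" "x \<in> {t i..s i}" | j where "j < m" "x \<in> {s j<..<t (Suc j)}"
        using cover[of m x] x sm by auto
      then show ?thesis
      proof cases
        case 1
        then have "x \<in> {t i<..<s i}" using x by (auto simp: order.strict_iff_order)
        moreover have "continuous_on {t i<..<s i} a" using cont[OF 1(1)] by (rule continuous_on_subset) auto
        ultimately show ?thesis using continuous_on_eq_continuous_at open_greaterThanLessThan by blast
      next
        case 2
        have "continuous_on {s j<..<t (Suc j)} (\<lambda>x. 0::real)" by simp
        then have "continuous_on {s j<..<t (Suc j)} a"
          by (rule continuous_on_eq) (simp add: gap[OF 2(1)])
        then show ?thesis using 2 continuous_on_eq_continuous_at open_greaterThanLessThan by blast
      qed
    qed
    show "0 < s 0" using ts[of 0] t0 by simp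
    show "s 0 \<le> L" using s_mono[of m] sm by simp
    show "0 < a x0" using pos[of 0] x0 by simp
    show "a x0 \<le> a x" if "x \<in> {0..s 0}" for x using x0 t0 that by simp
  qed auto
qed

lemma nodal_solution_exists:
  assumes L: "0 < L" and adm: "admissible_weight L m t s a" and p: "0 < p" "p \<noteq> 1"
    and n: "1 \<le> n" and \<mu>: "\<mu> < dirichlet_eigenvalue L n"
  obtains u where "nodal_solution L p \<mu> a (n - 1) u" "0 < deriv_within 0 L u 0"
proof -
  obtain A a0 s0 D where w: "finite D" "\<And>x. x \<in> {0..L} \<Longrightarrow> 0 \<le> a x \<and> a x \<le> A"
    "\<And>x. x \<in> {0<..<L} - D \<Longrightarrow> isCont a x"
    "0 < s0" "s0 \<le> L" "0 < a0" "\<And>x. x \<in> {0..s0} \<Longrightarrow> a0 \<le> a x"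
    by (rule admissible_weight_props[OF adm]) (rule that)
  obtain C \<theta> \<rho> where tr: "prufer_trajectory L p \<mu> A a D C \<theta> \<rho>" "\<theta> L = real n * pi"
    "\<And>t. t \<in> {0..L} \<Longrightarrow> exp ((p - 1) * \<rho> t) \<le> C"
    by (rule nodal_trajectory_exists[OF L p n \<mu> w]) (assumption | rule that)+
  interpret prufer_trajectory L p \<mu> A a D C \<theta> \<rho> by fact
  show thesis
  proof (rule that[of u])
    show "nodal_solution L p \<mu> a (n - 1) u"
      using trajectory_is_solution[OF tr(3,2)] card_interior_nodes[OF n tr(2)]
      by (simp add: nodal_solution_def)
    have "deriv_within 0 L u 0 = w 0" using L by (intro deriv_within_eq du_within) auto
    then show "0 < deriv_within 0 L u 0" by (simp add: w_def \<theta>_0)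
  qed
qed

lemma nodal_solution_imp_less:
  assumes L: "0 < L" and adm: "admissible_weight L m t s a" and p: "0 < p"
    and n: "1 \<le> n" and sol: "nodal_solution L p \<mu> a (n - 1) u"
  shows "\<mu> < dirichlet_eigenvalue L n"
proof (rule ccontr)
  assume "\<not> \<mu> < dirichlet_eigenvalue L n"
  then have \<mu>: "dirichlet_eigenvalue L n \<le> \<mu>" by simp
  obtain A a0 s0 D where w: "finite D" "\<And>x. x \<in> {0..L} \<Longrightarrow> 0 \<le> a x \<and> a x \<le> A"
    "\<And>x. x \<in> {0<..<L} - D \<Longrightarrow> isCont a x"
    "0 < s0" "s0 \<le> L" "0 < a0" "\<And>x. x \<in> {0..s0} \<Longrightarrow> a0 \<le> a x"
    by (rule admissible_weight_props[OF adm]) (rule that)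
  have "is_solution L p \<mu> a u" using sol by (simp add: nodal_solution_def)
  then have ls: "lipschitz_solution L p \<mu> a u (deriv_within 0 L u)"
    by (rule is_solution_imp_lipschitz_solution[OF L p _ w(2)])
  have "n \<le> card (interior_nodes L u)"
  proof (rule card_interior_nodes_ge[OF ls L n \<mu> _ w(4)])
    show "0 < a x" if "x \<in> {0<..<s0}" for x using w(6) w(7)[of x] that by auto
  qed (use w(2) sol in \<open>auto simp: nodal_solution_def\<close>)
  then show False using sol n by (simp add: nodal_solution_def)
qed

lemma solution_neq_uminus:
  assumes "nodal_solution L p \<mu> a k u"
  shows "\<exists>x\<in>{0..L}. u x \<noteq> - u x"
  using assms by (auto simp: nodal_solution_def is_solution_def)

theorem theorem1p1:
  fixes L p :: real and m :: nat and t s :: "nat \<Rightarrow> real" and a :: "real \<Rightarrow> real"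
  assumes "L > 0"
    and "admissible_weight L m t s a"
    and "p > 0" and "p \<noteq> 1"
  shows "(\<forall>\<mu>. \<forall>n\<ge>1.
            (\<exists>u. nodal_solution L p \<mu> a (n - 1) u) \<longleftrightarrow> \<mu> < dirichlet_eigenvalue L n)
       \<and> (\<forall>\<mu>. \<forall>n\<ge>1. \<mu> < dirichlet_eigenvalue L n \<longrightarrow>
            (\<exists>u. nodal_solution L p \<mu> a (n - 1) u \<and> deriv_within 0 L u 0 > 0 \<and>
                 nodal_solution L p \<mu> a (n - 1) (\<lambda>x. - u x) \<and>
                 (\<exists>x\<in>{0..L}. u x \<noteq> - u x)))
       \<and> (\<forall>\<mu><dirichlet_eigenvalue L 1. \<forall>\<kappa>\<ge>1. two_nodal_solutions L p \<mu> a (\<kappa> - 1))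
       \<and> (\<forall>n\<ge>1. \<forall>\<kappa>\<ge>n. \<forall>\<mu>\<in>{dirichlet_eigenvalue L n..<dirichlet_eigenvalue L (n + 1)}.
            two_nodal_solutions L p \<mu> a \<kappa>)"
proof -
  have ex: "\<exists>u. nodal_solution L p \<mu> a (n - 1) u \<and> deriv_within 0 L u 0 > 0 \<and>
      nodal_solution L p \<mu> a (n - 1) (\<lambda>x. - u x) \<and> (\<exists>x\<in>{0..L}. u x \<noteq> - u x)"
    if n: "1 \<le> n" and \<mu>: "\<mu> < dirichlet_eigenvalue L n" for n \<mu>
  proof -
    obtain u where u: "nodal_solution L p \<mu> a (n - 1) u" "0 < deriv_within 0 L u 0"
      using nodal_solution_exists[OF assms n \<mu>] by blast
    then show ?thesis
      using nodal_solution_uminus[OF assms(1) u(1)] solution_neq_uminus[OF u(1)] by blast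
  qed
  have mono: "dirichlet_eigenvalue L i \<le> dirichlet_eigenvalue L j" if "i \<le> j" for i j
    using that \<open>L > 0\<close> unfolding dirichlet_eigenvalue_def
    by (intro power_mono divide_right_mono mult_right_mono) auto
  have two: "two_nodal_solutions L p \<mu> a (n - 1)"
    if "1 \<le> n" "\<mu> < dirichlet_eigenvalue L n" for n \<mu>
    using ex[OF that] unfolding two_nodal_solutions_def by blast
  show ?thesis
  proof (intro conjI allI impI ballI)
    fix \<mu> and n :: nat assume n: "n \<ge> 1"
    show "(\<exists>u. nodal_solution L p \<mu> a (n - 1) u) \<longleftrightarrow> \<mu> < dirichlet_eigenvalue L n"
      using ex[OF n] nodal_solution_imp_less[OF assms(1-3) n] by blast
  next
    fix \<mu> and n :: nat assume "n \<ge> 1" "\<mu> < dirichlet_eigenvalue L n"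
    then show "\<exists>u. nodal_solution L p \<mu> a (n - 1) u \<and> deriv_within 0 L u 0 > 0 \<and>
      nodal_solution L p \<mu> a (n - 1) (\<lambda>x. - u x) \<and> (\<exists>x\<in>{0..L}. u x \<noteq> - u x)"
      by (rule ex)
  next
    fix \<mu> and \<kappa> :: nat assume "\<mu> < dirichlet_eigenvalue L 1" "1 \<le> \<kappa>"
    then show "two_nodal_solutions L p \<mu> a (\<kappa> - 1)"
      using two[of \<kappa> \<mu>] mono[of 1 \<kappa>] by simp
  next
    fix n \<kappa> :: nat and \<mu>
    assume "1 \<le> n" "n \<le> \<kappa>" "\<mu> \<in> {dirichlet_eigenvalue L n..<dirichlet_eigenvalue L (n + 1)}"
    then show "two_nodal_solutions L p \<mu> a \<kappa>"
      using two[of "\<kappa> + 1" \<mu>] mono[of "n + 1" "\<kappa> + 1"] by simp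
  qed
qed

end
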